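(* Let $q\ge 3$ be a prime power and let $m$ be an integer with $2\le m\le q-1$. Let $\mathtt{G}=m(P_2+\ldots+P_q)$ and $\mathtt{D}=Q_1+\ldots+Q_{q^2-1}$ be the divisors on the Hermitian curve $\mathcal{H}_q$ described in the context. Then the functional algebraic geometry code $C_{\mathcal{L}}(\mathtt{D},\mathtt{G})$ is an $$[q^2-1,\ \tfrac12 m(m-1)+1,\ d]_{q^2}$$ linear code whose minimum distance $d$ satisfies $$q^2-1-(q(m-1)-1)\ \le\ d\ \le\ q^2-1-(m-2)(q+1).$$ The improvement on the designed minimum distance $\delta=q^2-1-\deg(\mathtt{G})=q^2-1-m(q-1)$ is at least $q+1-m$, i.e. $d-\delta\ge q+1-m$.
   Context: $\mathcal{H}_q$ is the Hermitian curve over $\mathbb{F}_{q^2}$ with homogeneous equation $X_2^qX_3+X_2X_3^q-X_1^{q+1}=0$ (affine equation $Y^q+Y=X^{q+1}$ with $X=X_1/X_3$, $Y=X_2/X_3$). Put $P_1=O=(0:0:1)$, $P_{q+1}=Y_\infty=(0:1:0)$, and let $P_2,\ldots,P_q$ be the $q-1$ points $(0:b:1)$ with $b\in\mathbb{F}_{q^2}$, $b\ne 0$, $b^q+b=0$. The Riemann-Roch space $\mathcal{L}(\mathtt{G})$ is the $\mathbb{F}_{q^2}$-space of functions $f$ in the function field $\mathbb{F}_{q^2}(x,y)$, $y^q+y=x^{q+1}$, with $f=0$ or $\mathrm{div}(f)+\mathtt{G}\ge 0$. Fix $u,v\in\mathbb{F}_{q^2}$ with $u\neq0$ and $v^q+v=u^{q+1}$,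 and a generator $\omega$ of $\mathbb{F}_{q^2}^*$; the points $Q_i=(\omega^iu:\omega^{(q+1)i}v:1)$, $i=1,\ldots,q^2-1$, are pairwise distinct points of $\mathcal{H}_q$. The code $C_{\mathcal{L}}(\mathtt{D},\mathtt{G})\subseteq\mathbb{F}_{q^2}^{q^2-1}$ is the image of the evaluation map $f\mapsto (f(Q_1),\ldots,f(Q_{q^2-1}))$ on $\mathcal{L}(\mathtt{G})$. An $[n,k,d]_{q^2}$ code is a $k$-dimensional linear code of length $n$ over $\mathbb{F}_{q^2}$ with minimum Hamming distance $d$. *)

theory Defs
  imports
    "HOL-Analysis.Analysis"
    "HOL-Number_Theory.Prime_Powers"
    "HOL-Computational_Algebra.Polynomial_Factorial"
    "HOL-Algebra.Algebraic_Closure_Type"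
    "HOL-Library.Poly_Mapping"
begin

text \<open>
  All function fields considered here are subfields of a fixed algebraic closure of the rational
  function field \<open>F(x)\<close>, where \<open>F\<close> is the type \<open>'a\<close>.
\<close>

type_synonym 'a ambient = "'a poly fract alg_closure"

definition ff_const :: "'a::field \<Rightarrow> 'a ambient" where
  "ff_const c = to_ac (to_fract [:c:])"

definition ff_x :: "'a::field ambient" where
  "ff_x = to_ac (to_fract [:0, 1:])"

text \<open>The subfield \<open>F(x, y)\<close>; in the application \<open>y\<close> is a root of \<open>Y\<^sup>q + Y = x\<^bsup>q+1\<^esup>\<close>.\<close>

definition function_field :: "'a::field ambient \<Rightarrow> 'a ambient set" where
  "function_field y = {poly (map_poly to_ac p) y / poly (map_poly to_ac r) y | p r.
     poly (map_poly to_ac r) y \<noteq> 0}"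

text \<open>
  A place of \<open>F(x, y) / F\<close> (of arbitrary degree) is represented by its normalised discrete
  valuation, trivial on \<open>F\<close>. The value at \<open>0\<close>, which should be infinite, and the values outside
  the function field are set to \<open>0\<close>, so that a place is determined as a function on the
  ambient type.
\<close>

definition is_place :: "'a::field ambient \<Rightarrow> ('a ambient \<Rightarrow> int) \<Rightarrow> bool" where
  "is_place y P \<longleftrightarrow>
     (\<forall>f. f = 0 \<or> f \<notin> function_field y \<longrightarrow> P f = 0) \<and>
     (\<forall>f\<in>function_field y - {0}. \<forall>g\<in>function_field y - {0}. P (f * g) = P f + P g) \<and>
     (\<forall>f\<in>function_field y - {0}. \<forall>g\<in>function_field y - {0}.
        f + g \<noteq> 0 \<longrightarrow> P (f + g) \<ge> min (P f) (P g)) \<and>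
     (\<forall>c. P (ff_const c) = 0) \<and>
     (\<exists>t\<in>function_field y. P t = 1)"

definition place_ring :: "'a::field ambient \<Rightarrow> ('a ambient \<Rightarrow> int) \<Rightarrow> 'a ambient set" where
  "place_ring y P = {f \<in> function_field y. f = 0 \<or> P f \<ge> 0}"

definition place_ideal :: "'a::field ambient \<Rightarrow> ('a ambient \<Rightarrow> int) \<Rightarrow> 'a ambient set" where
  "place_ideal y P = {f \<in> function_field y. f = 0 \<or> P f > 0}"

text \<open>
  The degree of a place is the dimension over \<open>F\<close> of its residue class field; \<open>B\<close> below is a set
  of representatives in the valuation ring of an \<open>F\<close>-basis of the residue class field.
\<close>

definition place_degree :: "'a::field ambient \<Rightarrow> ('a ambient \<Rightarrow> int) \<Rightarrow> nat" where
  "place_degree y P = (THE n. \<exists>B. finite B \<and> card B = n \<and> B \<subseteq> place_ring y P \<and>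
     (\<forall>f\<in>place_ring y P. \<exists>!c. c \<in> B \<rightarrow>\<^sub>E UNIV \<and>
        f - (\<Sum>b\<in>B. ff_const (c b) * b) \<in> place_ideal y P))"

text \<open>
  The place centred at the affine point \<open>(a : b : 1)\<close>. It is unique because the points considered
  are nonsingular.
\<close>

definition place_at :: "'a::field ambient \<Rightarrow> 'a \<Rightarrow> 'a \<Rightarrow> ('a ambient \<Rightarrow> int)" where
  "place_at y a b = (THE P. is_place y P \<and>
     ff_x - ff_const a \<in> place_ideal y P \<and> y - ff_const b \<in> place_ideal y P)"

text \<open>Residue class of \<open>f\<close> at a place of degree one, i.e. the value of \<open>f\<close> at the point.\<close>

definition value_at :: "'a::field ambient \<Rightarrow> ('a ambient \<Rightarrow> int) \<Rightarrow> 'a ambient \<Rightarrow> 'a" where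
  "value_at y P f = (THE c. f - ff_const c \<in> place_ideal y P)"

text \<open>Divisors are elements of the free abelian group on the places.\<close>

type_synonym 'a divisor = "('a ambient \<Rightarrow> int) \<Rightarrow>\<^sub>0 int"

definition divisor_degree :: "'a::field ambient \<Rightarrow> 'a divisor \<Rightarrow> int" where
  "divisor_degree y G =
     (\<Sum>P\<in>Poly_Mapping.keys G. Poly_Mapping.lookup G P * int (place_degree y P))"

text \<open>The condition on \<open>f\<close> is \<open>f = 0\<close> or \<open>div f + G \<ge> 0\<close>, read off at every place.\<close>

definition riemann_roch_space :: "'a::field ambient \<Rightarrow> 'a divisor \<Rightarrow> 'a ambient set" where
  "riemann_roch_space y G = {f \<in> function_field y.
     f = 0 \<or> (\<forall>P. is_place y P \<longrightarrow> P f + Poly_Mapping.lookup G P \<ge> 0)}"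

text \<open>The divisor \<open>D\<close> enters through the family \<open>Q\<close> of the places in its support.\<close>

definition functional_ag_code ::
    "'a::field ambient \<Rightarrow> ('n::finite \<Rightarrow> 'a ambient \<Rightarrow> int) \<Rightarrow> 'a divisor \<Rightarrow> ('a ^ 'n) set" where
  "functional_ag_code y Q G = (\<lambda>f. \<chi> i. value_at y (Q i) f) ` riemann_roch_space y G"

definition hamming_dist :: "'a ^ 'n::finite \<Rightarrow> 'a ^ 'n \<Rightarrow> nat" where
  "hamming_dist c c' = card {i. c $ i \<noteq> c' $ i}"

definition is_linear_code :: "('a::field ^ 'n::finite) set \<Rightarrow> nat \<Rightarrow> nat \<Rightarrow> nat \<Rightarrow> bool" where
  "is_linear_code C n k d \<longleftrightarrow>
     vec.subspace C \<and> CARD('n) = n \<and> vec.dim C = k \<and>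
     (\<exists>c\<in>C. \<exists>c'\<in>C. c \<noteq> c' \<and> hamming_dist c c' = d) \<and>
     (\<forall>c\<in>C. \<forall>c'\<in>C. c \<noteq> c' \<longrightarrow> d \<le> hamming_dist c c')"

text \<open>
  The divisor \<open>m (P\<^sub>2 + \<dots> + P\<^sub>q)\<close>, where the \<open>P\<^sub>j\<close> are the places at the points
  \<open>(0 : b : 1)\<close> with \<open>b \<noteq> 0\<close> and \<open>b\<^sup>q + b = 0\<close>.
\<close>

definition hermitian_G :: "nat \<Rightarrow> 'a::field ambient \<Rightarrow> nat \<Rightarrow> 'a divisor" where
  "hermitian_G q y m =
     frag_cmul (int m) (\<Sum>b\<in>{b. b \<noteq> 0 \<and> b ^ q + b = 0}. frag_of (place_at y 0 b))"

definition hermitian_Q ::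
    "nat \<Rightarrow> 'a::field ambient \<Rightarrow> 'a \<Rightarrow> 'a \<Rightarrow> 'a \<Rightarrow> nat \<Rightarrow> ('a ambient \<Rightarrow> int)" where
  "hermitian_Q q y \<omega> u v i = place_at y (\<omega> ^ i * u) (\<omega> ^ ((q + 1) * i) * v)"

end

theory Submission
  imports Defs
begin

text \<open>
  A function \<open>f\<close> with poles of order at most \<open>m\<close> at \<open>P\<^sub>2, \<dots>, P\<^sub>q\<close> and no others becomes, after
  multiplication by \<open>x\<^sup>m\<close>, regular at all affine places, hence a polynomial in \<open>x\<close> and \<open>y\<close>. The
  monomials of this polynomial have distinct orders at infinity and at the origin, so each of them
  satisfies the order conditions by itself; this leaves the basis \<open>1\<close>, \<open>y\<^sup>j / x\<^sup>s\<close> with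
  \<open>1 \<le> j < s \<le> m\<close>. All points \<open>Q\<^sub>i\<close> lie on the curve \<open>y = \<kappa> x\<^sup>q\<^sup>+\<^sup>1\<close>, on which \<open>y\<^sup>j / x\<^sup>s\<close> is a
  constant times \<open>x\<^bsup>(q+1)j-s\<^esup>\<close>, and \<open>x\<close> takes every nonzero value exactly once. So the code
  consists of the evaluations of polynomials with exponents \<open>(q+1)j - s \<le> q(m-1) - 1\<close>, which gives
  the dimension and the lower bound. The upper bound comes from
  \<open>x\<^sup>-\<^sup>m y (y - \<beta>\<^sub>1) \<cdots> (y - \<beta>\<^sub>m\<^sub>-\<^sub>2)\<close>, where each value \<open>\<beta>\<^sub>l\<close> of \<open>y\<close> is taken at \<open>q + 1\<close> points.

  Places are constructed by embedding the function field into fields of Laurent series: the power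
  series \<open>w\<close> with \<open>w\<^sup>q + w = g\<close> is the composition of \<open>g\<close> with the compositional inverse of
  \<open>X\<^sup>q + X\<close>.
\<close>

hide_const (open) Polynomials.degree Polynomials.lead_coeff up_ring.coeff up_ring.monom module.smult
  Divisibility.prime
no_notation fps_nth (infixl \<open>$\<close> 75)

section \<open>Evaluation of bivariate polynomials\<close>

text \<open>The definitions set two unequal tasks. \<open>riemann_roch_space\<close> quantifies over
  all places, of every degree, so placing \<open>y^j / x^s\<close> in it takes a case analysis of an
  arbitrary place by its orders at x and y. The converse inclusion takes only enough explicit places
  to test a function against: those over the roots, in the algebraic closure of F, of a denominator,
  one at infinity and one at the origin. As \<open>place_at\<close> and \<open>place_degree\<close>
  are definite descriptions, the place at a rational point must also be shown unique, and its degree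
  independent of the chosen basis.

  Mapping the function field into Laurent series presupposes that the curve equation generates all
  relations between x and y; this rests on their pole orders \<open>q\<close> and
  \<open>q + 1\<close> at infinity.

  The improvement comes from counting zeros differently: the degree of the divisor allows
  \<open>m(q-1)\<close> of them, a polynomial of degree at most \<open>q(m-1) - 1\<close> in x
  allows only that many, and the difference is \<open>q + 1 - m\<close>.\<close>

definition uhom :: "('r::comm_ring_1 \<Rightarrow> 's::comm_ring_1) \<Rightarrow> bool" where
  "uhom h \<longleftrightarrow> h 1 = 1 \<and> (\<forall>a b. h (a + b) = h a + h b) \<and> (\<forall>a b. h (a * b) = h a * h b)"

lemma uhom_1: "uhom h \<Longrightarrow> h 1 = 1"
  and uhom_add: "uhom h \<Longrightarrow> h (a + b) = h a + h b"
  and uhom_mult: "uhom h \<Longrightarrow> h (a * b) = h a * h b"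
  by (auto simp: uhom_def)

lemma uhom_0: "uhom h \<Longrightarrow> h 0 = 0"
  using uhom_add[of h 0 0] by simp

lemma uhom_uminus: "uhom h \<Longrightarrow> h (- a) = - h a"
  using uhom_add[of h a "- a"] uhom_0[of h] by (simp add: eq_neg_iff_add_eq_0 add.commute)

lemma uhom_diff: "uhom h \<Longrightarrow> h (a - b) = h a - h b"
  using uhom_add[of h a "- b"] uhom_uminus[of h b] by simp

lemma uhom_power: "uhom h \<Longrightarrow> h (a ^ n) = h a ^ n"
  by (induction n) (auto simp: uhom_def)

lemma uhom_prod: "uhom h \<Longrightarrow> h (prod f A) = (\<Prod>i\<in>A. h (f i))"
  by (induction A rule: infinite_finite_induct) (simp_all add: uhom_1[of h] uhom_mult[of h])

lemma uhom_of_nat: "uhom h \<Longrightarrow> h (of_nat n) = of_nat n"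
  by (induction n) (simp_all add: uhom_0[of h] uhom_1[of h] uhom_add[of h])

lemma uhom_comp: "uhom g \<Longrightarrow> uhom h \<Longrightarrow> uhom (\<lambda>x. g (h x))"
  by (simp add: uhom_def)

lemma uhom_id: "uhom (\<lambda>x. x)"
  by (simp add: uhom_def)

lemma uhom_nonzero:
  fixes h :: "'r::field \<Rightarrow> 's::comm_ring_1"
  assumes "uhom h" "a \<noteq> 0"
  shows "h a \<noteq> 0"
proof
  assume "h a = 0"
  moreover have "h (a * inverse a) = h a * h (inverse a)"
    by (rule uhom_mult[OF assms(1)])
  ultimately show False using assms uhom_1[of h] by simp
qed

lemma uhom_eq_0_iff:
  fixes h :: "'r::field \<Rightarrow> 's::comm_ring_1"
  shows "uhom h \<Longrightarrow> h a = 0 \<longleftrightarrow> a = 0"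
  using uhom_nonzero[of h a] uhom_0[of h] by metis

lemma uhom_eq_iff:
  fixes h :: "'r::field \<Rightarrow> 's::comm_ring_1"
  shows "uhom h \<Longrightarrow> h a = h b \<longleftrightarrow> a = b"
  using uhom_eq_0_iff[of h "a - b"] uhom_diff[of h a b] by simp

text \<open>Coefficients pass through a homomorphism \<open>h\<close> because the same polynomial
  over F is evaluated in F itself, in the ambient field, and in Laurent series over F or over its
  algebraic closure.\<close>

definition ev1 :: "('r::comm_ring_1 \<Rightarrow> 's::comm_ring_1) \<Rightarrow> 's \<Rightarrow> 'r poly \<Rightarrow> 's" where
  "ev1 h \<xi> p = poly (map_poly h p) \<xi>"

lemma ev1_pCons [simp]: "uhom h \<Longrightarrow> ev1 h \<xi> (pCons a p) = h a + \<xi> * ev1 h \<xi> p"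
  by (simp add: ev1_def map_poly_pCons uhom_0[of h])

lemma ev1_0 [simp]: "ev1 h \<xi> 0 = 0"
  by (simp add: ev1_def)

lemma ev1_altdef:
  assumes "uhom h" "degree p \<le> n"
  shows "ev1 h \<xi> p = (\<Sum>i\<le>n. h (coeff p i) * \<xi> ^ i)"
proof -
  have "ev1 h \<xi> p = (\<Sum>i\<le>degree (map_poly h p). h (coeff p i) * \<xi> ^ i)"
    unfolding ev1_def poly_altdef by (simp add: coeff_map_poly uhom_0[OF assms(1)])
  also have "\<dots> = (\<Sum>i\<le>n. h (coeff p i) * \<xi> ^ i)"
    using map_poly_degree_leq[of h p] uhom_0[OF assms(1)] assms(2)
  proof (intro sum.mono_neutral_left ballI)
    fix i assume "i \<in> {..n} - {..degree (map_poly h p)}"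
    hence "coeff (map_poly h p) i = 0" by (intro coeff_eq_0) auto
    thus "h (coeff p i) * \<xi> ^ i = 0" by (simp add: coeff_map_poly uhom_0[OF assms(1)])
  qed auto
  finally show ?thesis .
qed

lemma ev1_add: "uhom h \<Longrightarrow> ev1 h \<xi> (p + q) = ev1 h \<xi> p + ev1 h \<xi> q"
  by (induction p q rule: poly_induct2) (simp_all add: uhom_add[of h] algebra_simps)

lemma ev1_smult: "uhom h \<Longrightarrow> ev1 h \<xi> (smult c q) = h c * ev1 h \<xi> q"
  by (induction q) (simp_all add: uhom_mult[of h] algebra_simps)

lemma ev1_mult: "uhom h \<Longrightarrow> ev1 h \<xi> (p * q) = ev1 h \<xi> p * ev1 h \<xi> q"
  by (induction p) (simp_all add: ev1_add ev1_smult uhom_0[of h] algebra_simps)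

lemma uhom_ev1: "uhom h \<Longrightarrow> uhom (ev1 h \<xi>)"
  unfolding uhom_def[of "ev1 h \<xi>"] by (simp add: ev1_add ev1_mult one_pCons uhom_1[of h] del: pCons_one)

lemma ev1_monom: "uhom h \<Longrightarrow> ev1 h \<xi> (monom c n) = h c * \<xi> ^ n"
  by (simp add: ev1_def map_poly_monom poly_monom uhom_0[of h])

lemma ev1_id: "ev1 (\<lambda>x. x) \<xi> p = poly p \<xi>"
  by (simp add: ev1_def)

definition ev2 :: "('r::comm_ring_1 \<Rightarrow> 's::comm_ring_1) \<Rightarrow> 's \<Rightarrow> 's \<Rightarrow> 'r poly poly \<Rightarrow> 's" where
  "ev2 h \<xi> \<eta> P = ev1 (ev1 h \<xi>) \<eta> P"

lemma uhom_ev2: "uhom h \<Longrightarrow> uhom (ev2 h \<xi> \<eta>)"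
  unfolding ev2_def by (intro uhom_ev1)

lemma ev2_pCons [simp]: "uhom h \<Longrightarrow> ev2 h \<xi> \<eta> (pCons a p) = ev1 h \<xi> a + \<eta> * ev2 h \<xi> \<eta> p"
  by (simp add: ev2_def uhom_ev1)

lemma ev2_0 [simp]: "ev2 h \<xi> \<eta> 0 = 0"
  by (simp add: ev2_def)

text \<open>A bivariate polynomial \<open>\<Sum> c\<^sub>i\<^sub>j x\<^sup>i y\<^sup>j\<close> is a polynomial in \<open>y\<close> over \<open>F[x]\<close>;
  the pairs are \<open>(j, i)\<close>.\<close>

definition supp2 :: "'a::zero poly poly \<Rightarrow> (nat \<times> nat) set" where
  "supp2 P = {(j, i). coeff (coeff P j) i \<noteq> 0}"

lemma supp2_sub: "supp2 P \<subseteq> (SIGMA j:{..degree P}. {..degree (coeff P j)})"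
proof clarify
  fix j i assume "(j, i) \<in> supp2 P"
  hence nz: "coeff (coeff P j) i \<noteq> 0" by (simp add: supp2_def)
  hence "coeff P j \<noteq> 0" by (metis coeff_0)
  thus "j \<in> {..degree P} \<and> i \<in> {..degree (coeff P j)}" using nz by (simp add: le_degree)
qed

lemma finite_supp2: "finite (supp2 P)"
  by (rule finite_subset[OF supp2_sub]) auto

lemma supp2_nonempty: "P \<noteq> 0 \<Longrightarrow> supp2 P \<noteq> {}"
proof -
  assume "P \<noteq> 0"
  hence "(degree P, degree (lead_coeff P)) \<in> supp2 P" by (simp add: supp2_def)
  thus ?thesis by blast
qed

lemma ev2_supp2:
  assumes "uhom h"
  shows "ev2 h \<xi> \<eta> P = (\<Sum>(j, i)\<in>supp2 P. h (coeff (coeff P j) i) * \<xi> ^ i * \<eta> ^ j)"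
proof -
  have "ev2 h \<xi> \<eta> P = (\<Sum>j\<le>degree P. ev1 h \<xi> (coeff P j) * \<eta> ^ j)"
    unfolding ev2_def by (rule ev1_altdef) (auto simp: uhom_ev1 assms)
  also have "\<dots> = (\<Sum>j\<le>degree P. \<Sum>i\<le>degree (coeff P j). h (coeff (coeff P j) i) * \<xi> ^ i * \<eta> ^ j)"
    by (simp add: ev1_altdef[OF assms order.refl] sum_distrib_right)
  also have "\<dots> = (\<Sum>(j, i)\<in>(SIGMA j:{..degree P}. {..degree (coeff P j)}). h (coeff (coeff P j) i) * \<xi> ^ i * \<eta> ^ j)"
    by (subst sum.Sigma) auto
  also have "\<dots> = (\<Sum>(j, i)\<in>supp2 P. h (coeff (coeff P j) i) * \<xi> ^ i * \<eta> ^ j)"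
    by (rule sum.mono_neutral_right) (use supp2_sub in \<open>auto simp: supp2_def uhom_0[OF assms]\<close>)
  finally show ?thesis .
qed

section \<open>Generic points of the Hermitian curve\<close>

text \<open>The term of least order is unique, so nothing can cancel its leading
  coefficient.\<close>

lemma fls_subdegree_sum_distinct:
  fixes a :: "'i \<Rightarrow> 'b::comm_monoid_add fls"
  assumes "finite I" "I \<noteq> {}" "\<And>i. i \<in> I \<Longrightarrow> a i \<noteq> 0" "inj_on (\<lambda>i. fls_subdegree (a i)) I"
  shows "sum a I \<noteq> 0 \<and> (\<forall>i\<in>I. fls_subdegree (sum a I) \<le> fls_subdegree (a i))"
proof -
  define d where "d = (\<lambda>i. fls_subdegree (a i))"
  define n where "n = Min (d ` I)"
  have "n \<in> d ` I" unfolding n_def by (rule Min_in) (use assms(1,2) in auto)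
  then obtain k where k: "k \<in> I" "d k = n" by auto
  have le: "n \<le> d i" if "i \<in> I" for i using that assms unfolding n_def by auto
  have lt: "n < d i" if "i \<in> I" "i \<noteq> k" for i
  proof -
    have "d i \<noteq> d k" using inj_onD[OF assms(4), of i k] that k(1) unfolding d_def by blast
    thus ?thesis using le[OF that(1)] k(2) by linarith
  qed
  have "fls_nth (sum a I) n = fls_nth (a k) n"
    unfolding fls_nth_sum using lt
    by (subst sum.remove[OF assms(1) k(1)], subst sum.neutral) (auto simp: d_def)
  hence nz: "fls_nth (sum a I) n \<noteq> 0" using k assms(3) by (auto simp: d_def)
  show ?thesis
    using fls_nonzeroI[OF nz] fls_subdegree_leI[OF nz] le by (auto simp: d_def intro: order.trans)
qed

text \<open>One order condition on a polynomial thereby becomes a condition on each of its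
  monomials. This serves with two different weights, at infinity and at the origin.\<close>

lemma ev2_fls_distinct:
  fixes h :: "'a::field \<Rightarrow> 'b::field"
  assumes "uhom h" "P \<noteq> 0" "\<xi> \<noteq> 0" "\<eta> \<noteq> 0"
    "inj_on (\<lambda>(j, i). int i * fls_subdegree \<xi> + int j * fls_subdegree \<eta>) (supp2 P)"
  shows "ev2 (\<lambda>c. fls_const (h c)) \<xi> \<eta> P \<noteq> 0 \<and>
    (\<forall>(j, i)\<in>supp2 P. fls_subdegree (ev2 (\<lambda>c. fls_const (h c)) \<xi> \<eta> P) \<le>
       int i * fls_subdegree \<xi> + int j * fls_subdegree \<eta>)"
proof -
  have uh: "uhom (\<lambda>c. fls_const (h c))"
    using assms(1) by (auto simp: uhom_def fls_plus_const)
  define a where "a = (\<lambda>(j, i). fls_const (h (coeff (coeff P j) i)) * \<xi> ^ i * \<eta> ^ j)"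
  have nz: "a k \<noteq> 0 \<and> fls_subdegree (a k) = (\<lambda>(j, i). int i * fls_subdegree \<xi> + int j * fls_subdegree \<eta>) k"
    if "k \<in> supp2 P" for k
    using that assms(1,3,4) 
    by (auto simp: a_def supp2_def uhom_eq_0_iff[of h] fls_subdegree_pow)
  have "inj_on (\<lambda>k. fls_subdegree (a k)) (supp2 P)"
    by (subst inj_on_cong[of _ _ "\<lambda>(j, i). int i * fls_subdegree \<xi> + int j * fls_subdegree \<eta>"])
       (use nz assms(5) in auto)
  from fls_subdegree_sum_distinct[OF finite_supp2 supp2_nonempty[OF assms(2)] _ this]
  have "sum a (supp2 P) \<noteq> 0 \<and> (\<forall>i\<in>supp2 P. fls_subdegree (sum a (supp2 P)) \<le> fls_subdegree (a i))"
    using nz by blast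
  moreover have "ev2 (\<lambda>c. fls_const (h c)) \<xi> \<eta> P = sum a (supp2 P)"
    unfolding ev2_supp2[OF uh] a_def ..
  ultimately show ?thesis using nz by auto
qed

section \<open>The curve equation as a monic polynomial in y\<close>

definition herm_poly :: "nat \<Rightarrow> 'a::comm_ring_1 poly poly" where
  "herm_poly q = monom 1 q + (monom 1 1 - [:monom 1 (q + 1):])"

lemma degree_herm_poly:
  assumes "q \<ge> 2"
  shows "degree (herm_poly q :: 'a::comm_ring_1 poly poly) = q" "lead_coeff (herm_poly q :: 'a poly poly) = 1"
    and "herm_poly q \<noteq> (0 :: 'a poly poly)"
proof -
  have "degree (monom 1 1 - [:monom 1 (q + 1):] :: 'a poly poly) < q"
    using assms by (intro degree_diff_less) (auto intro: le_less_trans[OF degree_monom_le])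
  thus *: "degree (herm_poly q :: 'a poly poly) = q"
    unfolding herm_poly_def by (subst degree_add_eq_left) (auto simp: degree_monom_eq)
  show **: "lead_coeff (herm_poly q :: 'a poly poly) = 1"
    unfolding * using assms by (simp add: herm_poly_def coeff_pCons split: nat.split)
  show "herm_poly q \<noteq> (0 :: 'a poly poly)"
    using ** by auto
qed

lemma ev2_herm_poly: "uhom h \<Longrightarrow> ev2 h \<xi> \<eta> (herm_poly q) = \<eta> ^ q + \<eta> - \<xi> ^ (q + 1)"
proof -
  assume h: "uhom h"
  have "ev2 h \<xi> \<eta> (monom 1 n) = \<eta> ^ n" for n
    unfolding ev2_def by (simp add: ev1_monom uhom_ev1 h uhom_1[OF uhom_ev1[OF h]])
  moreover have "ev2 h \<xi> \<eta> [:monom 1 (q + 1):] = \<xi> ^ (q + 1)"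
    by (simp only: ev2_pCons[OF h] ev1_monom[OF h]) (simp add: h uhom_1[OF h])
  ultimately show ?thesis
    unfolding herm_poly_def uhom_add[OF uhom_ev2[OF h]] uhom_diff[OF uhom_ev2[OF h]] by simp
qed

lemma herm_poly_division:
  fixes P :: "'a::comm_ring_1 poly poly"
  assumes "q \<ge> 2"
  obtains Q R where "P = herm_poly q * Q + R" "degree R < q"
proof -
  obtain Q R where QR: "pseudo_divmod P (herm_poly q) = (Q, R)" by fastforce
  \<comment> \<open>The divisor is monic, so the power of its leading coefficient in pseudo-division
    is 1.\<close>
  have "P = herm_poly q * Q + R"
    using pseudo_divmod(1)[OF degree_herm_poly(3)[OF assms] QR] degree_herm_poly(2)[OF assms, where ?'a = 'a] by simp
  moreover have "degree R < q"
    using pseudo_divmod(2)[OF degree_herm_poly(3)[OF assms] QR] degree_herm_poly(1)[OF assms, where ?'a = 'a] assms by auto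
  ultimately show ?thesis using that by blast
qed

text \<open>Generic points of the curve with coordinates in an extension field.\<close>

definition herm_point :: "nat \<Rightarrow> ('a::field \<Rightarrow> 'c::field) \<Rightarrow> 'c \<Rightarrow> 'c \<Rightarrow> bool" where
  "herm_point q h \<xi> \<eta> \<longleftrightarrow> uhom h \<and> \<eta> ^ q + \<eta> = \<xi> ^ (q + 1) \<and> (\<forall>p. p \<noteq> 0 \<longrightarrow> ev1 h \<xi> p \<noteq> 0)"

section \<open>Power series solutions of the curve equation\<close>

lemma fps_additive_solve:
  fixes g :: "'a::field fps"
  assumes "q \<ge> 2" "fps_nth g 0 = 0"
  obtains w where "w ^ q + w = g" "fps_nth w 0 = 0"
proof -
  define a :: "'a fps" where "a = fps_X ^ q + fps_X"
  define w where "w = fps_inv a oo g"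
  \<comment> \<open>Since \<open>q >= 2\<close>, the linear coefficient of \<open>a\<close> is 1,
    which makes \<open>a\<close> invertible under composition.\<close>
  have a: "fps_nth a 0 = 0" "fps_nth a 1 \<noteq> 0" "fps_nth (fps_inv a) 0 = 0"
    using assms by (auto simp: a_def fps_inv_def)
  have w0: "fps_nth w 0 = 0" unfolding w_def using a by simp
  have "a oo w = (a oo fps_inv a) oo g"
    unfolding w_def by (rule fps_compose_assoc) (use a assms in auto)
  also have "\<dots> = g"
    by (subst fps_inv_right) (use a assms in auto)
  also have "a oo w = w ^ q + w"
    using w0 by (simp add: a_def fps_compose_add_distrib flip: fps_compose_power)
  finally show ?thesis using w0 that by blast
qed

text \<open>As \<open>w\<close> has positive order, it dominates \<open>w^q\<close>, and its order
  must be that of the right-hand side.\<close>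

lemma series_root_order:
  fixes w :: "'a::field fps"
  assumes q: "q \<ge> 2" and eq: "fps_to_fls w ^ q + fps_to_fls w = fls_X ^ (q + 1)" and "fps_nth w 0 = 0"
  shows "fps_to_fls w \<noteq> 0" "fls_subdegree (fps_to_fls w) = int (q + 1)"
proof -
  define z where "z = fps_to_fls w"
  show "fps_to_fls w \<noteq> 0"
  proof
    assume "fps_to_fls w = 0"
    thus False using eq q by (auto simp: zero_power)
  qed
  hence nz: "z \<noteq> 0" by (simp add: z_def)
  have "fls_subdegree z > 0"
    using assms(3) nz unfolding z_def by (intro fls_subdegree_greaterI) auto
  hence "fls_subdegree z < fls_subdegree (z ^ q)"
    using q by (simp add: fls_subdegree_pow)
  hence "fls_subdegree (z ^ q + z) = fls_subdegree z"
    by (rule fls_subdegree_add_eq2[OF nz])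
  thus "fls_subdegree (fps_to_fls w) = int (q + 1)" using eq by (simp add: z_def)
qed

text \<open>Dehomogenising with \<open>z = X3/X2\<close> and \<open>t = X1/X2\<close> gives
  \<open>z^q + z = t^(q+1)\<close> again, now centred at the point at infinity. Solve this for
  \<open>z\<close> with parameter \<open>t\<close> and return to \<open>y = 1/z\<close>,
  \<open>x = t/z\<close>.\<close>

lemma hermitian_infinity:
  fixes q :: nat
  assumes "q \<ge> 2"
  obtains \<xi> \<eta> :: "'a::field fls" where "\<eta> ^ q + \<eta> = \<xi> ^ (q + 1)" "\<xi> \<noteq> 0" "\<eta> \<noteq> 0"
    "fls_subdegree \<xi> = - int q" "fls_subdegree \<eta> = - int (q + 1)"
proof -
  obtain w :: "'a fps" where w: "w ^ q + w = fps_X ^ (q + 1)" "fps_nth w 0 = 0"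
    using fps_additive_solve[of q "fps_X ^ (q + 1)"] assms by auto
  define Z where "Z = fps_to_fls w"
  have eq: "Z ^ q + Z = fls_X ^ (q + 1)"
    using arg_cong[OF w(1), of fps_to_fls] by (simp only: Z_def fps_to_fls_power fps_to_fls_plus fps_X_to_fls)
  from series_root_order[OF assms eq[unfolded Z_def] w(2)]
  have Znz: "Z \<noteq> 0" and sZ: "fls_subdegree Z = int (q + 1)" by (simp_all add: Z_def)
  show ?thesis
  proof (rule that[of "1 / Z" "fls_X / Z"])
    have "(1 / Z) ^ q + 1 / Z = (Z ^ q + Z) / Z ^ (q + 1)"
      using Znz by (simp add: field_simps)
    thus "(1 / Z) ^ q + 1 / Z = (fls_X / Z) ^ (q + 1)"
      unfolding eq by (simp add: power_divide)
    show "fls_subdegree (fls_X / Z) = - int q" "fls_subdegree (1 / Z) = - int (q + 1)"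
      using Znz sZ by (simp_all add: fls_divide_subdegree)
  qed (use Znz in auto)
qed

text \<open>Up to sign the weight is congruent to \<open>j\<close> modulo \<open>q\<close>, and
  \<open>j < q\<close> makes \<open>j\<close> the remainder itself.\<close>

lemma inj_on_weights:
  "inj_on (\<lambda>(j, i). int i * - int q + int j * - int (q + 1)) {(j, i). j < q}"
proof (rule inj_onI, clarify)
  fix j i j' i'
  assume j: "j < q" "j' < q" and "int i * - int q + int j * - int (q + 1) = int i' * - int q + int j' * - int (q + 1)"
  hence "int (i * q + j * (q + 1)) = int (i' * q + j' * (q + 1))" by (simp add: algebra_simps)
  hence eq: "i * q + j * (q + 1) = i' * q + j' * (q + 1)" by (simp only: of_nat_eq_iff)
  have "(i * q + j * (q + 1)) mod q = j" if "j < q" for i j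
  proof -
    have "i * q + j * (q + 1) = j + (i + j) * q" by (simp add: algebra_simps)
    thus ?thesis using that by simp
  qed
  with eq j have "j = j'" by metis
  with eq j show "j = j' \<and> i = i'" by auto
qed

lemma ev2_infinity:
  fixes P :: "'a::field poly poly" and \<xi> \<eta> :: "'a fls"
  assumes "\<xi> \<noteq> 0" "\<eta> \<noteq> 0" "fls_subdegree \<xi> = - int q" "fls_subdegree \<eta> = - int (q + 1)"
    "P \<noteq> 0" "degree P < q"
  shows "ev2 fls_const \<xi> \<eta> P \<noteq> 0 \<and>
    (\<forall>(j, i)\<in>supp2 P. fls_subdegree (ev2 fls_const \<xi> \<eta> P) \<le> int i * - int q + int j * - int (q + 1))"
proof -
  have "supp2 P \<subseteq> {(j, i). j < q}"
    using assms(6) supp2_sub[of P] by auto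
  thus ?thesis
    using ev2_fls_distinct[OF uhom_id assms(5,1,2)] assms(3,4)
      inj_on_subset[OF inj_on_weights, of "supp2 P" q] by simp
qed

lemma uhom_fls_const: "uhom h \<Longrightarrow> uhom (\<lambda>c. fls_const (h c))"
  by (auto simp: uhom_def fls_plus_const)

lemma herm_point_infinity:
  fixes \<xi> \<eta> :: "'a::field fls"
  assumes "q \<ge> 2" "\<eta> ^ q + \<eta> = \<xi> ^ (q + 1)" "\<xi> \<noteq> 0" "\<eta> \<noteq> 0"
    "fls_subdegree \<xi> = - int q" "fls_subdegree \<eta> = - int (q + 1)"
  shows "herm_point q fls_const \<xi> \<eta>"
proof -
  have h: "uhom (fls_const :: 'a \<Rightarrow> _)" using uhom_fls_const[OF uhom_id] .
  \<comment> \<open>A polynomial in x alone has degree 0 in y, so the bound at infinity covers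
    it.\<close>
  have "ev1 fls_const \<xi> p \<noteq> 0" if "p \<noteq> 0" for p
    using ev2_infinity[OF assms(3-6), of "[:p:]"] that assms(1) by (simp add: h)
  thus ?thesis unfolding herm_point_def using h assms(2) by blast
qed

text \<open>The completion at infinity shows that \<open>Y\<^sup>q + Y - x\<^sup>q\<^sup>+\<^sup>1\<close> has no factor of
  smaller degree, hence generates the ideal of relations of every generic point.\<close>

lemma herm_point_low_degree:
  fixes R :: "'a::field poly poly"
  assumes q: "q \<ge> 2" and pt: "herm_point q h \<xi> \<eta>" and "ev2 h \<xi> \<eta> R = 0" "degree R < q"
  shows "R = 0"
proof (rule ccontr)
  assume "R \<noteq> 0"
  note h = pt[unfolded herm_point_def, THEN conjunct1]
  define B where "B = (\<lambda>R. R \<noteq> 0 \<and> degree R < q \<and> ev2 h \<xi> \<eta> R = 0)"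
  define S where "S = arg_min degree B"
  have "B R" using \<open>R \<noteq> 0\<close> assms by (auto simp: B_def)
  hence S: "B S" and min: "\<And>T. B T \<Longrightarrow> degree S \<le> degree T"
    unfolding S_def using arg_min_natI[of B R degree] arg_min_nat_le[of B _ degree] by auto
  have S0: "S \<noteq> 0" using S by (simp add: B_def)
  \<comment> \<open>Coefficients lie in F[x], hence pseudo-division. The remainder is a relation of
    smaller degree and vanishes by minimality of \<open>S\<close>.\<close>
  obtain Q T where QT: "pseudo_divmod (herm_poly q) S = (Q, T)" by fastforce
  define c where "c = lead_coeff S ^ (Suc (degree (herm_poly q :: 'a poly poly)) - degree S)"
  have c0: "c \<noteq> 0" using S0 by (simp add: c_def)
  have eq: "smult c (herm_poly q) = S * Q + T" and T: "T = 0 \<or> degree T < degree S"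
    using pseudo_divmod[OF S0 QT] by (auto simp: c_def)
  have "ev2 h \<xi> \<eta> (smult c (herm_poly q)) = ev2 h \<xi> \<eta> S * ev2 h \<xi> \<eta> Q + ev2 h \<xi> \<eta> T"
    unfolding eq by (simp add: uhom_add[OF uhom_ev2[OF h]] uhom_mult[OF uhom_ev2[OF h]])
  moreover have "ev2 h \<xi> \<eta> (smult c (herm_poly q)) = 0"
    using pt unfolding ev2_def ev1_smult[OF uhom_ev1[OF h]]
    using ev2_herm_poly[OF h, of \<xi> \<eta> q] by (simp add: herm_point_def ev2_def)
  ultimately have "ev2 h \<xi> \<eta> T = 0" using S by (simp add: B_def)
  hence "T = 0" using T min[of T] S unfolding B_def by fastforce
  hence eq: "smult c (herm_poly q) = S * Q" using eq by simp
  have Q0: "Q \<noteq> 0" using eq c0 degree_herm_poly(3)[OF q, where ?'a='a] by auto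
  have "degree S \<noteq> 0"
  proof
    assume "degree S = 0"
    then obtain s where s: "S = [:s:]" by (metis degree_eq_zeroE)
    hence "ev1 h \<xi> s = 0" using S h by (simp add: B_def)
    thus False using pt s S0 by (auto simp: herm_point_def)
  qed
  moreover have "degree S + degree Q = q"
    using arg_cong[OF eq, of degree] c0 S0 Q0 degree_herm_poly(1)[OF q, where ?'a='a]
    by (simp add: degree_mult_eq)
  ultimately have dQ: "degree Q < q" by auto
  \<comment> \<open>Both factors have degree below \<open>q\<close>, so neither vanishes at
    infinity; but their product is a multiple of the curve equation and does.\<close>
  obtain \<xi>' \<eta>' :: "'a fls" where \<xi>': "\<eta>' ^ q + \<eta>' = \<xi>' ^ (q + 1)" "\<xi>' \<noteq> 0" "\<eta>' \<noteq> 0"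
    "fls_subdegree \<xi>' = - int q" "fls_subdegree \<eta>' = - int (q + 1)"
    by (rule hermitian_infinity[OF q])
  have h': "uhom (fls_const :: 'a \<Rightarrow> _)" using uhom_fls_const[OF uhom_id] .
  have "ev2 fls_const \<xi>' \<eta>' (smult c (herm_poly q)) = 0"
    unfolding ev2_def ev1_smult[OF uhom_ev1[OF h']]
    using ev2_herm_poly[OF h', of \<xi>' \<eta>' q] \<xi>'(1) by (simp add: ev2_def)
  hence "ev2 fls_const \<xi>' \<eta>' S * ev2 fls_const \<xi>' \<eta>' Q = 0"
    unfolding eq uhom_mult[OF uhom_ev2[OF h']] .
  thus False
    using ev2_infinity[OF \<xi>'(2-5), of S] ev2_infinity[OF \<xi>'(2-5), of Q] S0 Q0 S dQ
    by (auto simp: B_def)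
qed

text \<open>The right-hand side does not mention the point: all generic points satisfy the same
  relations, which is what allows functions to be carried from one to another.\<close>

lemma herm_point_zero_iff:
  assumes q: "q \<ge> 2" and pt: "herm_point q h \<xi> \<eta>"
  shows "ev2 h \<xi> \<eta> P = 0 \<longleftrightarrow> herm_poly q dvd P"
proof -
  note h = pt[unfolded herm_point_def, THEN conjunct1]
  obtain Q R where QR: "P = herm_poly q * Q + R" "degree R < q"
    using herm_poly_division[OF q] by blast
  have hp: "ev2 h \<xi> \<eta> (herm_poly q) = 0"
    using pt ev2_herm_poly[OF h, of \<xi> \<eta> q] by (simp add: herm_point_def)
  have "ev2 h \<xi> \<eta> P = ev2 h \<xi> \<eta> R"
    unfolding QR(1) by (simp add: uhom_add[OF uhom_ev2[OF h]] uhom_mult[OF uhom_ev2[OF h]] hp)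
  show ?thesis
  proof
    assume "ev2 h \<xi> \<eta> P = 0"
    with \<open>ev2 h \<xi> \<eta> P = ev2 h \<xi> \<eta> R\<close> have "R = 0"
      using herm_point_low_degree[OF q pt _ QR(2)] by metis
    thus "herm_poly q dvd P" unfolding QR(1) by simp
  next
    assume "herm_poly q dvd P"
    then obtain S where "P = herm_poly q * S" by (elim dvdE)
    thus "ev2 h \<xi> \<eta> P = 0" by (simp add: uhom_mult[OF uhom_ev2[OF h]] hp)
  qed
qed

lemma finite_field_power_card:
  fixes c :: "'a::{field, finite}"
  shows "c ^ CARD('a) = c"
proof (cases "c = 0")
  case False
  \<comment> \<open>Multiplication by \<open>c\<close> permutes the nonzero elements.\<close>
  have "(\<Prod>z\<in>UNIV - {0}. c * z) = (\<Prod>z\<in>UNIV - {0}. z)"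
    by (rule prod.reindex_bij_witness[of _ "\<lambda>z. z / c" "\<lambda>z. c * z"]) (use False in auto)
  hence "c ^ (CARD('a) - 1) * \<Prod>(UNIV - {0}) = \<Prod>(UNIV - {0})"
    by (simp add: prod.distrib)
  moreover have "\<Prod>(UNIV - {0 :: 'a}) \<noteq> 0" by simp
  ultimately have "c ^ (CARD('a) - 1) = 1" by simp
  moreover have "CARD('a) = Suc (CARD('a) - 1)" by (simp add: card_gt_0_iff)
  ultimately show ?thesis by (metis power_Suc mult.right_neutral)
qed (simp add: power_0_left card_gt_0_iff)

section \<open>The function field\<close>

abbreviation amb :: "'a::field ambient \<Rightarrow> 'a poly poly \<Rightarrow> 'a ambient" where
  "amb y \<equiv> ev2 ff_const ff_x y"

lemma uhom_to_ac_fract: "uhom (\<lambda>p. to_ac (to_fract p))"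
  by (simp add: uhom_def)

lemma uhom_ff_const: "uhom (ff_const :: 'a::field \<Rightarrow> _)"
proof -
  have "uhom (\<lambda>c :: 'a. [:c:])" by (simp add: uhom_def)
  from uhom_comp[OF uhom_to_ac_fract this] show ?thesis by (simp add: ff_const_def[abs_def])
qed

lemma ev1_ff: "ev1 ff_const ff_x p = to_ac (to_fract p)"
proof (induction p)
  case (pCons a p)
  have "pCons a p = [:a:] + [:0, 1:] * p" by simp
  hence "to_ac (to_fract (pCons a p)) = ff_const a + ff_x * to_ac (to_fract p)"
    unfolding ff_const_def ff_x_def by (metis to_ac_add to_ac_mult to_fract_add to_fract_mult)
  thus ?case using pCons by (simp add: uhom_ff_const)
qed simp

lemma amb_smult: "amb z (smult c Q) = to_ac (to_fract c) * amb z Q"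
  unfolding ev2_def ev1_smult[OF uhom_ev1[OF uhom_ff_const]] ev1_ff ..

text \<open>One \<open>P\<close> serves for all \<open>z\<close>, so a relation and its cleared form
  vanish at the same points. The clause about \<open>P = 0\<close> keeps a nontrivial relation
  nontrivial, as \<open>amb_inverse_multiple\<close> requires.\<close>

lemma clear_denominators:
  fixes p :: "'a::field poly fract poly"
  shows "\<exists>d P. d \<noteq> 0 \<and> (P = 0 \<longrightarrow> p = 0) \<and>
    (\<forall>z. to_ac (to_fract d) * poly (map_poly to_ac p) z = ev2 ff_const ff_x z P)"
proof (induction p)
  case 0
  show ?case by (intro exI[of _ 1] exI[of _ 0]) simp
next
  case (pCons a p)
  then obtain d P where dP: "d \<noteq> 0" "P = 0 \<longrightarrow> p = 0"
    "\<And>z. to_ac (to_fract d) * poly (map_poly to_ac p) z = ev2 ff_const ff_x z P" by blast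
  obtain n e where ne: "a = to_fract n / to_fract e" "e \<noteq> 0"
    by (metis Fract_cases Fract_conv_to_fract)
  have "to_ac (to_fract (d * e)) * poly (map_poly to_ac (pCons a p)) z =
      ev2 ff_const ff_x z (pCons (d * n) (smult e P))" for z
  proof -
    have "ev2 ff_const ff_x z (pCons (d * n) (smult e P)) =
      to_ac (to_fract (d * n)) + z * (to_ac (to_fract e) * ev2 ff_const ff_x z P)"
      by (simp add: uhom_ff_const amb_smult ev1_ff)
    also have "\<dots> = to_ac (to_fract (d * e)) * (to_ac a + z * poly (map_poly to_ac p) z)"
      using ne(2) by (simp add: dP(3)[symmetric] ne(1) algebra_simps)
    finally show ?thesis by (simp add: map_poly_pCons)
  qed
  thus ?case using dP ne
    by (intro exI[of _ "d * e"] exI[of _ "pCons (d * n) (smult e P)"]) auto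
qed

text \<open>Once coefficients lie in F[x] instead of F(x), numerator and denominator can be
  evaluated at any generic point.\<close>

lemma function_field_altdef:
  "function_field y = {amb y A / amb y B | A B. amb y B \<noteq> 0}"
proof (intro equalityI subsetI)
  fix f assume "f \<in> function_field y"
  then obtain p r where f: "f = poly (map_poly to_ac p) y / poly (map_poly to_ac r) y"
    "poly (map_poly to_ac r) y \<noteq> 0" by (auto simp: function_field_def)
  obtain d P where P: "d \<noteq> 0" "to_ac (to_fract d) * poly (map_poly to_ac p) y = amb y P"
    using clear_denominators[of p] by blast
  obtain e R where R: "e \<noteq> 0" "to_ac (to_fract e) * poly (map_poly to_ac r) y = amb y R"
    using clear_denominators[of r] by blast
  have "f = amb y (smult e P) / amb y (smult d R)"
    unfolding amb_smult P(2)[symmetric] R(2)[symmetric] using f P(1) R(1) by simp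
  moreover have "amb y (smult d R) \<noteq> 0"
    unfolding amb_smult R(2)[symmetric] using f P(1) R(1) by simp
  ultimately show "f \<in> {amb y A / amb y B | A B. amb y B \<noteq> 0}" by blast
next
  fix f assume "f \<in> {amb y A / amb y B | A B. amb y B \<noteq> 0}"
  then obtain A B where f: "f = amb y A / amb y B" "amb y B \<noteq> 0" by blast
  have "amb y Q = poly (map_poly to_ac (map_poly to_fract Q)) y" for Q
    unfolding ev2_def ev1_def[of "ev1 ff_const ff_x"]
    by (simp add: map_poly_map_poly o_def ev1_ff[abs_def])
  with f show "f \<in> function_field y" unfolding function_field_def by auto
qed

lemmas uhom_amb = uhom_ev2[OF uhom_ff_const]

lemma function_fieldI: "amb y B \<noteq> 0 \<Longrightarrow> amb y A / amb y B \<in> function_field y"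
  unfolding function_field_altdef by blast

lemma function_fieldE:
  assumes "f \<in> function_field y"
  obtains A B where "f = amb y A / amb y B" "amb y B \<noteq> 0"
  using assms unfolding function_field_altdef by blast

lemma amb_in_function_field [simp]: "amb y A \<in> function_field y"
  using function_fieldI[of y 1 A] by (simp add: uhom_1[OF uhom_amb])

lemma ff_const_in_function_field [simp]: "ff_const c \<in> function_field y"
  using amb_in_function_field[of y "[:[:c:]:]"] by (simp add: uhom_ff_const)

lemma ff_x_in_function_field [simp]: "ff_x \<in> function_field y"
  using amb_in_function_field[of y "[:[:0, 1:]:]"]
  by (simp add: uhom_ff_const uhom_0[OF uhom_ff_const] uhom_1[OF uhom_ff_const])

lemma y_in_function_field [simp]: "y \<in> function_field y"
  using amb_in_function_field[of y "[:0, 1:]"]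
  by (simp add: uhom_ff_const uhom_0[OF uhom_ff_const] uhom_1[OF uhom_ff_const] one_pCons del: pCons_one)

lemma function_field_add [simp]:
  "f \<in> function_field y \<Longrightarrow> g \<in> function_field y \<Longrightarrow> f + g \<in> function_field y"
proof (elim function_fieldE)
  fix A B C D assume *: "f = amb y A / amb y B" "amb y B \<noteq> 0" "g = amb y C / amb y D" "amb y D \<noteq> 0"
  hence "f + g = amb y (A * D + C * B) / amb y (B * D)"
    by (simp add: uhom_add[OF uhom_amb] uhom_mult[OF uhom_amb] add_frac_eq)
  thus ?thesis using * function_fieldI[of y "B * D"] by (simp add: uhom_mult[OF uhom_amb])
qed

lemma function_field_mult [simp]:
  "f \<in> function_field y \<Longrightarrow> g \<in> function_field y \<Longrightarrow> f * g \<in> function_field y"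
proof (elim function_fieldE)
  fix A B C D assume *: "f = amb y A / amb y B" "amb y B \<noteq> 0" "g = amb y C / amb y D" "amb y D \<noteq> 0"
  hence "f * g = amb y (A * C) / amb y (B * D)"
    by (simp add: uhom_mult[OF uhom_amb])
  thus ?thesis using * function_fieldI[of y "B * D" "A * C"] by (simp add: uhom_mult[OF uhom_amb])
qed

lemma function_field_0 [simp]: "0 \<in> function_field y"
  and function_field_1 [simp]: "1 \<in> function_field y"
  using ff_const_in_function_field[of 0] ff_const_in_function_field[of 1]
  by (simp_all add: uhom_0[OF uhom_ff_const] uhom_1[OF uhom_ff_const])

lemma function_field_uminus [simp]: "f \<in> function_field y \<Longrightarrow> - f \<in> function_field y"
proof -
  have "- f = ff_const (- 1) * f"
    by (simp add: uhom_uminus[OF uhom_ff_const] uhom_1[OF uhom_ff_const])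
  thus "f \<in> function_field y \<Longrightarrow> - f \<in> function_field y" by simp
qed

lemma function_field_diff [simp]:
  "f \<in> function_field y \<Longrightarrow> g \<in> function_field y \<Longrightarrow> f - g \<in> function_field y"
  using function_field_add[of f y "- g"] by simp

lemma function_field_inverse [simp]: "f \<in> function_field y \<Longrightarrow> inverse f \<in> function_field y"
  by (cases "f = 0"; elim function_fieldE) (auto intro: function_fieldI)

lemma function_field_divide [simp]:
  "f \<in> function_field y \<Longrightarrow> g \<in> function_field y \<Longrightarrow> f / g \<in> function_field y"
  by (simp add: divide_inverse)

lemma function_field_power [simp]: "f \<in> function_field y \<Longrightarrow> f ^ n \<in> function_field y"
  by (induction n) auto

lemma function_field_prod [simp]:
  "(\<And>i. i \<in> I \<Longrightarrow> f i \<in> function_field y) \<Longrightarrow> prod f I \<in> function_field y"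
  by (induction I rule: infinite_finite_induct) auto

text \<open>The description \<open>THE z\<close> is proper only if \<open>(\<xi>, \<eta>)\<close> satisfies \<open>herm_point\<close>; only then does
  \<open>x \<mapsto> \<xi>\<close>, \<open>y \<mapsto> \<eta>\<close> extend to the function field.\<close>

definition ff_embed :: "('a::field \<Rightarrow> 'c::field) \<Rightarrow> 'c \<Rightarrow> 'c \<Rightarrow> 'a ambient \<Rightarrow> 'a ambient \<Rightarrow> 'c" where
  "ff_embed h \<xi> \<eta> y f = (THE z. \<exists>A B. amb y B \<noteq> 0 \<and> f = amb y A / amb y B \<and>
     z = ev2 h \<xi> \<eta> A / ev2 h \<xi> \<eta> B)"

locale hermitian =
  fixes q :: nat and y :: "'a::{field, finite} ambient"
  assumes primepow_q: "primepow q" and q_ge: "q \<ge> 2" and card_field: "CARD('a) = q ^ 2"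
    and hermitian_eq: "y ^ q + y = ff_x ^ (q + 1)"
begin

lemma herm_point_generic: "herm_point q ff_const ff_x y"
  unfolding herm_point_def using uhom_ff_const hermitian_eq by (auto simp: ev1_ff)

lemma amb_zero_iff: 
  assumes "herm_point q h \<xi> \<eta>"
  shows "amb y A = 0 \<longleftrightarrow> ev2 h \<xi> \<eta> A = 0"
  using herm_point_zero_iff[OF q_ge herm_point_generic] herm_point_zero_iff[OF q_ge assms] by metis

text \<open>Equality of two quotients is a polynomial relation at the point \<open>(x, y)\<close>,
  and such relations hold at every generic point alike; hence the result does not depend on the
  representation.\<close>

lemma ff_embed_eq:
  assumes pt: "herm_point q h \<xi> \<eta>" and B: "amb y B \<noteq> 0"
  shows "ff_embed h \<xi> \<eta> y (amb y A / amb y B) = ev2 h \<xi> \<eta> A / ev2 h \<xi> \<eta> B"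
  unfolding ff_embed_def
proof (rule the_equality)
  fix z assume "\<exists>A' B'. amb y B' \<noteq> 0 \<and> amb y A / amb y B = amb y A' / amb y B' \<and>
     z = ev2 h \<xi> \<eta> A' / ev2 h \<xi> \<eta> B'"
  then obtain A' B' where *: "amb y B' \<noteq> 0" "amb y A / amb y B = amb y A' / amb y B'"
    "z = ev2 h \<xi> \<eta> A' / ev2 h \<xi> \<eta> B'" by blast
  have u: "uhom (ev2 h \<xi> \<eta>)" using pt uhom_ev2 by (auto simp: herm_point_def)
  have "amb y (A * B' - A' * B) = 0"
    using *(1,2) B by (simp add: uhom_diff[OF uhom_amb] uhom_mult[OF uhom_amb] field_simps)
  hence "ev2 h \<xi> \<eta> A * ev2 h \<xi> \<eta> B' = ev2 h \<xi> \<eta> A' * ev2 h \<xi> \<eta> B"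
    unfolding amb_zero_iff[OF pt] by (simp add: uhom_diff[OF u] uhom_mult[OF u])
  moreover have "ev2 h \<xi> \<eta> B \<noteq> 0" "ev2 h \<xi> \<eta> B' \<noteq> 0"
    using B *(1) amb_zero_iff[OF pt] by auto
  ultimately show "z = ev2 h \<xi> \<eta> A / ev2 h \<xi> \<eta> B"
    unfolding *(3) by (simp add: field_simps)
qed (use B in blast)

lemma ff_embed_amb:
  assumes pt: "herm_point q h \<xi> \<eta>"
  shows "ff_embed h \<xi> \<eta> y (amb y A) = ev2 h \<xi> \<eta> A"
proof -
  have u: "uhom (ev2 h \<xi> \<eta>)" using pt uhom_ev2 by (auto simp: herm_point_def)
  show ?thesis using ff_embed_eq[OF pt, of 1 A] by (simp add: uhom_1[OF uhom_amb] uhom_1[OF u])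
qed

lemma ff_embed_add:
  assumes pt: "herm_point q h \<xi> \<eta>" and "f \<in> function_field y" "g \<in> function_field y"
  shows "ff_embed h \<xi> \<eta> y (f + g) = ff_embed h \<xi> \<eta> y f + ff_embed h \<xi> \<eta> y g"
  using assms(2,3)
proof (elim function_fieldE)
  fix A B C D assume *: "f = amb y A / amb y B" "amb y B \<noteq> 0" "g = amb y C / amb y D" "amb y D \<noteq> 0"
  have u: "uhom (ev2 h \<xi> \<eta>)" using pt uhom_ev2 by (auto simp: herm_point_def)
  have nz: "ev2 h \<xi> \<eta> B \<noteq> 0" "ev2 h \<xi> \<eta> D \<noteq> 0"
    using * amb_zero_iff[OF pt] by auto
  have "f + g = amb y (A * D + C * B) / amb y (B * D)" "amb y (B * D) \<noteq> 0"
    using * by (simp_all add: uhom_add[OF uhom_amb] uhom_mult[OF uhom_amb] add_frac_eq)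
  thus ?thesis unfolding *(1,3) using nz
    by (simp only: ff_embed_eq[OF pt *(2)] ff_embed_eq[OF pt *(4)])
       (simp add: uhom_add[OF u] uhom_mult[OF u] add_frac_eq ff_embed_eq[OF pt])
qed

lemma ff_embed_mult:
  assumes pt: "herm_point q h \<xi> \<eta>" and "f \<in> function_field y" "g \<in> function_field y"
  shows "ff_embed h \<xi> \<eta> y (f * g) = ff_embed h \<xi> \<eta> y f * ff_embed h \<xi> \<eta> y g"
  using assms(2,3)
proof (elim function_fieldE)
  fix A B C D assume *: "f = amb y A / amb y B" "amb y B \<noteq> 0" "g = amb y C / amb y D" "amb y D \<noteq> 0"
  have u: "uhom (ev2 h \<xi> \<eta>)" using pt uhom_ev2 by (auto simp: herm_point_def)
  have "f * g = amb y (A * C) / amb y (B * D)" "amb y (B * D) \<noteq> 0"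
    using * by (simp_all add: uhom_mult[OF uhom_amb])
  thus ?thesis unfolding *(1,3)
    by (simp add: ff_embed_eq[OF pt] * uhom_mult[OF u])
qed

lemma ff_embed_eq_0_iff:
  assumes pt: "herm_point q h \<xi> \<eta>" and "f \<in> function_field y"
  shows "ff_embed h \<xi> \<eta> y f = 0 \<longleftrightarrow> f = 0"
  using assms(2)
proof (elim function_fieldE)
  fix A B assume *: "f = amb y A / amb y B" "amb y B \<noteq> 0"
  show ?thesis using * amb_zero_iff[OF pt, of A] amb_zero_iff[OF pt, of B]
    by (simp add: ff_embed_eq[OF pt])
qed

lemma ff_embed_const: "herm_point q h \<xi> \<eta> \<Longrightarrow> ff_embed h \<xi> \<eta> y (ff_const c) = h c"
  using ff_embed_amb[of h \<xi> \<eta> "[:[:c:]:]"] by (simp add: uhom_ff_const herm_point_def)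

lemma ff_embed_x: "herm_point q h \<xi> \<eta> \<Longrightarrow> ff_embed h \<xi> \<eta> y ff_x = \<xi>"
  using ff_embed_amb[of h \<xi> \<eta> "[:[:0, 1:]:]"]
  by (simp add: uhom_ff_const herm_point_def uhom_0[OF uhom_ff_const] uhom_1[OF uhom_ff_const]
      uhom_0[of h] uhom_1[of h])

lemma ff_embed_y: "herm_point q h \<xi> \<eta> \<Longrightarrow> ff_embed h \<xi> \<eta> y y = \<eta>"
  using ff_embed_amb[of h \<xi> \<eta> "[:0, 1:]"]
  by (simp add: uhom_ff_const herm_point_def uhom_0[OF uhom_ff_const] uhom_1[OF uhom_ff_const]
      uhom_0[of h] uhom_1[of h] one_pCons del: pCons_one)

lemma ff_embed_uminus:
  assumes pt: "herm_point q h \<xi> \<eta>" and "f \<in> function_field y"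
  shows "ff_embed h \<xi> \<eta> y (- f) = - ff_embed h \<xi> \<eta> y f"
  using ff_embed_add[OF pt assms(2), of "- f"] ff_embed_eq_0_iff[OF pt, of 0] assms(2)
  by (simp add: eq_neg_iff_add_eq_0 add.commute)

lemma ff_embed_diff:
  assumes pt: "herm_point q h \<xi> \<eta>" and "f \<in> function_field y" "g \<in> function_field y"
  shows "ff_embed h \<xi> \<eta> y (f - g) = ff_embed h \<xi> \<eta> y f - ff_embed h \<xi> \<eta> y g"
  using ff_embed_add[OF pt assms(2), of "- g"] ff_embed_uminus[OF pt, of g] assms(3) by simp

section \<open>Frobenius, norm and trace\<close>

lemma char_power: "\<exists>k. q = CHAR('a) ^ k \<and> prime CHAR('a)"
proof -
  obtain p k where pk: "prime p" "q = p ^ k" using primepow_q by (auto simp: primepow_def)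
  have "prime CHAR('a)" by (intro prime_CHAR_semidom finite_imp_CHAR_pos) simp
  moreover have "CHAR('a) dvd p ^ (k * 2)"
  proof -
    \<comment> \<open>Translation by 1 permutes the field, so the sum over it is unchanged although
      it grows by the number of elements.\<close>
    have "(\<Sum>c\<in>UNIV. c + 1 :: 'a) = (\<Sum>c\<in>UNIV. c)"
      by (rule sum.reindex_bij_witness[of _ "\<lambda>c. c - 1" "\<lambda>c. c + 1"]) auto
    hence "of_nat CARD('a) = (0 :: 'a)" by (simp add: sum.distrib)
    thus ?thesis unfolding of_nat_eq_0_iff_char_dvd card_field by (simp add: pk power_mult)
  qed
  ultimately have "CHAR('a) = p"
    using pk(1) by (meson prime_dvd_power primes_dvd_imp_eq)
  with pk show ?thesis by auto
qed

text \<open>Every field receiving \<open>F\<close> has the characteristic of \<open>F\<close>, so \<open>q\<close>-th powers are additive in it.\<close>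

lemma frobenius_add:
  fixes h :: "'a \<Rightarrow> 'c::field" and a b :: 'c
  assumes "uhom h"
  shows "(a + b) ^ q = a ^ q + b ^ q"
proof -
  obtain k where k: "q = CHAR('a) ^ k" "prime CHAR('a)" using char_power by blast
  have "CHAR('c) = CHAR('a)"
  proof (rule CHAR_eqI)
    show "of_nat CHAR('a) = (0 :: 'c)"
      using uhom_of_nat[OF assms, of "CHAR('a)"] uhom_0[OF assms] by simp
    fix n assume "of_nat n = (0 :: 'c)"
    thus "CHAR('a) dvd n"
      using uhom_of_nat[OF assms, of n] uhom_eq_0_iff[OF assms] by (metis of_nat_eq_0_iff_char_dvd)
  qed
  with k show ?thesis by (intro freshmans_dream') auto
qed

lemma frobenius_uminus:
  fixes h :: "'a \<Rightarrow> 'c::field" and a :: 'c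
  assumes "uhom h"
  shows "(- a) ^ q = - (a ^ q)"
  using frobenius_add[OF assms, of a "- a"] q_ge
  by (simp add: eq_neg_iff_add_eq_0 add.commute zero_power)

lemma frobenius_diff:
  fixes h :: "'a \<Rightarrow> 'c::field" and a b :: 'c
  assumes "uhom h"
  shows "(a - b) ^ q = a ^ q - b ^ q"
  using frobenius_add[OF assms, of a "- b"] frobenius_uminus[OF assms, of b] by simp

text \<open>\<open>z^(q+1)\<close> is the norm to the subfield with \<open>q\<close>
  elements.\<close>

lemma norm_frobenius: "(z ^ (q + 1)) ^ q = (z ^ (q + 1) :: 'a)"
proof -
  have "(z ^ (q + 1)) ^ q = z ^ (q ^ 2) * z ^ q"
    by (simp add: power2_eq_square power_add[symmetric] power_mult[symmetric] algebra_simps)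
  also have "z ^ (q ^ 2) = z" using finite_field_power_card[of z] card_field by simp
  finally show ?thesis by simp
qed

text \<open>These are the y-coordinates of the affine points with \<open>x = 0\<close>, the origin
  included.\<close>

definition trace_kernel :: "'a set" where "trace_kernel = {b. b ^ q + b = 0}"

lemma poly_trace: "poly (monom 1 q + monom 1 1) b = b ^ q + (b :: 'a)"
  by (simp add: poly_monom)

lemma degree_trace: "degree (monom 1 q + monom 1 1 :: 'a poly) = q"
  "lead_coeff (monom 1 q + monom 1 1 :: 'a poly) = 1"
proof -
  show *: "degree (monom 1 q + monom 1 1 :: 'a poly) = q"
    using q_ge by (subst degree_add_eq_left) (auto simp: degree_monom_eq)
  show "lead_coeff (monom 1 q + monom 1 1 :: 'a poly) = 1"
    unfolding * using q_ge by simp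
qed

text \<open>Since \<open>s = b\<^sup>q + b\<close> satisfies \<open>s\<^sup>q = s\<close>, every \<open>b\<close> is a root of \<open>T = X\<^sup>q + X\<close>
  or of \<open>T\<^sup>q\<^sup>-\<^sup>1 - 1\<close>, which leaves at least \<open>q\<close> roots for \<open>T\<close>.\<close>

lemma card_trace_kernel: "card trace_kernel = q"
proof -
  define T where "T = (monom 1 q + monom 1 1 :: 'a poly)"
  have T0: "T \<noteq> 0" using degree_trace(1) q_ge by (auto simp: T_def)
  have le: "card trace_kernel \<le> q"
    using card_poly_roots_bound[OF T0] degree_trace(1) unfolding T_def poly_trace trace_kernel_def
    by simp
  have deg: "degree (T ^ (q - 1) - 1) \<le> q * (q - 1)" "T ^ (q - 1) - 1 \<noteq> 0"
  proof -
    have dT: "degree (T ^ (q - 1)) = q * (q - 1)"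
      using degree_trace(1) T0 by (simp add: T_def degree_power_eq)
    thus "degree (T ^ (q - 1) - 1) \<le> q * (q - 1)"
      by (intro degree_diff_le) auto
    show "T ^ (q - 1) - 1 \<noteq> 0"
    proof
      assume "T ^ (q - 1) - 1 = 0"
      hence "degree (T ^ (q - 1)) = 0" by simp
      thus False using dT q_ge by simp
    qed
  qed
  have "UNIV = trace_kernel \<union> {b. poly (T ^ (q - 1) - 1) b = 0}"
  proof -
    have "b \<in> trace_kernel \<or> poly (T ^ (q - 1) - 1) b = 0" for b
    proof -
      define s where "s = b ^ q + b"
      have "s ^ q = (b ^ q) ^ q + b ^ q"
        unfolding s_def by (rule frobenius_add[OF uhom_id])
      also have "(b ^ q) ^ q = b"
        using finite_field_power_card[of b] card_field by (simp add: power_mult[symmetric] power2_eq_square)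
      finally have "s ^ q = s" by (simp add: s_def)
      hence "s * (s ^ (q - 1) - 1) = 0"
        using q_ge by (simp add: right_diff_distrib power_Suc[symmetric] del: power_Suc)
      thus ?thesis by (auto simp: trace_kernel_def s_def T_def poly_monom poly_power)
    qed
    thus ?thesis by auto
  qed
  hence "q ^ 2 \<le> card trace_kernel + card {b. poly (T ^ (q - 1) - 1) b = 0}"
    using card_field card_Un_le by metis
  also have "card {b. poly (T ^ (q - 1) - 1) b = 0} \<le> q * (q - 1)"
    using card_poly_roots_bound[OF deg(2)] deg(1) by linarith
  finally have "q * q \<le> card trace_kernel + (q * q - q)"
    by (simp add: power2_eq_square diff_mult_distrib2)
  hence "q \<le> card trace_kernel"
    using le_square[of q] by linarith
  with le show ?thesis by simp
qed

text \<open>The kernel provides \<open>q\<close> distinct roots of the monic polynomial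
  \<open>X^q + X\<close>, which therefore splits over F; evaluation through \<open>h\<close> carries
  the factorization into any extension.\<close>

lemma trace_factorization:
  fixes h :: "'a \<Rightarrow> 'c::field"
  assumes "uhom h"
  shows "\<eta> ^ q + \<eta> = (\<Prod>b\<in>trace_kernel. \<eta> - h b)"
proof -
  define T where "T = (monom 1 q + monom 1 1 :: 'a poly)"
  define R where "R = (\<Prod>b\<in>trace_kernel. [:- b, 1:])"
  have R: "degree R = q"
    unfolding R_def using card_trace_kernel by (simp add: degree_prod_eq_sum_degree)
  have "lead_coeff R = 1" unfolding R_def lead_coeff_prod by simp
  hence "coeff R q = 1" using R by simp
  have "T = R"
  proof (rule ccontr)
    assume "T \<noteq> R"
    hence nz: "T - R \<noteq> 0" by simp
    have "degree (T - R) < q"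
    proof (rule ccontr)
      assume "\<not> ?thesis"
      moreover have "degree (T - R) \<le> q" using R degree_trace by (intro degree_diff_le) (auto simp: T_def)
      ultimately have "degree (T - R) = q" by simp
      moreover have "coeff (T - R) q = 0"
        using \<open>coeff R q = 1\<close> degree_trace by (simp add: T_def)
      ultimately show False using nz by (metis leading_coeff_0_iff)
    qed
    moreover have "trace_kernel \<subseteq> {b. poly (T - R) b = 0}"
    proof
      fix b assume b: "b \<in> trace_kernel"
      hence "poly R b = 0" by (auto simp: R_def poly_prod intro!: bexI[of _ b])
      moreover have "poly T b = 0" using b by (simp add: T_def poly_monom trace_kernel_def)
      ultimately show "b \<in> {b. poly (T - R) b = 0}" by simp
    qed
    hence "card trace_kernel \<le> card {b. poly (T - R) b = 0}"
      using nz by (intro card_mono poly_roots_finite)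
    ultimately show False
      using card_poly_roots_bound[OF nz] card_trace_kernel by simp
  qed
  have "ev1 h \<eta> T = \<eta> ^ q + \<eta>"
    by (simp add: T_def ev1_add[OF assms] ev1_monom[OF assms] uhom_1[OF assms])
  moreover have "ev1 h \<eta> R = (\<Prod>b\<in>trace_kernel. \<eta> - h b)"
    unfolding R_def uhom_prod[OF uhom_ev1[OF assms]]
    by (simp add: assms uhom_1[OF assms] uhom_uminus[OF assms])
  ultimately show ?thesis using \<open>T = R\<close> by simp
qed

end

section \<open>Places\<close>

lemma is_placeD:
  assumes "is_place y P"
  shows place_0: "P 0 = 0"
    and place_mult: "\<And>f g. \<lbrakk>f \<in> function_field y; g \<in> function_field y; f \<noteq> 0; g \<noteq> 0\<rbrakk> \<Longrightarrow> P (f * g) = P f + P g"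
    and place_add: "\<And>f g. \<lbrakk>f \<in> function_field y; g \<in> function_field y; f \<noteq> 0; g \<noteq> 0; f + g \<noteq> 0\<rbrakk>
          \<Longrightarrow> min (P f) (P g) \<le> P (f + g)"
    and place_const: "\<And>c. P (ff_const c) = 0"
    and place_uniformizer: "\<exists>t\<in>function_field y. P t = 1"
    and place_outside: "\<And>f. f \<notin> function_field y \<Longrightarrow> P f = 0"
  using assms unfolding is_place_def by auto

lemma place_1: "is_place y P \<Longrightarrow> P 1 = 0"
  using place_const[of y P 1] by (simp add: uhom_1[OF uhom_ff_const])

lemma place_power:
  assumes "is_place y P" "f \<in> function_field y" "f \<noteq> 0"
  shows "P (f ^ n) = int n * P f"
  by (induction n) (simp_all add: place_1[OF assms(1)] place_mult[OF assms(1)] assms algebra_simps)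

lemma place_inverse:
  assumes "is_place y P" "f \<in> function_field y" "f \<noteq> 0"
  shows "P (inverse f) = - P f"
  using place_mult[OF assms(1), of f "inverse f"] place_1[OF assms(1)] assms(2,3) by simp

lemma place_divide:
  assumes "is_place y P" "f \<in> function_field y" "g \<in> function_field y" "f \<noteq> 0" "g \<noteq> 0"
  shows "P (f / g) = P f - P g"
  using place_mult[OF assms(1), of f "inverse g"] place_inverse[OF assms(1,3,5)] assms(2-)
  by (simp add: divide_inverse)

lemma place_uminus:
  assumes "is_place y P" "f \<in> function_field y"
  shows "P (- f) = P f"
proof (cases "f = 0")
  case False
  have "- f = ff_const (- 1) * f"
    by (simp add: uhom_uminus[OF uhom_ff_const] uhom_1[OF uhom_ff_const])
  moreover have "ff_const (- 1) \<noteq> (0 :: 'a ambient)"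
    by (simp add: uhom_uminus[OF uhom_ff_const] uhom_1[OF uhom_ff_const])
  ultimately show ?thesis
    using place_mult[OF assms(1), of "ff_const (- 1)" f] place_const[OF assms(1)] assms False by simp
qed simp

lemma place_prod:
  assumes "is_place y P" "\<And>i. i \<in> I \<Longrightarrow> f i \<in> function_field y \<and> f i \<noteq> 0"
  shows "P (prod f I) = (\<Sum>i\<in>I. P (f i))"
  using assms(2)
proof (induction I rule: infinite_finite_induct)
  case (insert i I)
  have "P (f i * prod f I) = P (f i) + P (prod f I)"
    using insert.prems insert.hyps by (intro place_mult[OF assms(1)]) auto
  thus ?case using insert by simp
qed (simp_all add: place_1[OF assms(1)])

lemma place_add_less:
  assumes "is_place y P" "f \<in> function_field y" "g \<in> function_field y" "f \<noteq> 0" "g \<noteq> 0" "P f < P g"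
  shows "f + g \<noteq> 0" "P (f + g) = P f"
proof -
  show nz: "f + g \<noteq> 0"
  proof
    assume "f + g = 0"
    hence "f = - g" by (simp add: eq_neg_iff_add_eq_0)
    thus False using place_uminus[OF assms(1,3)] assms(6) by simp
  qed
  have "P f \<le> P (f + g)"
    using place_add[OF assms(1-5) nz] assms(6) by simp
  moreover have "min (P (f + g)) (P (- g)) \<le> P f"
    using place_add[OF assms(1), of "f + g" "- g"] assms nz by simp
  ultimately show "P (f + g) = P f"
    using place_uminus[OF assms(1,3)] assms(6) by auto
qed

lemma place_ideal_sub: "place_ideal y P \<subseteq> place_ring y P"
  by (auto simp: place_ideal_def place_ring_def)

lemma place_ideal_add:
  assumes "is_place y P" "f \<in> place_ideal y P" "g \<in> place_ideal y P"
  shows "f + g \<in> place_ideal y P"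
  using assms place_add[OF assms(1), of f g]
  by (cases "f = 0"; cases "g = 0"; cases "f + g = 0") (auto simp: place_ideal_def)

lemma place_ring_add:
  assumes "is_place y P" "f \<in> place_ring y P" "g \<in> place_ring y P"
  shows "f + g \<in> place_ring y P"
  using assms place_add[OF assms(1), of f g]
  by (cases "f = 0"; cases "g = 0"; cases "f + g = 0") (auto simp: place_ring_def)

lemma place_ideal_uminus:
  assumes "is_place y P" "f \<in> place_ideal y P"
  shows "- f \<in> place_ideal y P"
  using assms place_uminus[OF assms(1), of f] by (auto simp: place_ideal_def)

lemma place_ring_mult_ideal:
  assumes "is_place y P" "f \<in> place_ring y P" "g \<in> place_ideal y P"
  shows "f * g \<in> place_ideal y P"
  using assms place_mult[OF assms(1), of f g]
  by (cases "f = 0"; cases "g = 0") (auto simp: place_ideal_def place_ring_def)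

lemma place_ring_mult:
  assumes "is_place y P" "f \<in> place_ring y P" "g \<in> place_ring y P"
  shows "f * g \<in> place_ring y P"
  using assms place_mult[OF assms(1), of f g]
  by (cases "f = 0"; cases "g = 0") (auto simp: place_ring_def)

lemma place_ring_const: "is_place y P \<Longrightarrow> ff_const c \<in> place_ring y P"
  by (simp add: place_ring_def place_const)

lemma place_ideal_0: "0 \<in> place_ideal y P"
  by (simp add: place_ideal_def)

text \<open>A relation instead of \<open>value_at\<close>, because a function has a value only if
  its residue class is represented by a constant. The closure rules then never touch a definite
  description.\<close>

definition has_value :: "'a::field ambient \<Rightarrow> ('a ambient \<Rightarrow> int) \<Rightarrow> 'a ambient \<Rightarrow> 'a \<Rightarrow> bool" where
  "has_value y P f c \<longleftrightarrow> f - ff_const c \<in> place_ideal y P"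

lemma has_value_const: "has_value y P (ff_const c) c"
  by (simp add: has_value_def place_ideal_0)

lemma has_value_in_ring:
  assumes "is_place y P" "has_value y P f c"
  shows "f \<in> place_ring y P"
  using place_ring_add[OF assms(1) subsetD[OF place_ideal_sub assms(2)[unfolded has_value_def]]
      place_ring_const[OF assms(1), of c]] by simp

lemma has_value_add:
  assumes "is_place y P" "has_value y P f c" "has_value y P g d"
  shows "has_value y P (f + g) (c + d)"
  using place_ideal_add[OF assms(1) assms(2,3)[unfolded has_value_def]]
  by (simp add: has_value_def uhom_add[OF uhom_ff_const] algebra_simps)

lemma has_value_mult:
  assumes "is_place y P" "has_value y P f c" "has_value y P g d"
  shows "has_value y P (f * g) (c * d)"
proof -
  have "f * (g - ff_const d) + ff_const d * (f - ff_const c) \<in> place_ideal y P"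
    using assms has_value_in_ring[OF assms(1,2)] unfolding has_value_def
    by (intro place_ideal_add place_ring_mult_ideal place_ring_const)
  thus ?thesis by (simp add: has_value_def uhom_mult[OF uhom_ff_const] algebra_simps)
qed

lemma has_value_uminus:
  assumes "is_place y P" "has_value y P f c"
  shows "has_value y P (- f) (- c)"
  using place_ideal_uminus[OF assms(1) assms(2)[unfolded has_value_def]]
  by (simp add: has_value_def uhom_uminus[OF uhom_ff_const])

lemma has_value_diff:
  assumes "is_place y P" "has_value y P f c" "has_value y P g d"
  shows "has_value y P (f - g) (c - d)"
  using has_value_add[OF assms(1,2) has_value_uminus[OF assms(1,3)]] by simp

lemma has_value_power:
  assumes "is_place y P" "has_value y P f c"
  shows "has_value y P (f ^ n) (c ^ n)"
  using has_value_const[of y P 1]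
  by (induction n) (simp_all add: uhom_1[OF uhom_ff_const] has_value_mult[OF assms])

lemma has_value_sum:
  assumes "is_place y P" "\<And>i. i \<in> I \<Longrightarrow> has_value y P (f i) (c i)"
  shows "has_value y P (sum f I) (sum c I)"
  using assms(2) has_value_const[of y P 0]
  by (induction I rule: infinite_finite_induct)
     (simp_all add: uhom_0[OF uhom_ff_const] has_value_add[OF assms(1)])

lemma has_value_unit:
  assumes "is_place y P" "has_value y P f c" "c \<noteq> 0"
  shows "f \<noteq> 0" "P f = 0"
proof -
  have K: "f \<in> function_field y"
    using has_value_in_ring[OF assms(1,2)] by (simp add: place_ring_def)
  have c: "ff_const c \<noteq> (0 :: 'a ambient)" using assms(3) uhom_nonzero[OF uhom_ff_const] by blast
  have *: "f - ff_const c = 0 \<or> P (f - ff_const c) > 0"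
    using assms(2) by (auto simp: has_value_def place_ideal_def)
  have "f \<noteq> 0 \<and> P f = 0"
  proof (cases "f - ff_const c = 0")
    case True
    thus ?thesis using c place_const[OF assms(1)] by simp
  next
    case False
    with * have "P (ff_const c) < P (f - ff_const c)" using place_const[OF assms(1)] by simp
    from place_add_less[OF assms(1) _ _ c False this] K place_const[OF assms(1), of c]
    show ?thesis by simp
  qed
  thus "f \<noteq> 0" "P f = 0" by auto
qed

lemma has_value_inverse:
  assumes "is_place y P" "has_value y P f c" "c \<noteq> 0"
  shows "has_value y P (inverse f) (inverse c)"
proof -
  have K: "f \<in> function_field y"
    using has_value_in_ring[OF assms(1,2)] by (simp add: place_ring_def)
  note u = has_value_unit[OF assms]
  have c: "ff_const c \<noteq> (0 :: 'a ambient)" using assms(3) uhom_nonzero[OF uhom_ff_const] by blast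
  have ic: "ff_const (inverse c) = (inverse (ff_const c) :: 'a ambient)"
    using uhom_mult[OF uhom_ff_const, of c "inverse c"] assms(3)
    by (metis inverse_unique right_inverse uhom_1[OF uhom_ff_const])
  have "(- (inverse f * ff_const (inverse c))) * (f - ff_const c) \<in> place_ideal y P"
  proof (rule place_ring_mult_ideal[OF assms(1) _ assms(2)[unfolded has_value_def]])
    have "P (inverse f * ff_const (inverse c)) = 0"
      using place_mult[OF assms(1), of "inverse f" "ff_const (inverse c)"] K u c
        place_inverse[OF assms(1) K u(1)] place_const[OF assms(1), of "inverse c"]
      by (simp add: ic)
    thus "- (inverse f * ff_const (inverse c)) \<in> place_ring y P"
      using K place_uminus[OF assms(1), of "inverse f * ff_const (inverse c)"] by (simp add: place_ring_def)
  qed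
  also have "(- (inverse f * ff_const (inverse c))) * (f - ff_const c) = inverse f - ff_const (inverse c)"
    unfolding ic using u c by (simp add: algebra_simps)
  finally show ?thesis by (simp add: has_value_def)
qed

lemma has_value_divide:
  assumes "is_place y P" "has_value y P f c" "has_value y P g d" "d \<noteq> 0"
  shows "has_value y P (f / g) (c / d)"
  using has_value_mult[OF assms(1,2) has_value_inverse[OF assms(1,3,4)]] by (simp add: divide_inverse)

lemma has_value_unique:
  assumes "is_place y P" "has_value y P f c" "has_value y P f d"
  shows "c = d"
proof (rule ccontr)
  assume "c \<noteq> d"
  from has_value_unit[OF assms(1) has_value_diff[OF assms]] this show False by simp
qed

lemma value_at_eq:
  assumes "is_place y P" "has_value y P f c"
  shows "value_at y P f = c"
  unfolding value_at_def
  using has_value_unique[OF assms(1)] assms(2) unfolding has_value_def by blast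

text \<open>The order of the image in a field of Laurent series, divided by a generator \<open>e\<close> of the group
  of all such orders.\<close>

definition series_place ::
    "int \<Rightarrow> ('a::field \<Rightarrow> 'b::field fls) \<Rightarrow> 'b fls \<Rightarrow> 'b fls \<Rightarrow> 'a ambient \<Rightarrow> 'a ambient \<Rightarrow> int" where
  "series_place e h \<xi> \<eta> y f =
     (if f \<in> function_field y then fls_subdegree (ff_embed h \<xi> \<eta> y f) div e else 0)"

section \<open>Places from Laurent series expansions\<close>

context hermitian
begin

lemma ff_embed_divide:
  assumes pt: "herm_point q h \<xi> \<eta>" and "f \<in> function_field y" "g \<in> function_field y"
  shows "ff_embed h \<xi> \<eta> y (f / g) = ff_embed h \<xi> \<eta> y f / ff_embed h \<xi> \<eta> y g"
proof (cases "g = 0")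
  case False
  thus ?thesis
    using ff_embed_mult[OF pt, of "f / g" g] ff_embed_eq_0_iff[OF pt assms(3)] assms
    by (simp add: field_simps)
qed (use ff_embed_eq_0_iff[OF pt, of 0] in simp)

lemma ff_embed_1: "herm_point q h \<xi> \<eta> \<Longrightarrow> ff_embed h \<xi> \<eta> y 1 = 1"
  using ff_embed_const[of h \<xi> \<eta> 1] by (simp add: herm_point_def uhom_1[OF uhom_ff_const] uhom_1[of h])

lemma ff_embed_power:
  assumes pt: "herm_point q h \<xi> \<eta>" and "f \<in> function_field y"
  shows "ff_embed h \<xi> \<eta> y (f ^ n) = ff_embed h \<xi> \<eta> y f ^ n"
  by (induction n) (simp_all add: ff_embed_1[OF pt] ff_embed_mult[OF pt] assms(2))

text \<open>Since \<open>e\<close> divides every order, the division is exact and additivity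
  survives; division by a positive integer is monotone, which preserves the inequality for sums. The
  witness \<open>t\<close> normalises.\<close>

lemma is_place_series_place:
  fixes i :: "'a \<Rightarrow> 'b::field"
  assumes pt: "herm_point q (\<lambda>c. fls_const (i c)) \<xi> \<eta>" and e: "e > 0"
    and dvd: "\<And>f. f \<in> function_field y \<Longrightarrow> e dvd fls_subdegree (ff_embed (\<lambda>c. fls_const (i c)) \<xi> \<eta> y f)"
    and t: "t \<in> function_field y" "fls_subdegree (ff_embed (\<lambda>c. fls_const (i c)) \<xi> \<eta> y t) = e"
  shows "is_place y (series_place e (\<lambda>c. fls_const (i c)) \<xi> \<eta> y)"
  unfolding is_place_def
proof (intro conjI ballI allI impI)
  let ?E = "ff_embed (\<lambda>c. fls_const (i c)) \<xi> \<eta> y"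
  let ?P = "series_place e (\<lambda>c. fls_const (i c)) \<xi> \<eta> y"
  fix f assume "f = 0 \<or> f \<notin> function_field y"
  thus "?P f = 0"
    using ff_embed_eq_0_iff[OF pt, of 0] by (auto simp: series_place_def)
next
  let ?E = "ff_embed (\<lambda>c. fls_const (i c)) \<xi> \<eta> y"
  let ?P = "series_place e (\<lambda>c. fls_const (i c)) \<xi> \<eta> y"
  fix f g assume *: "f \<in> function_field y - {0}" "g \<in> function_field y - {0}"
  hence nz: "?E f \<noteq> 0" "?E g \<noteq> 0" using ff_embed_eq_0_iff[OF pt] by auto
  show "?P (f * g) = ?P f + ?P g"
    using * nz dvd[of f] dvd[of g] by (simp add: series_place_def ff_embed_mult[OF pt] div_plus_div_distrib_dvd_left)
  assume "f + g \<noteq> 0"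
  hence "?E f + ?E g \<noteq> 0"
    using * ff_embed_eq_0_iff[OF pt, of "f + g"] by (simp add: ff_embed_add[OF pt])
  hence "min (fls_subdegree (?E f)) (fls_subdegree (?E g)) \<le> fls_subdegree (?E (f + g))"
    using * by (simp add: ff_embed_add[OF pt] fls_plus_subdegree)
  hence "min (fls_subdegree (?E f)) (fls_subdegree (?E g)) div e \<le> fls_subdegree (?E (f + g)) div e"
    by (rule zdiv_mono1[OF _ e])
  thus "min (?P f) (?P g) \<le> ?P (f + g)"
    using * by (auto simp: series_place_def min_def split: if_splits)
next
  fix c
  show "series_place e (\<lambda>c. fls_const (i c)) \<xi> \<eta> y (ff_const c) = 0"
    by (simp add: series_place_def ff_embed_const[OF pt])
next
  show "\<exists>t\<in>function_field y. series_place e (\<lambda>c. fls_const (i c)) \<xi> \<eta> y t = 1"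
    using t e by (intro bexI[of _ t]) (auto simp: series_place_def)
qed

text \<open>Euclidean division by the least positive order. It is meant for points over the
  algebraic closure, where \<open>x - \<alpha>\<close> need not be in the function field and so no
  function of order 1 is at hand.\<close>

lemma series_value_group:
  fixes i :: "'a \<Rightarrow> 'b::field"
  assumes pt: "herm_point q (\<lambda>c. fls_const (i c)) \<xi> \<eta>"
    and nontriv: "s \<in> function_field y" "fls_subdegree (ff_embed (\<lambda>c. fls_const (i c)) \<xi> \<eta> y s) \<noteq> 0"
  obtains e t where "e > 0" "t \<in> function_field y"
    "fls_subdegree (ff_embed (\<lambda>c. fls_const (i c)) \<xi> \<eta> y t) = e"
    "\<And>f. f \<in> function_field y \<Longrightarrow> e dvd fls_subdegree (ff_embed (\<lambda>c. fls_const (i c)) \<xi> \<eta> y f)"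
proof -
  define v where "v = (\<lambda>f. fls_subdegree (ff_embed (\<lambda>c. fls_const (i c)) \<xi> \<eta> y f))"
  have mult: "v (f * g) = v f + v g"
    if "f \<in> function_field y" "g \<in> function_field y" "f \<noteq> 0" "g \<noteq> 0" for f g
    using that ff_embed_eq_0_iff[OF pt] by (simp add: v_def ff_embed_mult[OF pt])
  have inv: "v (inverse f) = - v f" if "f \<in> function_field y" "f \<noteq> 0" for f
    using mult[of f "inverse f"] that ff_embed_1[OF pt] by (simp add: v_def)
  have pow: "v (f ^ n) = int n * v f" if "f \<in> function_field y" for f n
    using that by (simp add: v_def ff_embed_power[OF pt] fls_subdegree_pow)
  have v0: "v 0 = 0" using ff_embed_eq_0_iff[OF pt, of 0] by (simp add: v_def)
  define Q where "Q = (\<lambda>n. n > 0 \<and> (\<exists>t\<in>function_field y. v t = int n))"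
  have "\<exists>n. Q n"
  proof (cases "v s > 0")
    case True
    thus ?thesis unfolding Q_def using nontriv(1) by (intro exI[of _ "nat (v s)"]) auto
  next
    case False
    have "s \<noteq> 0" using nontriv(2) v0 by (auto simp: v_def)
    moreover have "v s \<noteq> 0" using nontriv(2) by (simp add: v_def)
    ultimately show ?thesis unfolding Q_def using nontriv(1) inv[of s] False
      by (intro exI[of _ "nat (- v s)"] conjI bexI[of _ "inverse s"]) auto
  qed
  define n where "n = (LEAST n. Q n)"
  have "Q n" unfolding n_def using \<open>\<exists>n. Q n\<close> by (rule LeastI_ex)
  then obtain t where t: "n > 0" "t \<in> function_field y" "v t = int n" by (auto simp: Q_def)
  have t0: "t \<noteq> 0" using t v0 by auto
  have "int n dvd v f" if f: "f \<in> function_field y" for f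
  proof (cases "f = 0")
    case False
    define k where "k = v f div int n"
    \<comment> \<open>This is \<open>f / t^k\<close>, split by the sign of \<open>k\<close>; its
      order is the remainder.\<close>
    define g where "g = (if k \<ge> 0 then f * inverse (t ^ nat k) else f * t ^ nat (- k))"
    have "v g = v f - k * int n"
      using f t t0 False by (auto simp: g_def mult inv pow)
    hence g: "v g = v f mod int n" "g \<in> function_field y"
      using f t by (auto simp: k_def minus_div_mult_eq_mod g_def)
    have "\<not> v f mod int n > 0"
    proof
      assume "v f mod int n > 0"
      hence "Q (nat (v g))" unfolding Q_def using g by (intro conjI bexI[of _ g]) auto
      hence "n \<le> nat (v g)" unfolding n_def by (rule Least_le)
      thus False using g(1) t(1) pos_mod_bound[of "int n" "v f"] by linarith
    qed
    moreover have "0 \<le> v f mod int n" using t(1) by simp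
    ultimately show ?thesis by (simp add: dvd_eq_mod_eq_0)
  qed (simp add: v0)
  thus ?thesis using that[of "int n" t] t by (auto simp: v_def)
qed

text \<open>As \<open>q\<close>-th powers are additive, substituting \<open>x = \<alpha> + X\<close>
  and \<open>y = \<beta> + w\<close> leaves \<open>w^q + w = g\<close> with \<open>g\<close> free of
  a constant term, which is solvable.\<close>

lemma affine_series_point:
  fixes i :: "'a \<Rightarrow> 'b::field"
  assumes i: "uhom i" and curve: "\<beta> ^ q + \<beta> = \<alpha> ^ (q + 1)"
  obtains w where "herm_point q (\<lambda>c. fls_const (i c)) (fls_const \<alpha> + fls_X) (fps_to_fls w)" "fps_nth w 0 = \<beta>"
proof -
  note h = uhom_fls_const[OF i]
  define g where "g = (fps_const \<alpha> + fps_X) ^ (q + 1) - fps_const (\<alpha> ^ (q + 1))"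
  have "fps_nth g 0 = 0" by (simp add: g_def fps_nth_power_0)
  then obtain w where w: "w ^ q + w = g" "fps_nth w 0 = 0"
    using fps_additive_solve[OF q_ge] by blast
  define s where "s = fps_to_fls (fps_const \<beta> + w)"
  have s: "s = fls_const \<beta> + fps_to_fls w" by (simp add: s_def)
  have "s ^ q + s = (fls_const \<beta> ^ q + fls_const \<beta>) + (fps_to_fls w ^ q + fps_to_fls w)"
    unfolding s frobenius_add[OF h] by simp
  also have "fls_const \<beta> ^ q + fls_const \<beta> = fls_const (\<alpha> ^ (q + 1))"
    by (simp only: fls_const_power[symmetric] fls_plus_const curve)
  also have "fps_to_fls w ^ q + fps_to_fls w = fps_to_fls g"
    by (simp only: w(1)[symmetric] fps_to_fls_plus fps_to_fls_power)
  also have "fps_to_fls g = (fls_const \<alpha> + fls_X) ^ (q + 1) - fls_const (\<alpha> ^ (q + 1))"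
    by (simp only: g_def fps_to_fls_minus fps_to_fls_power fps_to_fls_plus fps_const_to_fls fps_X_to_fls)
  finally have eq: "s ^ q + s = (fls_const \<alpha> + fls_X) ^ (q + 1)" by simp
  \<comment> \<open>Evaluation at \<open>\<alpha> + X\<close> is translation of the polynomial,
    which keeps it nonzero; hence \<open>\<alpha> + X\<close> is transcendental.\<close>
  have ev: "ev1 (\<lambda>c. fls_const (i c)) (fls_const \<alpha> + fls_X) p =
      fps_to_fls (fps_of_poly (pcompose (map_poly i p) [:\<alpha>, 1:]))" for p
  proof (induction p)
    case (pCons a p)
    have "fps_of_poly [:\<alpha>, 1:] = fps_const \<alpha> + fps_X"
      by (simp add: fps_of_poly_linear add.commute)
    hence *: "fps_of_poly (pcompose (map_poly i (pCons a p)) [:\<alpha>, 1:]) =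
        fps_const (i a) + (fps_const \<alpha> + fps_X) * fps_of_poly (pcompose (map_poly i p) [:\<alpha>, 1:])"
      by (simp only: map_poly_pCons[of i, OF uhom_0[OF i]] pcompose_pCons fps_of_poly_add
          fps_of_poly_mult fps_of_poly_const)
    show ?case
      unfolding * ev1_pCons[OF h] pCons.IH
      by (simp only: fps_to_fls_plus fls_times_fps_to_fls fps_const_to_fls fps_X_to_fls)
  qed simp
  have "ev1 (\<lambda>c. fls_const (i c)) (fls_const \<alpha> + fls_X) p \<noteq> 0" if "p \<noteq> 0" for p
  proof -
    have "map_poly i p \<noteq> 0"
      using that map_poly_eq_0_iff[of i p] uhom_0[OF i] uhom_eq_0_iff[OF i] by blast
    hence "pcompose (map_poly i p) [:\<alpha>, 1:] \<noteq> 0"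
      by (subst pcompose_eq_0_iff) auto
    thus ?thesis unfolding ev by (simp add: fps_of_poly_eq_iff[of _ 0, simplified])
  qed
  hence "herm_point q (\<lambda>c. fls_const (i c)) (fls_const \<alpha> + fls_X) s"
    unfolding herm_point_def using h eq by blast
  moreover have "fps_nth (fps_const \<beta> + w) 0 = \<beta>" using w(2) by simp
  ultimately show ?thesis using that[of "fps_const \<beta> + w"] unfolding s_def by blast
qed

section \<open>The place at a rational affine point\<close>

definition centred :: "'a \<Rightarrow> 'a \<Rightarrow> ('a ambient \<Rightarrow> int) \<Rightarrow> bool" where
  "centred a b P \<longleftrightarrow> is_place y P \<and> has_value y P ff_x a \<and> has_value y P y b"

lemma place_at_altdef: "place_at y a b = (THE P. centred a b P)"
  by (simp add: place_at_def centred_def has_value_def)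

lemma centred_amb:
  assumes "centred a b P"
  shows "has_value y P (amb y A) (ev2 (\<lambda>c. c) a b A)"
proof -
  note P = assms[unfolded centred_def]
  have 1: "has_value y P (ev1 ff_const ff_x p) (ev1 (\<lambda>c. c) a p)" for p
  proof (induction p)
    case 0
    thus ?case using has_value_const[of y P 0] by (simp add: uhom_0[OF uhom_ff_const])
  next
    case (pCons c p)
    thus ?case using P by (simp add: uhom_ff_const uhom_id has_value_add has_value_mult has_value_const)
  qed
  show ?thesis
  proof (induction A)
    case 0
    thus ?case using has_value_const[of y P 0] by (simp add: uhom_0[OF uhom_ff_const])
  next
    case (pCons c p)
    thus ?case using P 1 by (simp add: uhom_ff_const uhom_id has_value_add has_value_mult)
  qed
qed

text \<open>Divide by \<open>y - b\<close> first; the remainder is a polynomial in x alone vanishing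
  at \<open>a\<close>.\<close>

lemma vanishing_decomposition:
  assumes "ev2 (\<lambda>c. c) a b A = (0 :: 'a)"
  obtains B C where "A = [:[:- a, 1:]:] * B + [:[:- b:], 1:] * C"
proof -
  have "poly (A - [:poly A [:b:]:]) [:b:] = 0" by simp
  then obtain C where C: "A - [:poly A [:b:]:] = [:- [:b:], 1:] * C"
    unfolding poly_eq_0_iff_dvd by (elim dvdE)
  have "ev2 (\<lambda>c. c) a b Q = poly (poly Q [:b:]) a" for Q
    by (induction Q) (simp_all add: uhom_id ev1_id)
  hence "poly (poly A [:b:]) a = 0" using assms by simp
  then obtain B where B: "poly A [:b:] = [:- a, 1:] * B"
    unfolding poly_eq_0_iff_dvd by (elim dvdE)
  have "A = [:poly A [:b:]:] + [:- [:b:], 1:] * C" using C by (simp add: algebra_simps)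
  also have "[:poly A [:b:]:] = [:[:- a, 1:]:] * [:B:]" using B by simp
  finally show ?thesis using that[of "[:B:]" C] by simp
qed

lemma amb_x_minus: "amb y [:[:- a, 1:]:] = ff_x - ff_const a"
  and amb_y_minus: "amb y [:[:- b:], 1:] = y - ff_const b"
  by (simp_all add: uhom_ff_const uhom_0[OF uhom_ff_const] uhom_1[OF uhom_ff_const]
      uhom_uminus[OF uhom_ff_const] uhom_1[OF uhom_ev1[OF uhom_ff_const]])

text \<open>By additivity, \<open>(y - b)^q + (y - b)\<close> equals
  \<open>x^(q+1) - a^(q+1)\<close>, and the latter is divisible by \<open>x - a\<close>.\<close>

lemma local_relation:
  assumes curve: "b ^ q + b = a ^ (q + 1)"
  obtains g where "(y - ff_const b) * (1 + (y - ff_const b) ^ (q - 1)) = (ff_x - ff_const a) * amb y g"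
proof -
  have "poly (monom 1 (q + 1) - [:a ^ (q + 1):]) a = 0" by (simp add: poly_monom)
  then obtain g where g: "monom 1 (q + 1) - [:a ^ (q + 1):] = [:- a, 1:] * g"
    unfolding poly_eq_0_iff_dvd by (elim dvdE)
  have "ff_x ^ (q + 1) - ff_const (a ^ (q + 1)) = ev1 ff_const ff_x (monom 1 (q + 1) - [:a ^ (q + 1):])"
    by (simp only: uhom_diff[OF uhom_ev1[OF uhom_ff_const]] ev1_monom[OF uhom_ff_const])
       (simp add: uhom_ff_const uhom_1[OF uhom_ff_const])
  also have "\<dots> = (ff_x - ff_const a) * amb y [:g:]"
    unfolding g
    by (simp only: uhom_mult[OF uhom_ev1[OF uhom_ff_const]])
       (simp add: uhom_ff_const uhom_1[OF uhom_ff_const] uhom_uminus[OF uhom_ff_const])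
  finally have "ff_x ^ (q + 1) - ff_const (a ^ (q + 1)) = (ff_x - ff_const a) * amb y [:g:]" .
  moreover have "(y - ff_const b) * (1 + (y - ff_const b) ^ (q - 1)) = (y - ff_const b) ^ q + (y - ff_const b)"
    using power_Suc[of "y - ff_const b" "q - 1"] q_ge by (simp add: algebra_simps)
  moreover have "(y - ff_const b) ^ q + (y - ff_const b) = ff_x ^ (q + 1) - ff_const (a ^ (q + 1))"
    unfolding frobenius_diff[OF uhom_ff_const] curve[symmetric] hermitian_eq[symmetric]
    by (simp add: uhom_add[OF uhom_ff_const] uhom_power[OF uhom_ff_const])
  ultimately show ?thesis using that by metis
qed

lemma x_minus_nonzero: "ff_x - ff_const a \<noteq> (0 :: 'a ambient)"
proof -
  have "ff_x - ff_const a = (ev1 ff_const ff_x [:- a, 1:] :: 'a ambient)"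
    by (simp add: uhom_ff_const uhom_1[OF uhom_ff_const] uhom_uminus[OF uhom_ff_const])
  thus ?thesis by (simp only: ev1_ff) simp
qed

text \<open>In the local ring at a rational affine point, \<open>x - a\<close> generates the maximal ideal: by
  \<open>local_relation\<close>, \<open>y - b\<close> is a multiple of it up to the unit \<open>1 + (y - b)\<^sup>q\<^sup>-\<^sup>1\<close>. Dividing repeatedly
  by \<open>x - a\<close> computes every centred place from a single one.\<close>

lemma centred_order:
  assumes curve: "b ^ q + b = a ^ (q + 1)"
    and P: "centred a b P" and R: "centred a b R" "R (ff_x - ff_const a) = 1"
  shows "amb y A \<noteq> 0 \<Longrightarrow> R (amb y A) = int n \<Longrightarrow> P (amb y A) = int n * P (ff_x - ff_const a)"
proof (induction n arbitrary: A rule: less_induct)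
  case (less n)
  note pP = P[unfolded centred_def, THEN conjunct1] and pR = R(1)[unfolded centred_def, THEN conjunct1]
  show ?case
  proof (cases "ev2 (\<lambda>c. c) a b A = 0")
    case False
    from has_value_unit(2)[OF pP centred_amb[OF P] False] has_value_unit(2)[OF pR centred_amb[OF R(1)] False]
    show ?thesis using less.prems(2) by simp
  next
    case True
    then obtain B C where A: "A = [:[:- a, 1:]:] * B + [:[:- b:], 1:] * C"
      by (rule vanishing_decomposition)
    obtain g where g: "(y - ff_const b) * (1 + (y - ff_const b) ^ (q - 1)) = (ff_x - ff_const a) * amb y g"
      using local_relation[OF curve] by blast
    \<comment> \<open>Multiplying by the unit \<open>U\<close> turns the \<open>y - b\<close> part
      of \<open>A\<close> into a multiple of \<open>x - a\<close>; on the curve, \<open>D\<close> is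
      \<open>A U / (x - a)\<close>.\<close>
    define U where "U = 1 + [:[:- b:], 1:] ^ (q - 1)"
    define D where "D = B * U + g * C"
    have U: "amb y U = 1 + (y - ff_const b) ^ (q - 1)"
      by (simp only: U_def uhom_add[OF uhom_amb] uhom_1[OF uhom_amb] uhom_power[OF uhom_amb] amb_y_minus)
    have U1: "ev2 (\<lambda>c. c) a b U = 1"
      using q_ge by (simp add: U_def uhom_add[OF uhom_ev2[OF uhom_id]] uhom_1[OF uhom_ev2[OF uhom_id]]
          uhom_power[OF uhom_ev2[OF uhom_id]] uhom_id zero_power uhom_1[OF uhom_ev1[OF uhom_id]])
    have u0: "amb y U \<noteq> 0" "P (amb y U) = 0" "R (amb y U) = 0"
      using has_value_unit[OF pP centred_amb[OF P], of U] has_value_unit[OF pR centred_amb[OF R(1)], of U]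
      by (auto simp: U1)
    have "amb y A * amb y U = (ff_x - ff_const a) * (amb y B * amb y U) +
        ((y - ff_const b) * (1 + (y - ff_const b) ^ (q - 1))) * amb y C"
      unfolding A uhom_add[OF uhom_amb] uhom_mult[OF uhom_amb] amb_x_minus amb_y_minus U
      by (simp add: algebra_simps)
    also have "\<dots> = (ff_x - ff_const a) * amb y D"
      unfolding g by (simp add: D_def uhom_add[OF uhom_amb] uhom_mult[OF uhom_amb] algebra_simps)
    finally have eq: "amb y A * amb y U = (ff_x - ff_const a) * amb y D" .
    hence D0: "amb y D \<noteq> 0" using less.prems(1) u0(1) by auto
    have PA: "P (amb y A) = P (ff_x - ff_const a) + P (amb y D)"
      using arg_cong[OF eq, of P] place_mult[OF pP, of "amb y A" "amb y U"]
        place_mult[OF pP, of "ff_x - ff_const a" "amb y D"] u0 D0 less.prems(1) x_minus_nonzero by simp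
    have RA: "R (amb y A) = R (ff_x - ff_const a) + R (amb y D)"
      using arg_cong[OF eq, of R] place_mult[OF pR, of "amb y A" "amb y U"]
        place_mult[OF pR, of "ff_x - ff_const a" "amb y D"] u0 D0 less.prems(1) x_minus_nonzero by simp
    have "R (amb y D) \<ge> 0"
      using has_value_in_ring[OF pR centred_amb[OF R(1), of D]] D0 by (simp add: place_ring_def)
    hence n: "n > 0" "R (amb y D) = int (n - 1)"
      using RA R(2) less.prems(2) by auto
    have "P (amb y D) = int (n - 1) * P (ff_x - ff_const a)"
      using less.IH[of "n - 1" D] n D0 by simp
    thus ?thesis using PA n(1) by (simp add: algebra_simps of_nat_diff)
  qed
qed

text \<open>\<open>P\<close> is \<open>R\<close> times the constant \<open>P(x - a)\<close>. This
  constant is positive and, as \<open>P\<close> takes the value 1, divides 1.\<close>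

lemma centred_unique:
  assumes curve: "b ^ q + b = a ^ (q + 1)"
    and P: "centred a b P" and R: "centred a b R" "R (ff_x - ff_const a) = 1"
  shows "P = R"
proof -
  note pP = P[unfolded centred_def, THEN conjunct1] and pR = R(1)[unfolded centred_def, THEN conjunct1]
  have *: "P (amb y A) = R (amb y A) * P (ff_x - ff_const a)" if "amb y A \<noteq> 0" for A
  proof -
    have "R (amb y A) \<ge> 0"
      using has_value_in_ring[OF pR centred_amb[OF R(1), of A]] that by (simp add: place_ring_def)
    thus ?thesis using centred_order[OF curve P R that, of "nat (R (amb y A))"] by simp
  qed
  have **: "P f = R f * P (ff_x - ff_const a)" if "f \<in> function_field y" for f
  proof (cases "f = 0")
    case False
    obtain A B where f: "f = amb y A / amb y B" "amb y B \<noteq> 0"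
      using function_fieldE[OF \<open>f \<in> function_field y\<close>] .
    with False have "amb y A \<noteq> 0" by auto
    thus ?thesis unfolding f(1)
      using f(2) *[of A] *[of B] by (simp add: place_divide[OF pP] place_divide[OF pR] algebra_simps)
  qed (simp add: place_0[OF pP] place_0[OF pR])
  have "P (ff_x - ff_const a) > 0"
    using P x_minus_nonzero[of a] by (auto simp: centred_def has_value_def place_ideal_def)
  moreover obtain t where "t \<in> function_field y" "P t = 1" using place_uniformizer[OF pP] by blast
  hence "R t * P (ff_x - ff_const a) = 1" using ** by metis
  ultimately have "P (ff_x - ff_const a) = 1"
    by (metis pos_zmult_eq_1_iff mult.commute)
  show ?thesis
  proof
    fix f show "P f = R f"
      using **[of f] \<open>P (ff_x - ff_const a) = 1\<close> place_outside[OF pP] place_outside[OF pR]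
      by (cases "f \<in> function_field y") auto
  qed
qed

text \<open>The order of the expansion in \<open>X = x - a\<close>. Here \<open>x - a\<close> has
  order 1, so the divisor of orders is 1, and the constant coefficient of a regular expansion is the
  value.\<close>

lemma rational_place_exists:
  assumes curve: "b ^ q + b = a ^ (q + 1)"
  shows "\<exists>P. centred a b P \<and> P (ff_x - ff_const a) = 1 \<and> (\<forall>f\<in>place_ring y P. \<exists>c. has_value y P f c)"
proof -
  obtain w where pt: "herm_point q (\<lambda>c. fls_const c) (fls_const a + fls_X) (fps_to_fls w)" and w: "fps_nth w 0 = b"
    using affine_series_point[OF uhom_id curve] by blast
  define E where "E = ff_embed (\<lambda>c. fls_const c) (fls_const a + fls_X) (fps_to_fls w) y"
  define P where "P = series_place 1 (\<lambda>c. fls_const c) (fls_const a + fls_X) (fps_to_fls w) y"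
  have Ex: "E (ff_x - ff_const a) = fls_X"
    by (simp add: E_def ff_embed_diff[OF pt] ff_embed_x[OF pt] ff_embed_const[OF pt])
  have P: "is_place y P"
    unfolding P_def by (rule is_place_series_place[OF pt, of _ "ff_x - ff_const a"]) (use Ex in \<open>auto simp: E_def\<close>)
  have PE: "P f = fls_subdegree (E f)" if "f \<in> function_field y" for f
    using that by (simp add: P_def E_def series_place_def)
  have val: "has_value y P f c"
    if f: "f \<in> function_field y" "fls_nth (E f) 0 = c" "\<And>k. k < 0 \<Longrightarrow> fls_nth (E f) k = 0" for f c
  proof -
    have E: "E (f - ff_const c) = E f - fls_const c"
      using f by (simp add: E_def ff_embed_diff[OF pt] ff_embed_const[OF pt])
    have "f - ff_const c = 0 \<or> fls_subdegree (E (f - ff_const c)) > 0"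
    proof (cases "f - ff_const c = 0")
      case False
      hence "E f - fls_const c \<noteq> 0"
        using f ff_embed_eq_0_iff[OF pt, of "f - ff_const c"] E by (simp add: E_def)
      moreover have "fls_nth (E f - fls_const c) k = 0" if "k \<le> 0" for k
        using f(2,3) that by (cases "k = 0") auto
      ultimately show ?thesis unfolding E by (intro disjI2 fls_subdegree_greaterI) auto
    qed simp
    thus ?thesis using f(1) PE[of "f - ff_const c"] by (auto simp: has_value_def place_ideal_def)
  qed
  have "has_value y P ff_x a" by (rule val) (auto simp: E_def ff_embed_x[OF pt])
  moreover have "has_value y P y b" by (rule val) (use w in \<open>auto simp: E_def ff_embed_y[OF pt]\<close>)
  moreover have "\<exists>c. has_value y P f c" if "f \<in> place_ring y P" for f
  proof (intro exI val)
    show "f \<in> function_field y" using that by (simp add: place_ring_def)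
    fix k :: int assume "k < 0"
    show "fls_nth (E f) k = 0"
    proof (cases "f = 0")
      case False
      thus ?thesis using that PE[of f] \<open>k < 0\<close> by (auto simp: place_ring_def)
    qed (use ff_embed_eq_0_iff[OF pt, of 0] in \<open>simp add: E_def\<close>)
  qed simp
  moreover have "P (ff_x - ff_const a) = 1" using Ex PE by simp
  ultimately show ?thesis using P by (auto simp: centred_def)
qed

lemma place_at_props:
  assumes curve: "b ^ q + b = a ^ (q + 1)"
  shows centred_place_at: "centred a b (place_at y a b)"
    and place_at_x_minus: "place_at y a b (ff_x - ff_const a) = 1"
    and place_at_has_value: "f \<in> place_ring y (place_at y a b) \<Longrightarrow> \<exists>c. has_value y (place_at y a b) f c"
    and place_at_unique: "centred a b P \<Longrightarrow> P = place_at y a b"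
proof -
  obtain R where R: "centred a b R" "R (ff_x - ff_const a) = 1"
    "\<forall>f\<in>place_ring y R. \<exists>c. has_value y R f c" using rational_place_exists[OF curve] by blast
  have eq: "place_at y a b = R"
    unfolding place_at_altdef using R(1) centred_unique[OF curve _ R(1,2)] by (rule the_equality)
  show "centred a b (place_at y a b)" "place_at y a b (ff_x - ff_const a) = 1"
    unfolding eq by (fact R)+
  show "f \<in> place_ring y (place_at y a b) \<Longrightarrow> \<exists>c. has_value y (place_at y a b) f c"
    unfolding eq by (rule bspec[OF R(3)])
  show "centred a b P \<Longrightarrow> P = place_at y a b"
    unfolding eq by (rule centred_unique[OF curve _ R(1,2)])
qed

text \<open>Every residue class is a constant, so \<open>{1}\<close> is a basis. That no other
  cardinality fits the definite description is a counting argument over the finite field.\<close>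

lemma place_degree_place_at:
  assumes curve: "b ^ q + b = a ^ (q + 1)"
  shows "place_degree y (place_at y a b) = 1"
proof -
  define P where "P = place_at y a b"
  have P: "is_place y P" using centred_place_at[OF curve] by (simp add: P_def centred_def)
  have ex1: "\<exists>!c. has_value y P f c" if "f \<in> place_ring y P" for f
    using place_at_has_value[OF curve, of f] has_value_unique[OF P] that by (auto simp: P_def)
  have ff1: "ff_const 1 = (1 :: 'a ambient)" by (rule uhom_1[OF uhom_ff_const])
  show ?thesis
    unfolding place_degree_def P_def[symmetric]
  proof (rule the_equality)
    have "\<exists>!c. c \<in> {1} \<rightarrow>\<^sub>E UNIV \<and> f - (\<Sum>b\<in>{1}. ff_const (c b) * b) \<in> place_ideal y P"
      if f: "f \<in> place_ring y P" for f
    proof -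
      obtain d where d: "has_value y P f d" using ex1[OF f] by blast
      show ?thesis
      proof (rule ex1I[of _ "\<lambda>b\<in>{1}. d"])
        show "(\<lambda>b\<in>{1}. d) \<in> {1} \<rightarrow>\<^sub>E UNIV \<and>
            f - (\<Sum>b\<in>{1}. ff_const ((\<lambda>b\<in>{1}. d) b) * b) \<in> place_ideal y P"
          using d by (simp add: has_value_def)
        fix c assume c: "c \<in> {1} \<rightarrow>\<^sub>E UNIV \<and> f - (\<Sum>b\<in>{1}. ff_const (c b) * b) \<in> place_ideal y P"
        hence "has_value y P f (c 1)" by (simp add: has_value_def)
        hence "c 1 = d" using d has_value_unique[OF P] by blast
        thus "c = (\<lambda>b\<in>{1}. d)" using c by (auto simp: PiE_def extensional_def fun_eq_iff)
      qed
    qed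
    moreover have "{1} \<subseteq> place_ring y P"
      using place_ring_const[OF P, of 1] ff1 by simp
    ultimately show "\<exists>B. finite B \<and> card B = 1 \<and> B \<subseteq> place_ring y P \<and>
       (\<forall>f\<in>place_ring y P. \<exists>!c. c \<in> B \<rightarrow>\<^sub>E UNIV \<and>
          f - (\<Sum>b\<in>B. ff_const (c b) * b) \<in> place_ideal y P)"
      by (intro exI[of _ "{1}"]) simp
  next
    fix n assume "\<exists>B. finite B \<and> card B = n \<and> B \<subseteq> place_ring y P \<and>
       (\<forall>f\<in>place_ring y P. \<exists>!c. c \<in> B \<rightarrow>\<^sub>E UNIV \<and>
          f - (\<Sum>b\<in>B. ff_const (c b) * b) \<in> place_ideal y P)"
    then obtain B where B': "finite B" "card B = n" "B \<subseteq> place_ring y P"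
      "\<forall>f\<in>place_ring y P. \<exists>!c. c \<in> B \<rightarrow>\<^sub>E UNIV \<and>
          f - (\<Sum>b\<in>B. ff_const (c b) * b) \<in> place_ideal y P" by (elim exE conjE)
    note B = B'(1-3) bspec[OF B'(4)]
    define s where "s = (\<lambda>c. \<Sum>b\<in>B. ff_const (c b) * b)"
    have s: "s c \<in> place_ring y P" for c
    proof -
      have "(\<Sum>b\<in>C. ff_const (c b) * b) \<in> place_ring y P" if "C \<subseteq> B" for C
        using finite_subset[OF that B(1)] that
      proof (induction C rule: finite_induct)
        case empty
        show ?case by (simp add: place_ring_def)
      next
        case (insert b C)
        have "ff_const (c b) * b \<in> place_ring y P"
          using insert.prems B(3) by (intro place_ring_mult[OF P] place_ring_const[OF P]) auto
        thus ?case using insert place_ring_add[OF P] by simp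
      qed
      thus ?thesis by (simp add: s_def)
    qed
    define V where "V = (\<lambda>c. THE d. has_value y P (s c) d)"
    have V: "has_value y P (s c) (V c)" for c
      unfolding V_def by (rule theI'[OF ex1[OF s]])
    \<comment> \<open>Unique representation makes coefficient vectors over \<open>B\<close>
      correspond to residue classes, that is to elements of F; hence
      \<open>CARD('a) ^ n = CARD('a)\<close>.\<close>
    have "bij_betw V (B \<rightarrow>\<^sub>E UNIV) UNIV"
    proof (rule bij_betwI')
      fix c c' :: "'a ambient \<Rightarrow> 'a" assume c: "c \<in> B \<rightarrow>\<^sub>E UNIV" "c' \<in> B \<rightarrow>\<^sub>E UNIV"
      show "V c = V c' \<longleftrightarrow> c = c'"
      proof
        assume "V c = V c'"
        hence "has_value y P (s c - s c') 0" using has_value_diff[OF P V[of c] V[of c']] by simp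
        hence "s c - s c' \<in> place_ideal y P" by (simp add: has_value_def uhom_0[OF uhom_ff_const])
        moreover have "s c - s c \<in> place_ideal y P" by (simp add: place_ideal_0)
        ultimately show "c = c'" using B(4)[OF s[of c]] c unfolding s_def by blast
      qed simp
    next
      fix d :: 'a
      obtain c where c: "c \<in> B \<rightarrow>\<^sub>E UNIV" "ff_const d - s c \<in> place_ideal y P"
        using B(4)[OF place_ring_const[OF P, of d]] unfolding s_def by blast
      have "has_value y P (ff_const d - s c) (d - V c)"
        by (rule has_value_diff[OF P has_value_const V])
      moreover have "has_value y P (ff_const d - s c) 0"
        using c(2) by (simp add: has_value_def uhom_0[OF uhom_ff_const])
      ultimately have "d - V c = 0" using has_value_unique[OF P] by blast
      thus "\<exists>c\<in>B \<rightarrow>\<^sub>E UNIV. d = V c" using c(1) by auto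
    qed simp
    hence "card (B \<rightarrow>\<^sub>E (UNIV :: 'a set)) = CARD('a)" by (rule bij_betw_same_card)
    hence "CARD('a) ^ n = CARD('a) ^ 1" using B(1,2) by (simp add: card_PiE)
    moreover have "CARD('a) > 1" using card_field one_less_power[of q 2] q_ge by simp
    ultimately show "n = 1" by (metis power_inject_exp)
  qed
qed

end

section \<open>Functions without affine poles\<close>

lemma fls_regular_add:
  "fls_subdegree f \<ge> 0 \<Longrightarrow> fls_subdegree g \<ge> 0 \<Longrightarrow> fls_subdegree (f + g) \<ge> 0"
  using fls_plus_subdegree[of f g] by (cases "f + g = 0") auto

lemma fls_regular_diff:
  fixes f g :: "'b::ring_1 fls"
  shows "fls_subdegree f \<ge> 0 \<Longrightarrow> fls_subdegree g \<ge> 0 \<Longrightarrow> fls_subdegree (f - g) \<ge> 0"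
  using fls_regular_add[of f "- g"] by simp

lemma fls_regular_mult:
  fixes f g :: "'b::idom fls"
  shows "fls_subdegree f \<ge> 0 \<Longrightarrow> fls_subdegree g \<ge> 0 \<Longrightarrow> fls_subdegree (f * g) \<ge> 0"
  by (cases "f = 0"; cases "g = 0") auto

text \<open>Newton interpolation: split off one node by synthetic division and apply induction to
  the quotient on the remaining nodes.\<close>

lemma fls_interpolation_regular:
  fixes p :: "'b::field fls poly"
  assumes "finite S" "degree p < card S"
    and "\<And>s. s \<in> S \<Longrightarrow> fls_subdegree s \<ge> 0" "\<And>s. s \<in> S \<Longrightarrow> fls_subdegree (poly p s) \<ge> 0"
    and "\<And>s t. s \<in> S \<Longrightarrow> t \<in> S \<Longrightarrow> s \<noteq> t \<Longrightarrow> fls_subdegree (s - t) = 0"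
  shows "fls_subdegree (coeff p j) \<ge> 0"
  using assms
proof (induction "card S" arbitrary: S p j)
  case (Suc n)
  then obtain s where s: "s \<in> S" by fastforce
  define r where "r = synthetic_div p s"
  have p: "p = [:- s, 1:] * r + [:poly p s:]"
    unfolding r_def by (rule synthetic_div_correct'[symmetric])
  have "fls_subdegree (coeff r k) \<ge> 0" for k
  proof (cases "degree p = 0")
    case True
    hence "r = 0" unfolding r_def by (simp add: synthetic_div_eq_0_iff)
    thus ?thesis by simp
  next
    case False
    show ?thesis
    proof (rule Suc.hyps(1)[of "S - {s}" r])
      show "n = card (S - {s})" using Suc.hyps(2) s Suc.prems(1) by simp
      show "degree r < card (S - {s})"
        using False Suc.prems(1,2) s unfolding r_def degree_synthetic_div by simp
      fix t assume t: "t \<in> S - {s}"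
      \<comment> \<open>At another node \<open>t\<close> the quotient is a divided difference,
        regular because \<open>t - s\<close> has order 0.\<close>
      have "poly p t = (t - s) * poly r t + poly p s"
        by (subst p) (simp add: algebra_simps)
      hence "poly r t = (poly p t - poly p s) * inverse (t - s)"
        using t by (simp add: field_simps)
      moreover have "fls_subdegree (inverse (t - s)) = 0"
        using Suc.prems(5)[of t s] t s by simp
      ultimately show "fls_subdegree (poly r t) \<ge> 0"
        using Suc.prems(4)[of t] Suc.prems(4)[of s] s t
        by (simp add: fls_regular_mult fls_regular_diff)
    qed (use Suc.prems in auto)
  qed note r = this
  have "coeff p j = (case j of 0 \<Rightarrow> poly p s | Suc k \<Rightarrow> coeff r k) - s * coeff r j"
    by (subst p) (simp add: coeff_pCons split: nat.split)
  thus ?case using r Suc.prems(3,4)[OF s]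
    by (simp add: fls_regular_diff fls_regular_mult split: nat.split)
qed simp

lemma amb_eq_poly_in_x: "amb y [:p:] = to_ac (to_fract p)"
  by (simp add: uhom_ff_const ev1_ff)

text \<open>Roots live in the algebraic closure, but cancellation has to happen in F[x]; this
  polynomial turns a common root into a common factor.\<close>

lemma min_poly_alg_closure:
  fixes \<alpha> :: "'a::field alg_closure"
  obtains m :: "'a poly" where "m \<noteq> 0" "degree m > 0" "\<And>p. ev1 to_ac \<alpha> p = 0 \<Longrightarrow> m dvd p"
proof -
  have u: "uhom (to_ac :: 'a \<Rightarrow> _)" by (simp add: uhom_def)
  define Q where "Q = (\<lambda>p :: 'a poly. p \<noteq> 0 \<and> ev1 to_ac \<alpha> p = 0)"
  obtain p0 where "Q p0" unfolding Q_def ev1_def using alg_closure_algebraic[of \<alpha>] by blast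
  define m where "m = arg_min degree Q"
  have m: "Q m" and min: "\<And>p. Q p \<Longrightarrow> degree m \<le> degree p"
    unfolding m_def using arg_min_natI[of Q p0 degree] arg_min_nat_le[of Q _ degree] \<open>Q p0\<close> by auto
  show ?thesis
  proof (rule that[of m])
    show "m \<noteq> 0" using m by (simp add: Q_def)
    show "degree m > 0"
    proof (rule ccontr)
      assume "\<not> degree m > 0"
      then obtain c where "m = [:c:]" by (metis degree_eq_zeroE gr0I)
      thus False using m by (simp add: Q_def u)
    qed
    fix p assume p: "ev1 to_ac \<alpha> p = 0"
    have "p = m * (p div m) + p mod m" by simp
    hence "ev1 to_ac \<alpha> p = ev1 to_ac \<alpha> m * ev1 to_ac \<alpha> (p div m) + ev1 to_ac \<alpha> (p mod m)"
      by (metis ev1_add[OF u] ev1_mult[OF u])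
    hence "ev1 to_ac \<alpha> (p mod m) = 0" using p m by (simp add: Q_def)
    hence "p mod m = 0"
      using min[of "p mod m"] degree_mod_less[of m p] m by (fastforce simp: Q_def)
    thus "m dvd p" by auto
  qed
qed

context hermitian
begin

section \<open>Functions regular wherever x is regular\<close>

lemma amb_inverse_multiple:
  assumes "amb y B \<noteq> 0"
  obtains C d where "d \<noteq> 0" "amb y B * amb y C = to_ac (to_fract d)"
proof -
  obtain p :: "'a poly fract poly" where p: "p \<noteq> 0" "poly (map_poly to_ac p) (amb y B) = 0"
    using alg_closure_algebraic by blast
  obtain d P where dP: "d \<noteq> 0" "P = 0 \<longrightarrow> p = 0"
    "\<And>z. to_ac (to_fract d) * poly (map_poly to_ac p) z = amb z P"
    using clear_denominators[of p] by blast
  have "P \<noteq> 0" "amb (amb y B) P = 0" using p dP(2) dP(3)[of "amb y B"] by auto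
  \<comment> \<open>Strip factors of the element from its algebraic relation until the constant term
    is nonzero; the rest is then a multiple of the element equal to a nonzero polynomial in
    x.\<close>
  hence "\<exists>Q d. d \<noteq> 0 \<and> amb y B * amb (amb y B) Q = to_ac (to_fract d)"
  proof (induction P)
    case (pCons c P)
    have eq: "to_ac (to_fract c) + amb y B * amb (amb y B) P = 0"
      using pCons.prems by (simp add: uhom_ff_const ev1_ff)
    show ?case
    proof (cases "c = 0")
      case True
      thus ?thesis using eq pCons assms by auto
    next
      case False
      thus ?thesis using eq
        by (intro exI[of _ P] exI[of _ "- c"]) (simp add: eq_neg_iff_add_eq_0 add.commute)
    qed
  qed simp
  then obtain Q d where Q: "d \<noteq> 0" "amb y B * amb (amb y B) Q = to_ac (to_fract d)" by blast
  have "\<exists>C. amb (amb y B) Q = amb y C"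
  proof (induction Q)
    case 0
    show ?case by (intro exI[of _ 0]) simp
  next
    case (pCons c Q)
    then obtain C where "amb (amb y B) Q = amb y C" by blast
    thus ?case
      by (intro exI[of _ "[:c:] + B * C"])
         (simp only: uhom_add[OF uhom_amb] uhom_mult[OF uhom_amb] amb_eq_poly_in_x
            ev2_pCons[OF uhom_ff_const] ev1_ff ev2_0 mult_zero_right add_0_right)
  qed
  thus ?thesis using Q that by metis
qed

lemma amb_reduce:
  obtains R where "degree R < q" "amb y A = amb y R"
proof -
  obtain Q R where QR: "A = herm_poly q * Q + R" "degree R < q"
    using herm_poly_division[OF q_ge] by blast
  have "amb y (herm_poly q) = 0"
    using herm_point_zero_iff[OF q_ge herm_point_generic] by simp
  thus ?thesis using QR that by (simp add: uhom_add[OF uhom_amb] uhom_mult[OF uhom_amb])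
qed

lemma function_field_normal_form:
  assumes "f \<in> function_field y"
  obtains A d where "d \<noteq> 0" "degree A < q" "f = amb y A / to_ac (to_fract d)"
proof -
  obtain A B where f: "f = amb y A / amb y B" "amb y B \<noteq> 0"
    using function_fieldE[OF assms] .
  obtain C d where C: "d \<noteq> 0" "amb y B * amb y C = to_ac (to_fract d)"
    using amb_inverse_multiple[OF f(2)] .
  obtain R where R: "degree R < q" "amb y (A * C) = amb y R" using amb_reduce .
  have "amb y C \<noteq> 0" using C by auto
  hence "f = amb y (A * C) / (amb y B * amb y C)"
    using f by (simp add: uhom_mult[OF uhom_amb])
  thus ?thesis using that[of d R] C R by simp
qed

lemma herm_point_translate:
  assumes pt: "herm_point q h \<xi> \<eta>" and c: "c \<in> trace_kernel"
  shows "herm_point q h \<xi> (\<eta> + h c)"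
proof -
  note h = pt[unfolded herm_point_def, THEN conjunct1]
  have "(\<eta> + h c) ^ q + (\<eta> + h c) = (\<eta> ^ q + \<eta>) + h (c ^ q + c)"
    by (simp add: frobenius_add[OF h] uhom_add[OF h] uhom_power[OF h])
  also have "h (c ^ q + c) = 0" using c uhom_0[OF h] by (simp add: trace_kernel_def)
  finally have "(\<eta> + h c) ^ q + (\<eta> + h c) = \<eta> ^ q + \<eta>" by simp
  thus ?thesis using pt unfolding herm_point_def by metis
qed

text \<open>The \<open>q\<close> points over \<open>x = \<alpha>\<close> are translates of each other by the kernel of the trace, so the
  coefficients with respect to \<open>1, y, \<dots>, y\<^sup>q\<^sup>-\<^sup>1\<close> of a function regular at all of them are
  regular at \<open>\<alpha>\<close> by Lagrange interpolation.\<close>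

lemma coeff_vanish_at_pole:
  fixes \<alpha> :: "'a alg_closure"
  assumes reg: "\<And>P. is_place y P \<Longrightarrow> P ff_x \<ge> 0 \<Longrightarrow> P f \<ge> 0"
    and f: "f = amb y A / to_ac (to_fract d)" "degree A < q" "d \<noteq> 0"
    and root: "ev1 to_ac \<alpha> d = 0"
  shows "ev1 to_ac \<alpha> (coeff A j) = 0"
proof -
  have u: "uhom (to_ac :: 'a \<Rightarrow> _)" by (simp add: uhom_def)
  define h where "h = (\<lambda>c :: 'a. fls_const (to_ac c))"
  have h: "uhom h" unfolding h_def by (rule uhom_fls_const[OF u])
  obtain \<beta> where \<beta>: "\<beta> ^ q + \<beta> = \<alpha> ^ (q + 1)"
  proof -
    have "degree (monom 1 q + (monom 1 1 - [:\<alpha> ^ (q + 1):])) = q"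
    proof (subst degree_add_eq_left)
      have "degree (monom 1 1 - [:\<alpha> ^ (q + 1):]) \<le> 1"
        by (intro degree_diff_le) (auto simp: degree_monom_eq)
      thus "degree (monom 1 1 - [:\<alpha> ^ (q + 1):]) < degree (monom (1 :: 'a alg_closure) q)"
        using q_ge by (simp add: degree_monom_eq)
    qed (simp add: degree_monom_eq)
    then obtain \<beta> where "poly (monom 1 q + (monom 1 1 - [:\<alpha> ^ (q + 1):])) \<beta> = 0"
      using alg_closed_imp_poly_has_root[of "monom 1 q + (monom 1 1 - [:\<alpha> ^ (q + 1):])"] q_ge by auto
    hence "\<beta> ^ q + \<beta> - \<alpha> ^ (q + 1) = 0" by (simp add: poly_monom add_diff_eq)
    thus ?thesis using that by (simp only: right_minus_eq)
  qed
  define \<xi> where "\<xi> = fls_const \<alpha> + fls_X"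
  obtain w where pt: "herm_point q h \<xi> (fps_to_fls w)"
    using affine_series_point[OF u \<beta>] unfolding \<xi>_def h_def by blast
  define \<eta> where "\<eta> = fps_to_fls w"
  note pt = pt[folded \<eta>_def]
  \<comment> \<open>Setting \<open>X = 0\<close> in \<open>p(\<alpha> + X)\<close> recovers
    \<open>p(\<alpha>)\<close>.\<close>
  have ev: "\<exists>g. ev1 h \<xi> p = fps_to_fls g \<and> fps_nth g 0 = ev1 to_ac \<alpha> p" for p
  proof (induction p)
    case 0
    show ?case by (intro exI[of _ 0]) simp
  next
    case (pCons c p)
    then obtain g where g: "ev1 h \<xi> p = fps_to_fls g" "fps_nth g 0 = ev1 to_ac \<alpha> p" by blast
    have "ev1 h \<xi> (pCons c p) = fps_to_fls (fps_const (to_ac c) + (fps_const \<alpha> + fps_X) * g)"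
      unfolding ev1_pCons[OF h] g(1)
      by (simp only: fps_to_fls_plus fls_times_fps_to_fls fps_const_to_fls fps_X_to_fls \<xi>_def h_def)
    thus ?case using g(2)
      by (intro exI[of _ "fps_const (to_ac c) + (fps_const \<alpha> + fps_X) * g"]) (simp add: u)
  qed
  define D where "D = ev1 h \<xi> d"
  have D0: "D \<noteq> 0" using pt f(3) by (simp add: D_def herm_point_def)
  have Dpos: "fls_subdegree D > 0"
  proof -
    obtain g where "D = fps_to_fls g" "fps_nth g 0 = 0" using ev[of d] root by (auto simp: D_def)
    thus ?thesis using D0 by (intro fls_subdegree_greaterI) auto
  qed
  \<comment> \<open>The coefficients of \<open>p\<close> are those of \<open>f\<close> with respect
    to powers of y. Its value at \<open>\<eta> + h c\<close> is the image of \<open>f\<close> at the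
    translated point.\<close>
  define p where "p = smult (inverse D) (map_poly (ev1 h \<xi>) A)"
  have coeff_p: "coeff p j = ev1 h \<xi> (coeff A j) / D" for j
    by (simp add: p_def coeff_map_poly field_simps)
  have poly_p: "fls_subdegree (poly p (\<eta> + h c)) \<ge> 0" if c: "c \<in> trace_kernel" for c
  proof -
    note pc = herm_point_translate[OF pt c]
    define E where "E = ff_embed h \<xi> (\<eta> + h c) y"
    have "to_ac (to_fract d) = amb y [:d:]" by (simp add: amb_eq_poly_in_x)
    hence Ed: "E (to_ac (to_fract d)) = D"
      by (simp add: E_def D_def ff_embed_amb[OF pc] h)
    have K: "to_ac (to_fract d) \<in> function_field y" "f \<in> function_field y"
      unfolding f(1) by (simp_all flip: amb_eq_poly_in_x[of y])
    have Ef: "E f = poly p (\<eta> + h c)"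
    proof -
      have "E f = ev2 h \<xi> (\<eta> + h c) A / D"
        unfolding f(1) E_def
        by (subst ff_embed_divide[OF pc amb_in_function_field K(1)])
           (simp only: ff_embed_amb[OF pc] Ed[unfolded E_def])
      thus ?thesis by (simp add: p_def ev2_def ev1_def[of "ev1 h \<xi>"] field_simps)
    qed
    \<comment> \<open>The denominator has positive order, so the group of orders is not
      trivial.\<close>
    obtain e t where et: "e > 0" "t \<in> function_field y" "fls_subdegree (E t) = e"
      "\<And>f. f \<in> function_field y \<Longrightarrow> e dvd fls_subdegree (E f)"
      using series_value_group[OF pc[unfolded h_def] K(1)] Ed Dpos unfolding E_def h_def
      by (metis less_irrefl)
    have P: "is_place y (series_place e h \<xi> (\<eta> + h c) y)"
      unfolding h_def
      by (rule is_place_series_place[OF pc[unfolded h_def] et(1) _ et(2)])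
         (use et(3,4) in \<open>auto simp: E_def h_def\<close>)
    have "fls_subdegree \<xi> \<ge> 0"
      unfolding \<xi>_def by (intro fls_regular_add) auto
    hence "series_place e h \<xi> (\<eta> + h c) y ff_x \<ge> 0"
      using et(1) by (simp add: series_place_def ff_embed_x[OF pc] pos_imp_zdiv_nonneg_iff)
    from reg[OF P this] have "fls_subdegree (E f) div e \<ge> 0"
      using K(2) by (simp add: series_place_def E_def)
    thus ?thesis using et(1) by (simp add: Ef pos_imp_zdiv_nonneg_iff)
  qed
  define S where "S = (\<lambda>c. \<eta> + h c) ` trace_kernel"
  have "card S = q"
    unfolding S_def using card_trace_kernel
    by (subst card_image) (auto simp: inj_on_def uhom_eq_iff[OF h])
  moreover have "degree p < q"
    using f(2) degree_smult_le[of "inverse D" "map_poly (ev1 h \<xi>) A"] map_poly_degree_leq[of "ev1 h \<xi>" A]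
    unfolding p_def by simp
  moreover have "fls_subdegree \<eta> \<ge> 0" unfolding \<eta>_def by (rule fls_subdegree_fls_to_fps_gt0)
  ultimately have "fls_subdegree (coeff p j) \<ge> 0"
    using poly_p
  proof (intro fls_interpolation_regular[of S])
    fix s t assume "s \<in> S" "t \<in> S" "s \<noteq> t"
    then obtain c c' where "s - t = fls_const (to_ac c - to_ac c')"
      by (auto simp: S_def h_def fls_minus_const)
    thus "fls_subdegree (s - t) = 0" by simp
  qed (auto simp: S_def h_def intro: fls_regular_add)
  moreover obtain g where g: "ev1 h \<xi> (coeff A j) = fps_to_fls g" "fps_nth g 0 = ev1 to_ac \<alpha> (coeff A j)"
    using ev by blast
  \<comment> \<open>The quotient by \<open>D\<close> is regular and \<open>D\<close> has positive
    order, so the numerator has positive order and its constant term, the value at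
    \<open>\<alpha>\<close>, is 0.\<close>
  ultimately have "g = 0 \<or> fls_subdegree (fps_to_fls g) > 0"
    using D0 Dpos unfolding coeff_p by (cases "g = 0") (auto simp: fls_divide_subdegree)
  hence "fls_nth (fps_to_fls g) 0 = 0" using fls_eq0_below_subdegree[of 0 "fps_to_fls g"] by auto
  thus ?thesis using g(2) by simp
qed

text \<open>Induction on the degree of the denominator: at a root of \<open>d\<close> all
  coefficients of \<open>A\<close> vanish as well, so the minimal polynomial of the root
  cancels.\<close>

lemma integral_closure:
  assumes "f \<in> function_field y" "\<And>P. is_place y P \<Longrightarrow> P ff_x \<ge> 0 \<Longrightarrow> P f \<ge> 0"
  obtains A where "degree A < q" "f = amb y A"
proof -
  obtain A d where Ad: "d \<noteq> 0" "degree A < q" "f = amb y A / to_ac (to_fract d)"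
    using function_field_normal_form[OF assms(1)] .
  hence "\<exists>A. degree A < q \<and> f = amb y A"
  proof (induction "degree d" arbitrary: d A rule: less_induct)
    case (less d)
    have u: "uhom (to_ac :: 'a \<Rightarrow> _)" by (simp add: uhom_def)
    show ?case
    proof (cases "degree d = 0")
      case True
      then obtain c where c: "d = [:c:]" by (metis degree_eq_zeroE)
      have "[:inverse c:] * d = 1" using less.prems(1) by (simp add: c one_pCons)
      hence "to_ac (to_fract [:inverse c:]) * to_ac (to_fract d) = 1"
        by (metis to_ac_mult to_fract_mult to_ac_1 to_fract_1)
      hence "f = amb y (smult [:inverse c:] A)"
        using less.prems(1) unfolding less.prems(3) amb_smult
        by (simp add: divide_eq_eq mult.assoc mult.left_commute)
      moreover have "degree (smult [:inverse c:] A) < q"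
        using degree_smult_le[of "[:inverse c:]" A] less.prems(2) by linarith
      ultimately show ?thesis by blast
    next
      case False
      have "degree (map_poly (to_ac :: 'a \<Rightarrow> _) d) = degree d"
        by (rule degree_map_poly) simp
      then obtain \<alpha> where \<alpha>: "ev1 (to_ac :: 'a \<Rightarrow> _) \<alpha> d = 0"
        using alg_closed_imp_poly_has_root[of "map_poly to_ac d"] False by (auto simp: ev1_def)
      obtain m :: "'a poly" where m: "m \<noteq> 0" "degree m > 0" "\<And>p. ev1 to_ac \<alpha> p = 0 \<Longrightarrow> m dvd p"
        using min_poly_alg_closure[of \<alpha>] by blast
      obtain d' where d': "d = m * d'" using m(3)[OF \<alpha>] by (elim dvdE)
      have "m dvd coeff A j" for j
        by (rule m(3), rule coeff_vanish_at_pole[OF _ less.prems(3,2,1) \<alpha>]) (rule assms(2))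
      then obtain A' where A': "A = [:m:] * A'"
        using const_poly_dvd_iff[of m A] by (auto elim: dvdE)
      have d'0: "d' \<noteq> 0" using d' less.prems(1) by auto
      have "degree d' < degree d" unfolding d' using m d'0 by (simp add: degree_mult_eq)
      moreover have "degree A' < q" using less.prems(2) A' m(1) by simp
      moreover have "f = amb y A' / to_ac (to_fract d')"
        using m(1) d'0 less.prems(3) A' by (simp add: d' amb_smult)
      ultimately show ?thesis using less.hyps d'0 by blast
    qed
  qed
  thus ?thesis using that by blast
qed

end

text \<open>The pair \<open>(j, s)\<close> stands for the function \<open>y\<^sup>j / x\<^sup>s\<close>.\<close>

definition rr_index :: "nat \<Rightarrow> (nat \<times> nat) set" where
  "rr_index m = insert (0, 0) {(j, s). 1 \<le> j \<and> j < s \<and> s \<le> m}"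

lemma finite_rr_index: "finite (rr_index m)"
proof -
  have "rr_index m \<subseteq> {..m} \<times> {..m}" by (auto simp: rr_index_def)
  thus ?thesis by (rule finite_subset) auto
qed

section \<open>The Riemann-Roch space\<close>

lemma riemann_roch_space_add:
  assumes "f \<in> riemann_roch_space y G" "g \<in> riemann_roch_space y G"
  shows "f + g \<in> riemann_roch_space y G"
proof (cases "f = 0 \<or> g = 0 \<or> f + g = 0")
  case True
  thus ?thesis using assms by (auto simp: riemann_roch_space_def)
next
  case False
  have K: "f \<in> function_field y" "g \<in> function_field y"
    using assms by (auto simp: riemann_roch_space_def)
  have "P (f + g) + Poly_Mapping.lookup G P \<ge> 0" if P: "is_place y P" for P
  proof -
    have "P f + Poly_Mapping.lookup G P \<ge> 0" "P g + Poly_Mapping.lookup G P \<ge> 0"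
      using assms False P by (auto simp: riemann_roch_space_def)
    thus ?thesis using place_add[OF P K] False by (auto simp: min_def split: if_splits)
  qed
  thus ?thesis using K by (simp add: riemann_roch_space_def)
qed

lemma riemann_roch_space_scale:
  assumes "f \<in> riemann_roch_space y G"
  shows "ff_const c * f \<in> riemann_roch_space y G"
proof (cases "ff_const c * f = 0")
  case False
  hence nz: "ff_const c \<noteq> (0 :: 'a ambient)" "f \<noteq> 0" by auto
  have K: "f \<in> function_field y" using assms by (auto simp: riemann_roch_space_def)
  have "P (ff_const c * f) + Poly_Mapping.lookup G P \<ge> 0" if P: "is_place y P" for P
  proof -
    have "P (ff_const c * f) = P f"
      using place_mult[OF P _ K nz] place_const[OF P, of c] by simp
    thus ?thesis using assms nz P by (simp add: riemann_roch_space_def)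
  qed
  thus ?thesis using K by (simp add: riemann_roch_space_def)
qed (auto simp: riemann_roch_space_def)

lemma riemann_roch_space_sum:
  assumes "\<And>i. i \<in> I \<Longrightarrow> f i \<in> riemann_roch_space y G"
  shows "sum f I \<in> riemann_roch_space y G"
proof -
  have "0 \<in> riemann_roch_space y G" by (simp add: riemann_roch_space_def)
  thus ?thesis using assms
    by (induction I rule: infinite_finite_induct) (auto intro: riemann_roch_space_add)
qed

context hermitian
begin

lemma x_nonzero: "ff_x \<noteq> (0 :: 'a ambient)"
  using x_minus_nonzero[of 0] by (simp add: uhom_0[OF uhom_ff_const])

lemma y_nonzero: "y \<noteq> 0"
proof
  assume "y = 0"
  hence "(ff_x :: 'a ambient) ^ (q + 1) = 0" using hermitian_eq q_ge by (simp add: zero_power)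
  thus False using x_nonzero by simp
qed

lemma centred_on_axis:
  assumes "b \<in> trace_kernel"
  shows "centred 0 b (place_at y 0 b)" "place_at y 0 b ff_x = 1" "centred 0 b P \<Longrightarrow> P = place_at y 0 b"
proof -
  have curve: "b ^ q + b = 0 ^ (q + 1)" using assms by (simp add: trace_kernel_def)
  show "centred 0 b (place_at y 0 b)" "place_at y 0 b ff_x = 1" "centred 0 b P \<Longrightarrow> P = place_at y 0 b"
    by (fact centred_place_at[OF curve],
        use place_at_x_minus[OF curve] in \<open>simp add: uhom_0[OF uhom_ff_const]\<close>,
        rule place_at_unique[OF curve])
qed

lemma inj_on_place_at_axis: "inj_on (place_at y 0) trace_kernel"
proof (rule inj_onI)
  fix b c assume *: "b \<in> trace_kernel" "c \<in> trace_kernel" "place_at y 0 b = place_at y 0 c"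
  have "centred 0 b (place_at y 0 b)" "centred 0 c (place_at y 0 b)"
    using centred_on_axis(1)[OF *(1)] centred_on_axis(1)[OF *(2)] *(3) by simp_all
  thus "b = c" using has_value_unique[of y "place_at y 0 b" y b c] by (simp add: centred_def)
qed

lemma hermitian_G_altdef:
  "hermitian_G q y m = frag_cmul (int m) (\<Sum>b\<in>trace_kernel - {0}. frag_of (place_at y 0 b))"
proof -
  have "{b. b \<noteq> 0 \<and> b ^ q + b = 0} = trace_kernel - {0}" by (auto simp: trace_kernel_def)
  thus ?thesis by (simp add: hermitian_G_def)
qed

lemma lookup_hermitian_G:
  "Poly_Mapping.lookup (hermitian_G q y m) P = (if P \<in> place_at y 0 ` (trace_kernel - {0}) then int m else 0)"
proof -
  have "(\<Sum>b\<in>trace_kernel - {0}. Poly_Mapping.lookup (frag_of (place_at y 0 b)) P) =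
        (\<Sum>R\<in>place_at y 0 ` (trace_kernel - {0}). if R = P then 1 else 0)"
    by (subst sum.reindex[OF inj_on_subset[OF inj_on_place_at_axis]])
       (auto intro: sum.cong simp: eq_commute[of P])
  also have "\<dots> = (if P \<in> place_at y 0 ` (trace_kernel - {0}) then 1 else 0)"
    by (subst sum.delta) auto
  finally show ?thesis by (simp add: hermitian_G_altdef lookup_sum)
qed

lemma divisor_degree_hermitian_G:
  assumes "m > 0"
  shows "divisor_degree y (hermitian_G q y m) = int m * (int q - 1)"
proof -
  have keys: "Poly_Mapping.keys (hermitian_G q y m) = place_at y 0 ` (trace_kernel - {0})"
    using assms by (auto simp: in_keys_iff lookup_hermitian_G split: if_splits)
  have "0 \<in> trace_kernel" using q_ge by (simp add: trace_kernel_def)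
  have "divisor_degree y (hermitian_G q y m) = (\<Sum>P\<in>place_at y 0 ` (trace_kernel - {0}). int m)"
    unfolding divisor_degree_def keys
  proof (rule sum.cong)
    fix P assume P: "P \<in> place_at y 0 ` (trace_kernel - {0})"
    then obtain b where b: "P = place_at y 0 b" "b \<in> trace_kernel" by auto
    have "place_degree y P = 1"
      unfolding b(1) by (rule place_degree_place_at) (use b(2) in \<open>simp add: trace_kernel_def\<close>)
    thus "Poly_Mapping.lookup (hermitian_G q y m) P * int (place_degree y P) = int m"
      using P by (simp add: lookup_hermitian_G)
  qed simp
  also have "\<dots> = int (card (trace_kernel - {0})) * int m"
    by (simp add: card_image inj_on_subset[OF inj_on_place_at_axis])
  also have "card (trace_kernel - {0}) = q - 1"
    using \<open>0 \<in> trace_kernel\<close> card_trace_kernel by simp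
  finally show ?thesis using q_ge by (simp add: of_nat_diff)
qed

text \<open>At the places of the divisor y has a nonzero value, hence order 0. This separates them
  from the places at infinity and at the origin.\<close>

lemma lookup_hermitian_G_off_axis:
  assumes "P y \<noteq> 0"
  shows "Poly_Mapping.lookup (hermitian_G q y m) P = 0"
proof -
  have "P \<notin> place_at y 0 ` (trace_kernel - {0})"
  proof
    assume "P \<in> place_at y 0 ` (trace_kernel - {0})"
    then obtain b where "P = place_at y 0 b" "b \<in> trace_kernel" "b \<noteq> 0" by auto
    hence "centred 0 b P" "b \<noteq> 0" using centred_on_axis by auto
    thus False using has_value_unit[of y P y b] assms by (auto simp: centred_def)
  qed
  thus ?thesis by (simp add: lookup_hermitian_G)
qed

section \<open>Order conditions at an arbitrary place\<close>

text \<open>Compare orders in \<open>y^q + y = x^(q+1)\<close>: whichever of \<open>y^q\<close> and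
  \<open>y\<close> has smaller order determines the left side. If y has order 0, factor the left
  side over the trace kernel; either x is a unit, or some \<open>y - b\<close> has positive order
  and uniqueness identifies the place.\<close>

lemma place_hermitian_cases:
  assumes P: "is_place y P"
  obtains "P y < 0" "int (q + 1) * P ff_x = int q * P y"
  | "P y > 0" "int (q + 1) * P ff_x = P y"
  | "P y = 0" "P ff_x = 0"
  | b where "b \<in> trace_kernel" "b \<noteq> 0" "P = place_at y 0 b"
proof -
  have k: "P (y ^ q + y) = int (q + 1) * P ff_x"
    unfolding hermitian_eq by (rule place_power[OF P _ x_nonzero]) simp
  have yq: "P (y ^ q) = int q * P y" by (rule place_power[OF P _ y_nonzero]) simp
  consider "P y < 0" | "P y > 0" | "P y = 0" by linarith
  thus ?thesis
  proof cases
    case 1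
    have "P (y ^ q) < P y" using 1 q_ge unfolding yq by (simp add: mult_less_cancel_right1)
    hence "P (y ^ q + y) = P (y ^ q)"
      using place_add_less(2)[OF P, of "y ^ q" y] y_nonzero by simp
    thus ?thesis using 1 that(1) k yq by simp
  next
    case 2
    have "P y < P (y ^ q)" using 2 q_ge unfolding yq by (simp add: mult_less_cancel_right2)
    hence "P (y + y ^ q) = P y"
      using place_add_less(2)[OF P, of y "y ^ q"] y_nonzero by simp
    thus ?thesis using 2 that(2) k by (simp add: add.commute)
  next
    case 3
    have nz: "y ^ q + y \<noteq> 0" unfolding hermitian_eq using x_nonzero by simp
    have prod: "y ^ q + y = (\<Prod>b\<in>trace_kernel. y - ff_const b)"
      by (rule trace_factorization[OF uhom_ff_const])
    have nzb: "y - ff_const b \<noteq> 0" if "b \<in> trace_kernel" for b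
      using nz that unfolding prod by (auto simp: prod_zero_iff)
    have ge: "P (y - ff_const b) \<ge> 0" if "b \<in> trace_kernel" for b
    proof -
      have "y - ff_const b \<in> place_ring y P"
        using place_ring_add[OF P, of y "ff_const (- b)"] place_ring_const[OF P, of "- b"] 3
        by (simp add: place_ring_def uhom_uminus[OF uhom_ff_const])
      thus ?thesis using nzb[OF that] by (simp add: place_ring_def)
    qed
    have sum: "int (q + 1) * P ff_x = (\<Sum>b\<in>trace_kernel. P (y - ff_const b))"
      unfolding k[symmetric] prod by (rule place_prod[OF P]) (use nzb in auto)
    show ?thesis
    proof (cases "\<exists>b\<in>trace_kernel. P (y - ff_const b) > 0")
      case True
      then obtain b where b: "b \<in> trace_kernel" "P (y - ff_const b) > 0" by blast
      have "(\<Sum>b\<in>trace_kernel. P (y - ff_const b)) > 0"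
        by (rule sum_pos2[of _ b]) (use b ge in auto)
      hence "P ff_x > 0" unfolding sum[symmetric] by (simp add: zero_less_mult_iff)
      hence "centred 0 b P"
        using P b by (simp add: centred_def has_value_def place_ideal_def uhom_0[OF uhom_ff_const])
      moreover have "b \<noteq> 0" using b(2) 3 by (auto simp: uhom_0[OF uhom_ff_const])
      ultimately show ?thesis using that(4) b(1) centred_on_axis(3) by blast
    next
      case False
      hence "(\<Sum>b\<in>trace_kernel. P (y - ff_const b)) = 0"
        using ge by (intro sum.neutral) (meson order.antisym not_less)
      thus ?thesis using that(3) 3 sum by simp
    qed
  qed
qed

text \<open>Infinity demands \<open>(q+1) j <= s q\<close>, which follows from \<open>j < s\<close>
  and \<open>j <= q\<close>; the origin demands \<open>s <= (q+1) j\<close>; the places of the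
  divisor demand \<open>s <= m\<close>.\<close>

lemma rr_basis_in_space:
  assumes m: "m \<le> q - 1" and "(j, s) \<in> rr_index m"
  shows "y ^ j / ff_x ^ s \<in> riemann_roch_space y (hermitian_G q y m)"
proof -
  have js: "j = 0 \<and> s = 0 \<or> 1 \<le> j \<and> j < s \<and> s \<le> m"
    using assms(2) by (auto simp: rr_index_def)
  have "P (y ^ j / ff_x ^ s) + Poly_Mapping.lookup (hermitian_G q y m) P \<ge> 0" if P: "is_place y P" for P
  proof -
    have v: "P (y ^ j / ff_x ^ s) = int j * P y - int s * P ff_x"
      using place_divide[OF P, of "y ^ j" "ff_x ^ s"] x_nonzero y_nonzero
      by (simp add: place_power[OF P])
    have lk: "Poly_Mapping.lookup (hermitian_G q y m) P \<ge> 0" by (simp add: lookup_hermitian_G)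
    have pos: "0 \<le> a" if "0 \<le> int (q + 1) * a" for a
      using that by (simp add: zero_le_mult_iff)
    from P show ?thesis
    proof (cases rule: place_hermitian_cases)
      case 1
      \<comment> \<open>The factor \<open>q + 1\<close> allows the order of x to be expressed by
        that of y without division.\<close>
      have "int (q + 1) * (int j * P y - int s * P ff_x) =
          int (q + 1) * int j * P y - int s * (int (q + 1) * P ff_x)" by (simp add: algebra_simps)
      also have "\<dots> = P y * (int (q + 1) * int j - int s * int q)"
        unfolding 1(2) by (simp add: algebra_simps)
      also have "\<dots> \<ge> 0"
      proof (rule mult_nonpos_nonpos)
        have "(q + 1) * j \<le> s * q"
        proof (cases "j = 0")
          case False
          with js have "j + 1 \<le> s" "j \<le> q" using m by auto
          hence "(j + 1) * q \<le> s * q" by (intro mult_le_mono1)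
          with \<open>j \<le> q\<close> show ?thesis by (simp add: algebra_simps)
        qed simp
        thus "int (q + 1) * int j - int s * int q \<le> 0"
          by (metis diff_le_0_iff_le of_nat_mult of_nat_mono)
      qed (use 1 in simp)
      finally have "int j * P y - int s * P ff_x \<ge> 0" by (rule pos)
      thus ?thesis using v lk by simp
    next
      case 2
      have "P ff_x \<ge> 0" by (rule pos) (use 2 in simp)
      have "int j * P y - int s * P ff_x = P ff_x * (int (q + 1) * int j - int s)"
        unfolding 2(2)[symmetric] by (simp add: algebra_simps)
      also have "\<dots> \<ge> 0"
      proof (rule mult_nonneg_nonneg[OF \<open>P ff_x \<ge> 0\<close>])
        have "s \<le> (q + 1) * j"
        proof (cases "j = 0")
          case False
          with js m have "s \<le> q" by linarith
          also have "q \<le> (q + 1) * j" using False by (cases j) auto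
          finally show ?thesis .
        qed (use js in simp)
        thus "int (q + 1) * int j - int s \<ge> 0"
          by (metis diff_ge_0_iff_ge of_nat_mult of_nat_mono)
      qed
      finally show ?thesis using v lk by simp
    next
      case 3
      thus ?thesis using v lk by simp
    next
      case (4 b)
      have "P ff_x = 1" using centred_on_axis(2)[OF 4(1)] 4(3) by simp
      moreover have "P y = 0"
        using centred_on_axis(1)[OF 4(1)] 4 has_value_unit(2)[of y P y b] by (auto simp: centred_def)
      moreover have "Poly_Mapping.lookup (hermitian_G q y m) P = int m"
        using 4 by (simp add: lookup_hermitian_G)
      ultimately show ?thesis using v js by auto
    qed
  qed
  thus ?thesis by (simp add: riemann_roch_space_def)
qed

text \<open>For \<open>f\<close> in the space, \<open>x\<^sup>m f\<close> is a polynomial in \<open>x\<close> and \<open>y\<close> of degree less than \<open>q\<close> in \<open>y\<close>.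
  Its monomials have distinct orders at infinity, which bounds the exponents of \<open>x\<close> by \<open>m < q\<close>;
  then they also have distinct orders at the origin. So each monomial satisfies the two
  order conditions separately.\<close>

lemma rr_supp:
  assumes m: "m \<le> q - 1" and f: "f \<in> riemann_roch_space y (hermitian_G q y m)"
  obtains A where "ff_x ^ m * f = amb y A"
    "\<And>j i. (j, i) \<in> supp2 A \<Longrightarrow> i \<le> m \<and> (j, m - i) \<in> rr_index m"
proof (cases "f = 0")
  case True
  thus ?thesis using that[of 0] by (simp add: supp2_def)
next
  case f0: False
  define h where "h = ff_x ^ m * f"
  have fK: "f \<in> function_field y" using f by (simp add: riemann_roch_space_def)
  have Pf: "P f + Poly_Mapping.lookup (hermitian_G q y m) P \<ge> 0" if "is_place y P" for P
    using f f0 that by (simp add: riemann_roch_space_def)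
  have hK: "h \<in> function_field y" using fK by (simp add: h_def)
  have h0: "h \<noteq> 0" using f0 x_nonzero by (simp add: h_def)
  have Ph: "P h = int m * P ff_x + P f" if P: "is_place y P" for P
    unfolding h_def using place_mult[OF P _ fK _ f0, of "ff_x ^ m"] x_nonzero
    by (simp add: place_power[OF P])
  \<comment> \<open>At the places of the divisor x has order 1, so \<open>x^m\<close> cancels poles
    of order up to \<open>m\<close>; at the others \<open>f\<close> is regular, and x is so by
    assumption.\<close>
  have "P h \<ge> 0" if P: "is_place y P" "P ff_x \<ge> 0" for P
  proof (cases "P \<in> place_at y 0 ` (trace_kernel - {0})")
    case True
    then obtain b where "b \<in> trace_kernel" "P = place_at y 0 b" by auto
    hence "P ff_x = 1" using centred_on_axis(2) by auto
    thus ?thesis using Ph[OF P(1)] Pf[OF P(1)] True by (simp add: lookup_hermitian_G)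
  next
    case False
    thus ?thesis using Ph[OF P(1)] Pf[OF P(1)] P(2) by (simp add: lookup_hermitian_G)
  qed
  then obtain A where A: "degree A < q" "h = amb y A"
    using integral_closure[OF hK] by metis
  have A0: "A \<noteq> 0" using h0 A(2) by auto

  obtain \<xi> \<eta> :: "'a fls" where inf: "\<eta> ^ q + \<eta> = \<xi> ^ (q + 1)" "\<xi> \<noteq> 0" "\<eta> \<noteq> 0"
    "fls_subdegree \<xi> = - int q" "fls_subdegree \<eta> = - int (q + 1)"
    by (rule hermitian_infinity[OF q_ge])
  have pt: "herm_point q (\<lambda>c. fls_const c) \<xi> \<eta>" by (rule herm_point_infinity[OF q_ge inf])
  define P where "P = series_place 1 (\<lambda>c. fls_const c) \<xi> \<eta> y"
  have P: "is_place y P"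
    unfolding P_def
    \<comment> \<open>\<open>x / y\<close> has order \<open>(q + 1) - q = 1\<close> at
      infinity.\<close>
    by (rule is_place_series_place[OF pt, of _ "ff_x / y"])
       (simp_all add: ff_embed_divide[OF pt] ff_embed_x[OF pt] ff_embed_y[OF pt] inf fls_divide_subdegree)
  have Px: "P ff_x = - int q" and Py: "P y = - int (q + 1)" and PA: "P h = fls_subdegree (ev2 fls_const \<xi> \<eta> A)"
    by (simp_all add: P_def series_place_def ff_embed_x[OF pt] ff_embed_y[OF pt] inf A(2) ff_embed_amb[OF pt])
  have "P f \<ge> 0" using Pf[OF P] lookup_hermitian_G_off_axis[of P m] Py by simp
  hence ge: "fls_subdegree (ev2 fls_const \<xi> \<eta> A) \<ge> - int (m * q)"
    using Ph[OF P] Px PA by simp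
  have le: "i * q + j * (q + 1) \<le> m * q" if "(j, i) \<in> supp2 A" for j i
  proof -
    have "fls_subdegree (ev2 fls_const \<xi> \<eta> A) \<le> int i * - int q + int j * - int (q + 1)"
      using ev2_infinity[OF inf(2-5) A0 A(1)] that by blast
    hence "int (i * q + j * (q + 1)) \<le> int (m * q)" using ge by (simp add: algebra_simps)
    thus ?thesis by (simp only: of_nat_le_iff)
  qed
  have im: "i \<le> m" if "(j, i) \<in> supp2 A" for j i
  proof -
    have "i * q \<le> m * q" using le[OF that] by linarith
    thus ?thesis using q_ge by simp
  qed

  obtain w where pt0: "herm_point q (\<lambda>c. fls_const c) (fls_const 0 + fls_X) (fps_to_fls w)" and w: "fps_nth w 0 = (0 :: 'a)"
    using affine_series_point[OF uhom_id, of 0 0] q_ge by auto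
  define \<zeta> where "\<zeta> = fps_to_fls w"
  have pt0: "herm_point q (\<lambda>c. fls_const c) fls_X \<zeta>" using pt0 by (simp add: \<zeta>_def)
  hence "\<zeta> ^ q + \<zeta> = fls_X ^ (q + 1)" unfolding herm_point_def by blast
  from series_root_order[OF q_ge this[unfolded \<zeta>_def] w]
  have \<zeta>: "\<zeta> \<noteq> 0" "fls_subdegree \<zeta> = int (q + 1)" by (auto simp: \<zeta>_def)
  define R where "R = series_place 1 (\<lambda>c. fls_const c) fls_X \<zeta> y"
  have R: "is_place y R"
    unfolding R_def
    by (rule is_place_series_place[OF pt0, of _ "ff_x"]) (simp_all add: ff_embed_x[OF pt0])
  have Rx: "R ff_x = 1" and Ry: "R y = int (q + 1)" and RA: "R h = fls_subdegree (ev2 fls_const fls_X \<zeta> A)"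
    by (simp_all add: R_def series_place_def ff_embed_x[OF pt0] ff_embed_y[OF pt0] \<zeta> A(2) ff_embed_amb[OF pt0])
  have "R f \<ge> 0" using Pf[OF R] lookup_hermitian_G_off_axis[of R m] Ry by simp
  hence ge0: "fls_subdegree (ev2 fls_const fls_X \<zeta> A) \<ge> int m"
    using Ph[OF R] Rx RA by simp
  have inj: "inj_on (\<lambda>(j, i). int i * fls_subdegree (fls_X :: 'a fls) + int j * fls_subdegree \<zeta>) (supp2 A)"
  proof (rule inj_onI, clarify)
    fix j i j' i' assume *: "(j, i) \<in> supp2 A" "(j', i') \<in> supp2 A"
      and "int i * fls_subdegree (fls_X :: 'a fls) + int j * fls_subdegree \<zeta> =
           int i' * fls_subdegree (fls_X :: 'a fls) + int j' * fls_subdegree \<zeta>"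
    hence "int (i + j * (q + 1)) = int (i' + j' * (q + 1))" by (simp add: \<zeta> algebra_simps)
    hence eq: "i + j * (q + 1) = i' + j' * (q + 1)" by (simp only: of_nat_eq_iff)
    have "i < q + 1" "i' < q + 1" using im[OF *(1)] im[OF *(2)] m by auto
    hence "i = i'" using arg_cong[OF eq, of "\<lambda>n. n mod (q + 1)"]
      by (simp only: mod_mult_self1 mod_less)
    moreover from this have "j * (q + 1) = j' * (q + 1)" using eq by linarith
    hence "j = j'" using mult_cancel2[of j "q + 1" j'] by linarith
    ultimately show "j = j' \<and> i = i'" by blast
  qed
  have lower: "m \<le> i + j * (q + 1)" if "(j, i) \<in> supp2 A" for j i
  proof -
    have "fls_subdegree (ev2 fls_const fls_X \<zeta> A) \<le> int i * fls_subdegree (fls_X :: 'a fls) + int j * fls_subdegree \<zeta>"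
      using ev2_fls_distinct[OF uhom_id A0 _ \<zeta>(1) inj] that by auto
    hence "int m \<le> int (i + j * (q + 1))" using ge0 by (simp add: \<zeta> algebra_simps)
    thus ?thesis by (simp only: of_nat_le_iff)
  qed
  show ?thesis
  proof (rule that[of A])
    show "ff_x ^ m * f = amb y A" using A(2) by (simp add: h_def)
    fix j i assume ji: "(j, i) \<in> supp2 A"
    show "i \<le> m \<and> (j, m - i) \<in> rr_index m"
    proof (cases "j = 0")
      case True
      \<comment> \<open>The two bounds force \<open>i = m\<close>: only the monomial
        \<open>x^m\<close> remains, which stands for the function 1.\<close>
      thus ?thesis using lower[OF ji] im[OF ji] by (simp add: rr_index_def)
    next
      case False
      \<comment> \<open>The extra summand \<open>j > 0\<close> makes the bound strict, so
        \<open>i + j < m\<close>, which is \<open>j < s\<close> for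
        \<open>s = m - i\<close>.\<close>
      have "(i + j) * q + j \<le> m * q" using le[OF ji] by (simp add: algebra_simps)
      hence "(i + j) * q < m * q" using False by linarith
      hence "i + j < m" by simp
      thus ?thesis using False by (auto simp: rr_index_def)
    qed
  qed
qed

lemma riemann_roch_space_eq:
  assumes m: "m \<le> q - 1"
  shows "riemann_roch_space y (hermitian_G q y m) =
    {(\<Sum>(j, s)\<in>rr_index m. ff_const (c (j, s)) * (y ^ j / ff_x ^ s)) | c. True}"
proof (intro equalityI subsetI)
  fix f assume "f \<in> riemann_roch_space y (hermitian_G q y m)"
  then obtain A where A: "ff_x ^ m * f = amb y A"
    "\<And>j i. (j, i) \<in> supp2 A \<Longrightarrow> i \<le> m \<and> (j, m - i) \<in> rr_index m"
    using rr_supp[OF m] by metis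
  define c where "c = (\<lambda>(j, s). coeff (coeff A j) (m - s))"
  \<comment> \<open>Translates the pole order \<open>s\<close> of \<open>y^j / x^s\<close> into the
    exponent \<open>m - s\<close> of x after multiplication by \<open>x^m\<close>.\<close>
  define \<phi> where "\<phi> = (\<lambda>(j :: nat, s). (j, m - s))"
  have inj: "inj_on \<phi> (rr_index m)"
    by (auto simp: inj_on_def \<phi>_def rr_index_def)
  have "amb y A = (\<Sum>(j, i)\<in>supp2 A. ff_const (coeff (coeff A j) i) * ff_x ^ i * y ^ j)"
    by (rule ev2_supp2[OF uhom_ff_const])
  also have "\<dots> = (\<Sum>(j, i)\<in>\<phi> ` rr_index m. ff_const (coeff (coeff A j) i) * ff_x ^ i * y ^ j)"
  proof (rule sum.mono_neutral_left)
    show "supp2 A \<subseteq> \<phi> ` rr_index m"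
    proof clarify
      fix j i assume "(j, i) \<in> supp2 A"
      from A(2)[OF this] show "(j, i) \<in> \<phi> ` rr_index m"
        by (intro image_eqI[of _ _ "(j, m - i)"]) (auto simp: \<phi>_def)
    qed
  qed (auto simp: finite_rr_index supp2_def uhom_0[OF uhom_ff_const])
  also have "\<dots> = (\<Sum>(j, s)\<in>rr_index m. ff_const (c (j, s)) * ff_x ^ (m - s) * y ^ j)"
    by (subst sum.reindex[OF inj]) (auto simp: \<phi>_def c_def intro!: sum.cong)
  also have "\<dots> = (\<Sum>(j, s)\<in>rr_index m. ff_x ^ m * (ff_const (c (j, s)) * (y ^ j / ff_x ^ s)))"
  proof (rule sum.cong, simp, clarify)
    fix j s assume "(j, s) \<in> rr_index m"
    hence "s \<le> m" by (auto simp: rr_index_def)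
    hence "(ff_x :: 'a ambient) ^ m = ff_x ^ (m - s) * ff_x ^ s" by (simp flip: power_add)
    thus "ff_const (c (j, s)) * ff_x ^ (m - s) * y ^ j = ff_x ^ m * (ff_const (c (j, s)) * (y ^ j / ff_x ^ s))"
      using x_nonzero by simp
  qed
  also have "\<dots> = ff_x ^ m * (\<Sum>(j, s)\<in>rr_index m. ff_const (c (j, s)) * (y ^ j / ff_x ^ s))"
    by (simp add: sum_distrib_left case_prod_unfold)
  finally have "f = (\<Sum>(j, s)\<in>rr_index m. ff_const (c (j, s)) * (y ^ j / ff_x ^ s))"
    using A(1) x_nonzero by simp
  thus "f \<in> {(\<Sum>(j, s)\<in>rr_index m. ff_const (c (j, s)) * (y ^ j / ff_x ^ s)) | c. True}" by blast
next
  fix f assume "f \<in> {(\<Sum>(j, s)\<in>rr_index m. ff_const (c (j, s)) * (y ^ j / ff_x ^ s)) | c. True}"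
  then obtain c where f: "f = (\<Sum>(j, s)\<in>rr_index m. ff_const (c (j, s)) * (y ^ j / ff_x ^ s))" by blast
  show "f \<in> riemann_roch_space y (hermitian_G q y m)"
    unfolding f
    by (intro riemann_roch_space_sum, clarify)
       (intro riemann_roch_space_scale rr_basis_in_space[OF m])
qed

end

section \<open>The code\<close>

lemma card_rr_index: "card (rr_index m) = m * (m - 1) div 2 + 1"
proof -
  \<comment> \<open>Pairs are swapped so that each \<open>s\<close> contributes its
    \<open>s - 1\<close> values of \<open>j\<close>.\<close>
  define T where "T = (SIGMA s:{..m}. {1..<s})"
  have "rr_index m = insert (0, 0) (prod.swap ` T)"
    unfolding rr_index_def T_def by (auto simp: image_iff)
  moreover have "finite T" "(0, 0) \<notin> prod.swap ` T" by (auto simp: T_def)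
  ultimately have "card (rr_index m) = card T + 1"
    by (simp add: card_image)
  also have "card T = (\<Sum>s\<le>m. s - 1)" by (simp add: T_def)
  also have "\<dots> = m * (m - 1) div 2"
  proof (induction m)
    case (Suc m)
    have "Suc m * m = m * (m - 1) + 2 * m" by (cases m) auto
    hence "Suc m * m div 2 = m * (m - 1) div 2 + m" by simp
    thus ?case using Suc by simp
  qed simp
  finally show ?thesis .
qed

section \<open>Codes spanned by evaluations of monomials\<close>

definition monomial_code :: "('n::finite \<Rightarrow> 'a::field) \<Rightarrow> nat set \<Rightarrow> ('a ^ 'n) set" where
  "monomial_code pts E = {(\<chi> k. \<Sum>n\<in>E. g n * pts k ^ n) | g. True}"

text \<open>A nonzero polynomial of degree at most \<open>D\<close> has at most \<open>D\<close>
  zeros among the distinct points, as for Reed-Solomon codes.\<close>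

lemma monomial_code_weight:
  fixes pts :: "'n::finite \<Rightarrow> 'a::field"
  assumes "inj pts" "finite E" "E \<subseteq> {..D}" "n \<in> E" "g n \<noteq> 0"
  shows "CARD('n) - D \<le> card {k. (\<Sum>n\<in>E. g n * pts k ^ n) \<noteq> 0}"
proof -
  define p where "p = (\<Sum>n\<in>E. monom (g n) n)"
  have coeff: "coeff p j = (if j \<in> E then g j else 0)" for j
    using assms(2) by (simp add: p_def coeff_sum sum.delta)
  have p0: "p \<noteq> 0" using coeff[of n] assms(4,5) by auto
  have deg: "degree p \<le> D" using assms(3) by (intro degree_le) (auto simp: coeff)
  have poly: "poly p z = (\<Sum>n\<in>E. g n * z ^ n)" for z
    by (simp add: p_def poly_sum poly_monom)
  have "pts ` {k. poly p (pts k) = 0} \<subseteq> {z. poly p z = 0}" by auto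
  hence "card (pts ` {k. poly p (pts k) = 0}) \<le> card {z. poly p z = 0}"
    by (intro card_mono poly_roots_finite[OF p0])
  also have "\<dots> \<le> D" using card_poly_roots_bound[OF p0] deg by simp
  finally have zeros: "card {k. poly p (pts k) = 0} \<le> D"
    using assms(1) by (simp add: card_image inj_on_subset)
  have "{k. poly p (pts k) \<noteq> 0} = - {k. poly p (pts k) = 0}" by auto
  hence "card {k. poly p (pts k) \<noteq> 0} = CARD('n) - card {k. poly p (pts k) = 0}"
    by (simp add: card_Diff_subset Compl_eq_Diff_UNIV)
  thus ?thesis using zeros by (simp add: poly)
qed

lemma subspace_monomial_code: "vec.subspace (monomial_code pts E)"
proof (rule vec.subspaceI)
  show "0 \<in> monomial_code pts E"
    unfolding monomial_code_def by (rule CollectI, rule exI[of _ "\<lambda>_. 0"]) (simp add: vec_eq_iff)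
next
  fix c d assume "c \<in> monomial_code pts E" "d \<in> monomial_code pts E"
  then obtain g h where "c = (\<chi> k. \<Sum>n\<in>E. g n * pts k ^ n)" "d = (\<chi> k. \<Sum>n\<in>E. h n * pts k ^ n)"
    by (auto simp: monomial_code_def)
  hence "c + d = (\<chi> k. \<Sum>n\<in>E. (g n + h n) * pts k ^ n)"
    by (simp add: vec_eq_iff sum.distrib algebra_simps)
  thus "c + d \<in> monomial_code pts E" unfolding monomial_code_def
    by (intro CollectI exI[of _ "\<lambda>n. g n + h n"]) simp
next
  fix a c assume "c \<in> monomial_code pts E"
  then obtain g where "c = (\<chi> k. \<Sum>n\<in>E. g n * pts k ^ n)" by (auto simp: monomial_code_def)
  hence "a *s c = (\<chi> k. \<Sum>n\<in>E. (a * g n) * pts k ^ n)"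
    by (simp add: vec_eq_iff sum_distrib_left mult.assoc)
  thus "a *s c \<in> monomial_code pts E" unfolding monomial_code_def
    by (intro CollectI exI[of _ "\<lambda>n. a * g n"]) simp
qed

text \<open>With \<open>D\<close> below the length, a nonzero coefficient forces a nonzero entry, so
  the monomial vectors are independent.\<close>

lemma dim_monomial_code:
  fixes pts :: "'n::finite \<Rightarrow> 'a::field"
  assumes "inj pts" "finite E" "E \<subseteq> {..D}" "D < CARD('n)"
  shows "vec.dim (monomial_code pts E) = card E"
proof -
  define v where "v = (\<lambda>n. \<chi> k. pts k ^ n)"
  have comb: "(\<Sum>n\<in>E. g n *s v n) = (\<chi> k. \<Sum>n\<in>E. g n * pts k ^ n)" for g
    by (simp add: vec_eq_iff v_def)
  have zero: "g n = 0" if "(\<Sum>n\<in>E. g n *s v n) = 0" "n \<in> E" for g n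
  proof (rule ccontr)
    assume "g n \<noteq> 0"
    from monomial_code_weight[OF assms(1-3) that(2), of g, OF this] assms(4)
    have "card {k. (\<Sum>n\<in>E. g n * pts k ^ n) \<noteq> 0} \<noteq> 0" by linarith
    moreover have "(\<Sum>n\<in>E. g n * pts k ^ n) = 0" for k
      using that(1) unfolding comb by (simp add: vec_eq_iff)
    ultimately show False by simp
  qed
  have inj: "inj_on v E"
  proof (rule inj_onI, rule ccontr)
    fix n n' assume *: "n \<in> E" "n' \<in> E" "v n = v n'" "n \<noteq> n'"
    define g where "g = (\<lambda>j. if j = n then 1 else if j = n' then - 1 else (0 :: 'a))"
    have "(\<Sum>j\<in>E. g j *s v j) = (\<Sum>j\<in>{n, n'}. g j *s v j)"
      using * assms(2) by (intro sum.mono_neutral_right) (auto simp: g_def)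
    also have "\<dots> = 0" using * by (simp add: g_def vec_eq_iff)
    finally show False using zero[of g n] * by (simp add: g_def)
  qed
  have indep: "vec.independent (v ` E)"
  proof
    assume "vec.dependent (v ` E)"
    then obtain w x where w: "x \<in> v ` E" "w x \<noteq> 0" "(\<Sum>x\<in>v ` E. w x *s x) = 0"
      using vec.dependent_finite[of "v ` E"] assms(2) by auto
    have "(\<Sum>n\<in>E. w (v n) *s v n) = 0"
      using w(3) by (simp add: sum.reindex[OF inj])
    thus False using zero[of "\<lambda>n. w (v n)"] w(1,2) by auto
  qed
  have "vec.span (v ` E) = monomial_code pts E"
  proof (intro equalityI subsetI)
    fix c assume "c \<in> vec.span (v ` E)"
    then obtain w where "c = (\<Sum>x\<in>v ` E. w x *s x)"
      using vec.span_finite[of "v ` E"] assms(2) by auto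
    hence "c = (\<Sum>n\<in>E. w (v n) *s v n)" by (simp add: sum.reindex[OF inj])
    thus "c \<in> monomial_code pts E" unfolding comb monomial_code_def
      by (intro CollectI exI[of _ "\<lambda>n. w (v n)"]) simp
  next
    fix c assume "c \<in> monomial_code pts E"
    then obtain g where g: "c = (\<Sum>n\<in>E. g n *s v n)" unfolding comb monomial_code_def by blast
    show "c \<in> vec.span (v ` E)"
      unfolding g by (intro vec.span_sum vec.span_scale vec.span_base imageI)
  qed
  hence "vec.dim (monomial_code pts E) = vec.dim (v ` E)" by (metis vec.dim_span)
  also have "\<dots> = card (v ` E)" by (rule vec.dim_eq_card_independent[OF indep])
  also have "\<dots> = card E" by (rule card_image[OF inj])
  finally show ?thesis .
qed

lemma hamming_dist_altdef:
  fixes c c' :: "'a::field ^ 'n::finite"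
  shows "hamming_dist c c' = card {k. (c - c') $ k \<noteq> 0}"
  by (simp add: hamming_dist_def)

text \<open>By linearity distances are weights, and \<open>d\<close> is the least weight. The last
  conclusion lets a single codeword bound \<open>d\<close> from above.\<close>

lemma monomial_code_parameters:
  fixes pts :: "'n::finite \<Rightarrow> 'a::field"
  assumes "inj pts" "finite E" "E \<noteq> {}" "E \<subseteq> {..D}" "D < CARD('n)"
  obtains d where "is_linear_code (monomial_code pts E) CARD('n) (card E) d" "CARD('n) - D \<le> d"
    "\<And>c. c \<in> monomial_code pts E \<Longrightarrow> c \<noteq> 0 \<Longrightarrow> d \<le> card {k. c $ k \<noteq> 0}"
proof -
  let ?C = "monomial_code pts E"
  have diff: "c - c' \<in> ?C" if "c \<in> ?C" "c' \<in> ?C" for c c'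
    using subspace_monomial_code that by (rule vec.subspace_diff)
  have zero: "0 \<in> ?C" using subspace_monomial_code by (rule vec.subspace_0)
  define Q where "Q = (\<lambda>d. \<exists>c\<in>?C. c \<noteq> 0 \<and> card {k. c $ k \<noteq> 0} = d)"
  have weight: "CARD('n) - D \<le> card {k. c $ k \<noteq> 0}" if c: "c \<in> ?C" "c \<noteq> 0" for c
  proof -
    obtain g where g: "c = (\<chi> k. \<Sum>n\<in>E. g n * pts k ^ n)" using c(1) by (auto simp: monomial_code_def)
    have "\<exists>n\<in>E. g n \<noteq> 0"
    proof (rule ccontr)
      assume "\<not> ?thesis"
      hence "c = 0" unfolding g by (simp add: vec_eq_iff)
      thus False using c(2) by simp
    qed
    thus ?thesis using monomial_code_weight[OF assms(1,2,4)] by (auto simp: g)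
  qed
  obtain n where "n \<in> E" using assms(3) by blast
  \<comment> \<open>Any nonzero codeword would do; it makes the minimum range over a nonempty
    set.\<close>
  define c where "c = (\<chi> k. \<Sum>n\<in>E. 1 * pts k ^ n)"
  have "c \<in> ?C" unfolding monomial_code_def c_def
    by (rule CollectI, rule exI[of _ "\<lambda>_. 1"]) simp
  moreover have "c \<noteq> 0"
  proof
    assume "c = 0"
    hence "{k. (\<Sum>n\<in>E. 1 * pts k ^ n) \<noteq> 0} = {}" by (simp add: c_def vec_eq_iff)
    thus False
      using monomial_code_weight[OF assms(1,2,4) \<open>n \<in> E\<close>, of "\<lambda>_. 1"] assms(5) by simp
  qed
  ultimately have "\<exists>d. Q d" unfolding Q_def by blast
  define d where "d = (LEAST d. Q d)"
  have "Q d" unfolding d_def using \<open>\<exists>d. Q d\<close> by (rule LeastI_ex)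
  then obtain c0 where c0: "c0 \<in> ?C" "c0 \<noteq> 0" "card {k. c0 $ k \<noteq> 0} = d" by (auto simp: Q_def)
  have min: "d \<le> card {k. c $ k \<noteq> 0}" if "c \<in> ?C" "c \<noteq> 0" for c
    unfolding d_def by (rule Least_le) (use that in \<open>auto simp: Q_def\<close>)
  have "is_linear_code ?C CARD('n) (card E) d"
    unfolding is_linear_code_def
  proof (intro conjI ballI impI)
    show "\<exists>c\<in>?C. \<exists>c'\<in>?C. c \<noteq> c' \<and> hamming_dist c c' = d"
      using c0 zero by (intro bexI[of _ c0] bexI[of _ 0]) (auto simp: hamming_dist_altdef)
    fix c c' assume "c \<in> ?C" "c' \<in> ?C" "c \<noteq> c'"
    thus "d \<le> hamming_dist c c'"
      unfolding hamming_dist_altdef by (intro min diff) auto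
  qed (use subspace_monomial_code dim_monomial_code[OF assms(1,2,4,5)] in auto)
  thus ?thesis using that[of d] weight[OF c0(1,2)] c0(3) min by simp
qed

context hermitian
begin

text \<open>For \<open>m <= q - 1\<close> the subtraction does not truncate on
  \<open>rr_index m\<close>; see \<open>rr_index_bounds\<close>.\<close>

definition rr_exponent :: "nat \<times> nat \<Rightarrow> nat" where
  "rr_exponent = (\<lambda>(j, s). (q + 1) * j - s)"

lemma rr_index_bounds:
  assumes "m \<le> q - 1" "(j, s) \<in> rr_index m"
  shows "s < q" "s \<le> (q + 1) * j"
proof -
  have js: "j = 0 \<and> s = 0 \<or> 1 \<le> j \<and> j < s \<and> s \<le> m"
    using assms(2) by (auto simp: rr_index_def)
  show "s < q" using js assms(1) q_ge by linarith
  moreover have "q \<le> (q + 1) * j" if "j \<noteq> 0" using that by (cases j) auto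
  ultimately show "s \<le> (q + 1) * j" using js by (cases "j = 0") linarith+
qed

text \<open>Both values of \<open>s\<close> are below \<open>q + 1\<close>, so reduction modulo
  \<open>q + 1\<close> recovers \<open>s\<close>, and then \<open>j\<close>.\<close>

lemma inj_on_rr_exponent:
  assumes m: "m \<le> q - 1"
  shows "inj_on rr_exponent (rr_index m)"
proof (rule inj_onI, clarify)
  fix j s j' s' assume *: "(j, s) \<in> rr_index m" "(j', s') \<in> rr_index m" "rr_exponent (j, s) = rr_exponent (j', s')"
  note b = rr_index_bounds[OF m *(1)] rr_index_bounds[OF m *(2)]
  have eq: "s' + j * (q + 1) = s + j' * (q + 1)"
    using *(3) b by (simp add: rr_exponent_def mult.commute)
  have "s' < q + 1" "s < q + 1" using b by auto
  hence s: "s' = s" using arg_cong[OF eq, of "\<lambda>n. n mod (q + 1)"]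
    by (simp only: mod_mult_self1 mod_less)
  hence "j * (q + 1) = j' * (q + 1)" using eq by linarith
  hence "j = j'" using mult_cancel2[of j "q + 1" j'] by linarith
  thus "j = j' \<and> s = s'" using s by simp
qed

text \<open>The extreme case is \<open>y^(m-1) / x^m\<close>, with exponent
  \<open>(q+1)(m-1) - m = q(m-1) - 1\<close>.\<close>

lemma rr_exponent_le:
  assumes "2 \<le> m"
  shows "rr_exponent ` rr_index m \<subseteq> {..q * (m - 1) - 1}"
proof (rule image_subsetI)
  fix p assume "p \<in> rr_index m"
  moreover obtain j s where p: "p = (j, s)" by fastforce
  ultimately have js: "j = 0 \<and> s = 0 \<or> 1 \<le> j \<and> j < s \<and> s \<le> m" by (auto simp: rr_index_def)
  show "rr_exponent p \<in> {..q * (m - 1) - 1}"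
  proof (cases "j = 0")
    case False
    with js have *: "q * j \<le> q * (m - 1)" "j + 1 \<le> s" by auto
    have "(q + 1) * j = q * j + j" by simp
    hence "(q + 1) * j - s \<le> q * (m - 1) - 1" using * by linarith
    thus ?thesis by (simp add: rr_exponent_def p)
  qed (use js in \<open>simp add: rr_exponent_def p\<close>)
qed

lemma rr_code_altdef:
  fixes a b :: "'n::finite \<Rightarrow> 'a"
  assumes m: "m \<le> q - 1" and curve: "\<And>k. b k ^ q + b k = a k ^ (q + 1)" and a: "\<And>k. a k \<noteq> 0"
  shows "functional_ag_code y (\<lambda>k. place_at y (a k) (b k)) (hermitian_G q y m) =
    {(\<chi> k. \<Sum>(j, s)\<in>rr_index m. c (j, s) * (b k ^ j / a k ^ s)) | c. True}"
proof -
  have val: "value_at y (place_at y (a k) (b k)) (\<Sum>(j, s)\<in>rr_index m. ff_const (c (j, s)) * (y ^ j / ff_x ^ s)) =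
      (\<Sum>(j, s)\<in>rr_index m. c (j, s) * (b k ^ j / a k ^ s))" for c k
  proof -
    define P where "P = place_at y (a k) (b k)"
    have P: "is_place y P" "has_value y P ff_x (a k)" "has_value y P y (b k)"
      using centred_place_at[OF curve] by (auto simp: P_def centred_def)
    have "has_value y P (\<Sum>(j, s)\<in>rr_index m. ff_const (c (j, s)) * (y ^ j / ff_x ^ s))
        (\<Sum>(j, s)\<in>rr_index m. c (j, s) * (b k ^ j / a k ^ s))"
      unfolding case_prod_unfold using a[of k]
      by (intro has_value_sum has_value_mult has_value_const has_value_divide has_value_power P) simp
    thus ?thesis unfolding P_def[symmetric] by (rule value_at_eq[OF P(1)])
  qed
  show ?thesis
    unfolding functional_ag_code_def riemann_roch_space_eq[OF m]
  proof (intro equalityI subsetI)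
    fix w assume "w \<in> (\<lambda>f. \<chi> k. value_at y (place_at y (a k) (b k)) f) `
      {(\<Sum>(j, s)\<in>rr_index m. ff_const (c (j, s)) * (y ^ j / ff_x ^ s)) | c. True}"
    then obtain c where "w = (\<chi> k. value_at y (place_at y (a k) (b k))
      (\<Sum>(j, s)\<in>rr_index m. ff_const (c (j, s)) * (y ^ j / ff_x ^ s)))" by blast
    thus "w \<in> {(\<chi> k. \<Sum>(j, s)\<in>rr_index m. c (j, s) * (b k ^ j / a k ^ s)) | c. True}"
      unfolding val by blast
  next
    fix w assume "w \<in> {(\<chi> k. \<Sum>(j, s)\<in>rr_index m. c (j, s) * (b k ^ j / a k ^ s)) | c. True}"
    then obtain c where "w = (\<chi> k. \<Sum>(j, s)\<in>rr_index m. c (j, s) * (b k ^ j / a k ^ s))" by blast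
    hence "w = (\<chi> k. value_at y (place_at y (a k) (b k))
      (\<Sum>(j, s)\<in>rr_index m. ff_const (c (j, s)) * (y ^ j / ff_x ^ s)))" unfolding val .
    thus "w \<in> (\<lambda>f. \<chi> k. value_at y (place_at y (a k) (b k)) f) `
      {(\<Sum>(j, s)\<in>rr_index m. ff_const (c (j, s)) * (y ^ j / ff_x ^ s)) | c. True}" by blast
  qed
qed

text \<open>On the curve \<open>y = \<kappa> x\<^sup>q\<^sup>+\<^sup>1\<close>, which contains all evaluation points, \<open>y\<^sup>j / x\<^sup>s\<close> is the
  monomial \<open>x\<^bsup>(q+1)j-s\<^esup>\<close> up to a constant.\<close>

lemma rr_code_monomial:
  fixes a b :: "'n::finite \<Rightarrow> 'a"
  assumes m: "m \<le> q - 1" and b: "\<And>k. b k = \<kappa> * a k ^ (q + 1)" and \<kappa>: "\<kappa> \<noteq> 0" and a: "\<And>k. a k \<noteq> 0"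
  shows "{(\<chi> k. \<Sum>(j, s)\<in>rr_index m. c (j, s) * (b k ^ j / a k ^ s)) | c. True} =
    monomial_code a (rr_exponent ` rr_index m)"
proof -
  note inj = inj_on_rr_exponent[OF m]
  have mono: "b k ^ j / a k ^ s = \<kappa> ^ j * a k ^ rr_exponent (j, s)" if "(j, s) \<in> rr_index m" for j s k
  proof -
    have "(q + 1) * j = rr_exponent (j, s) + s"
      using rr_index_bounds(2)[OF m that] by (simp add: rr_exponent_def)
    hence "(a k ^ (q + 1)) ^ j = a k ^ rr_exponent (j, s) * a k ^ s"
      by (metis power_add power_mult)
    thus ?thesis using a[of k] unfolding b power_mult_distrib by simp
  qed
  have eq: "(\<Sum>(j, s)\<in>rr_index m. c (j, s) * (b k ^ j / a k ^ s)) =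
      (\<Sum>n\<in>rr_exponent ` rr_index m. g n * a k ^ n)"
    if "\<And>j s. (j, s) \<in> rr_index m \<Longrightarrow> g (rr_exponent (j, s)) = c (j, s) * \<kappa> ^ j" for c g k
    unfolding sum.reindex[OF inj]
  proof (rule sum.cong[OF refl], clarify)
    fix j s assume js: "(j, s) \<in> rr_index m"
    show "c (j, s) * (b k ^ j / a k ^ s) = ((\<lambda>n. g n * a k ^ n) \<circ> rr_exponent) (j, s)"
      by (simp only: mono[OF js] that[OF js] mult.assoc o_def)
  qed
  show ?thesis
  proof (intro equalityI subsetI)
    fix w assume "w \<in> {(\<chi> k. \<Sum>(j, s)\<in>rr_index m. c (j, s) * (b k ^ j / a k ^ s)) | c. True}"
    then obtain c where w: "w = (\<chi> k. \<Sum>(j, s)\<in>rr_index m. c (j, s) * (b k ^ j / a k ^ s))" by blast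
    \<comment> \<open>Distinct pairs have distinct exponents, so the factor
      \<open>\<kappa>^j\<close> can be absorbed into the coefficient of the exponent.\<close>
    define g where "g = (\<lambda>n. let p = the_inv_into (rr_index m) rr_exponent n in c p * \<kappa> ^ fst p)"
    have "g (rr_exponent (j, s)) = c (j, s) * \<kappa> ^ j" if "(j, s) \<in> rr_index m" for j s
      using the_inv_into_f_f[OF inj that] by (simp add: g_def)
    hence "w = (\<chi> k. \<Sum>n\<in>rr_exponent ` rr_index m. g n * a k ^ n)"
      unfolding w using eq[of g c] by simp
    thus "w \<in> monomial_code a (rr_exponent ` rr_index m)" unfolding monomial_code_def by blast
  next
    fix w assume "w \<in> monomial_code a (rr_exponent ` rr_index m)"
    then obtain g where w: "w = (\<chi> k. \<Sum>n\<in>rr_exponent ` rr_index m. g n * a k ^ n)"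
      unfolding monomial_code_def by blast
    define c where "c = (\<lambda>(j, s). g (rr_exponent (j, s)) / \<kappa> ^ j)"
    have "g (rr_exponent (j, s)) = c (j, s) * \<kappa> ^ j" for j s
      using \<kappa> by (simp add: c_def)
    hence "w = (\<chi> k. \<Sum>(j, s)\<in>rr_index m. c (j, s) * (b k ^ j / a k ^ s))"
      unfolding w using eq[of g c] by simp
    thus "w \<in> {(\<chi> k. \<Sum>(j, s)\<in>rr_index m. c (j, s) * (b k ^ j / a k ^ s)) | c. True}" by blast
  qed
qed

end

text \<open>The \<open>N\<close> exponents reach all \<open>N\<close> nonzero elements, so they
  reach each only once.\<close>

lemma generator_powers:
  fixes \<omega> :: "'a::{field, finite}"
  assumes card: "CARD('a) = Suc N" and \<omega>: "\<omega> \<noteq> 0" and gen: "\<forall>z. z \<noteq> 0 \<longrightarrow> (\<exists>k::nat. z = \<omega> ^ k)"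
  shows "\<omega> ^ N = 1" "inj_on (\<lambda>i. \<omega> ^ i) {1..N}"
proof -
  have "\<omega> * \<omega> ^ N = \<omega> * 1" using finite_field_power_card[of \<omega>] card by simp
  thus one: "\<omega> ^ N = 1" using \<omega> by simp
  have "card {0, 1 :: 'a} \<le> CARD('a)" by (intro card_mono) auto
  hence N: "N > 0" using card by simp
  have "(\<lambda>i. \<omega> ^ i) ` {1..N} = - {0}"
  proof (intro equalityI subsetI)
    fix z assume "z \<in> - {0 :: 'a}"
    then obtain k where k: "z = \<omega> ^ k" using gen by auto
    have "\<omega> ^ k = (\<omega> ^ N) ^ (k div N) * \<omega> ^ (k mod N)"
      by (simp flip: power_mult power_add)
    hence z: "z = \<omega> ^ (k mod N)" using k one by simp
    show "z \<in> (\<lambda>i. \<omega> ^ i) ` {1..N}"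
    \<comment> \<open>Exponents start at 1, so \<open>N\<close> stands in for the residue 0.\<close>
    proof (cases "k mod N = 0")
      case True
      thus ?thesis using z one N by (intro image_eqI[of _ _ N]) auto
    next
      case False
      moreover have "k mod N < N" using N by simp
      ultimately show ?thesis using z by (intro image_eqI[of _ _ "k mod N"]) auto
    qed
  qed (use \<omega> in auto)
  hence "card ((\<lambda>i. \<omega> ^ i) ` {1..N}) = card {1..N}"
    using card by (simp add: card_Diff_subset Compl_eq_Diff_UNIV)
  thus "inj_on (\<lambda>i. \<omega> ^ i) {1..N}" by (intro eq_card_imp_inj_on) auto
qed

theorem theorem1:
  fixes q m :: nat
    and \<omega> u v :: "'a::{field, finite}"
    and y :: "'a ambient"
    and e :: "'n::finite \<Rightarrow> nat"
  assumes "primepow q" and "q \<ge> 3" and "CARD('a) = q ^ 2"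
    and "2 \<le> m" and "m \<le> q - 1"
    and "y ^ q + y = ff_x ^ (q + 1)"
    and "u \<noteq> 0" and "v ^ q + v = u ^ (q + 1)"
    and "\<omega> \<noteq> 0" and "\<forall>z. z \<noteq> 0 \<longrightarrow> (\<exists>k::nat. z = \<omega> ^ k)"
    and "bij_betw e UNIV {1..q ^ 2 - 1}"
  shows "\<exists>d.
    is_linear_code (functional_ag_code y (\<lambda>j. hermitian_Q q y \<omega> u v (e j)) (hermitian_G q y m))
      (q ^ 2 - 1) (m * (m - 1) div 2 + 1) d \<and>
    int q ^ 2 - 1 - (int q * (int m - 1) - 1) \<le> int d \<and>
    int d \<le> int q ^ 2 - 1 - (int m - 2) * (int q + 1) \<and>
    divisor_degree y (hermitian_G q y m) = int m * (int q - 1) \<and>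
    int d - (int q ^ 2 - 1 - divisor_degree y (hermitian_G q y m)) \<ge> int q + 1 - int m"
proof -
  interpret hermitian q y by unfold_locales (use assms in auto)
  define N where "N = q ^ 2 - 1"
  have qN: "q ^ 2 = Suc N" using assms(2) by (simp add: N_def)
  have N: "N = (q + 1) * (q - 1)"
    using assms(2) by (simp add: N_def power2_eq_square diff_mult_distrib2)
  have card_n: "CARD('n) = N" using bij_betw_same_card[OF assms(11)] by (simp add: N_def)
  have e: "e k \<in> {1..N}" for k using assms(11) by (auto simp: bij_betw_def N_def)
  have e_inj: "inj e" and "range e = {1..N}" using assms(11) by (auto simp: bij_betw_def N_def)
  hence e_surj: "\<exists>k. e k = i" if "i \<in> {1..N}" for i using that by (metis rangeE)
  have card_a: "CARD('a) = Suc N" using assms(3) qN by simp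
  note \<omega>N = generator_powers[OF card_a assms(9,10)]
  define \<kappa> where "\<kappa> = v / u ^ (q + 1)"
  have "v \<noteq> 0"
  proof
    assume "v = 0"
    hence "u ^ (q + 1) = 0" using assms(2,8) by (simp add: zero_power)
    thus False using assms(7) by simp
  qed
  hence \<kappa>: "\<kappa> \<noteq> 0" using assms(7) by (simp add: \<kappa>_def)
  define a where "a = (\<lambda>k. \<omega> ^ e k * u)"
  define b where "b = (\<lambda>k. \<omega> ^ ((q + 1) * e k) * v)"
  have a: "a k \<noteq> 0" for k using assms(7,9) by (simp add: a_def)
  have b_eq: "b k = \<kappa> * a k ^ (q + 1)" for k
    using assms(7) by (simp add: a_def b_def \<kappa>_def power_mult_distrib power_mult[symmetric] mult.commute del: power_Suc)
  \<comment> \<open>The norm \<open>u^(q+1)\<close> is fixed by the \<open>q\<close>-th power and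
    factors out of the curve equation at \<open>(u, v)\<close>. What remains,
    \<open>\<kappa>^q + \<kappa> = 1\<close>, puts every point with
    \<open>y = \<kappa> x^(q+1)\<close> on the curve.\<close>
  have "(\<kappa> ^ q + \<kappa>) * u ^ (q + 1) = v ^ q + v"
  proof -
    have "\<kappa> ^ q * u ^ (q + 1) = v ^ q"
      using assms(7) unfolding \<kappa>_def power_divide norm_frobenius by simp
    moreover have "\<kappa> * u ^ (q + 1) = v" using assms(7) by (simp add: \<kappa>_def)
    ultimately show ?thesis by (simp only: distrib_right)
  qed
  hence \<kappa>1: "\<kappa> ^ q + \<kappa> = 1" using assms(7,8) by simp
  have curve: "b k ^ q + b k = a k ^ (q + 1)" for k
    unfolding b_eq power_mult_distrib[of \<kappa>] norm_frobenius
    by (simp only: distrib_right[symmetric] \<kappa>1 mult_1)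
  define E where "E = rr_exponent ` rr_index m"
  define C where "C = functional_ag_code y (\<lambda>j. hermitian_Q q y \<omega> u v (e j)) (hermitian_G q y m)"
  have C_rr: "C = {(\<chi> k. \<Sum>(j, s)\<in>rr_index m. c (j, s) * (b k ^ j / a k ^ s)) | c. True}"
    unfolding C_def using rr_code_altdef[OF assms(5), of b a] curve a
    by (simp add: hermitian_Q_def a_def b_def)
  have C_mono: "C = monomial_code a E"
    unfolding C_rr E_def using b_eq \<kappa> a by (rule rr_code_monomial[OF assms(5)])
  have inj_a: "inj a"
  proof (rule injI)
    fix k k' assume "a k = a k'"
    hence "\<omega> ^ e k = \<omega> ^ e k'" using assms(7) by (simp add: a_def)
    hence "e k = e k'" using inj_onD[OF \<omega>N(2)] e by blast
    thus "k = k'" using e_inj by (simp add: inj_eq)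
  qed
  define D where "D = q * (m - 1) - 1"
  have finE: "finite E" "E \<noteq> {}"
    using finite_rr_index[of m] by (auto simp: E_def) (auto simp: rr_index_def)
  have ED: "E \<subseteq> {..D}" unfolding E_def D_def by (rule rr_exponent_le[OF assms(4)])
  \<comment> \<open>The lower bound keeps the subtraction in \<open>D\<close> exact; the upper one
    gives \<open>D < N\<close>, so that evaluation is injective.\<close>
  have qm: "1 \<le> q * (m - 1)" "q * (m - 1) < q * q" using assms(2,4,5) by auto
  hence DN: "D < N" unfolding D_def N_def power2_eq_square by linarith
  have cardE: "card E = m * (m - 1) div 2 + 1"
    unfolding E_def card_image[OF inj_on_rr_exponent[OF assms(5)]] by (rule card_rr_index)
  obtain d where d: "is_linear_code C N (card E) d" "N - D \<le> d"
    "\<And>c. c \<in> C \<Longrightarrow> c \<noteq> 0 \<Longrightarrow> d \<le> card {k. c $ k \<noteq> 0}"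
    using monomial_code_parameters[OF inj_a finE ED, folded C_mono] DN card_n by metis

  have upper: "d \<le> N - (m - 2) * (q + 1)"
  proof -
    \<comment> \<open>\<open>\<beta> l\<close> is the value of y at \<open>Q_l\<close>. Pairs with
      \<open>s = m\<close> need \<open>1 <= j < m\<close>, so \<open>T\<close> has degree at most
      \<open>m - 1\<close> and no constant term; the factor y ensures the latter and leaves
      \<open>m - 2\<close> roots to choose.\<close>
    define \<beta> where "\<beta> = (\<lambda>l. \<omega> ^ ((q + 1) * l) * v)"
    define T where "T = pCons 0 (\<Prod>l\<in>{1..m - 2}. [:- \<beta> l, 1:])"
    have deg: "degree T \<le> m - 1"
    proof -
      have "degree (\<Prod>l\<in>{1..m - 2}. [:- \<beta> l, 1:]) = m - 2"
        by (simp add: degree_prod_eq_sum_degree)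
      thus ?thesis unfolding T_def using degree_pCons_le[of 0 "\<Prod>l\<in>{1..m - 2}. [:- \<beta> l, 1:]"] assms(4) by simp
    qed
    define w where "w = (\<chi> k. poly T (b k) / a k ^ m)"
    have "w \<in> C"
    proof -
      define c where "c = (\<lambda>(j, s). if s = m then coeff T j else 0)"
      have "(\<Sum>(j, s)\<in>rr_index m. c (j, s) * (b k ^ j / a k ^ s)) = poly T (b k) / a k ^ m" for k
      proof -
        have "(\<Sum>(j, s)\<in>rr_index m. c (j, s) * (b k ^ j / a k ^ s)) =
            (\<Sum>(j, s)\<in>{1..m - 1} \<times> {m}. c (j, s) * (b k ^ j / a k ^ s))"
        proof (rule sum.mono_neutral_right[OF finite_rr_index])
          show "{1..m - 1} \<times> {m} \<subseteq> rr_index m" using assms(4) by (auto simp: rr_index_def)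
          show "\<forall>p\<in>rr_index m - {1..m - 1} \<times> {m}. (case p of (j, s) \<Rightarrow> c (j, s) * (b k ^ j / a k ^ s)) = 0"
            using assms(4) by (auto simp: rr_index_def c_def split: if_splits)
        qed
        also have "\<dots> = (\<Sum>j\<in>{1..m - 1}. coeff T j * b k ^ j / a k ^ m)"
          by (simp add: sum.cartesian_product[symmetric] c_def)
        also have "\<dots> = (\<Sum>j\<in>{1..m - 1}. coeff T j * b k ^ j) / a k ^ m"
          by (simp add: sum_divide_distrib)
        also have "(\<Sum>j\<in>{1..m - 1}. coeff T j * b k ^ j) = (\<Sum>j\<le>m - 1. coeff T j * b k ^ j)"
          by (rule sum.mono_neutral_left) (auto simp: T_def coeff_pCons split: nat.splits)
        also have "\<dots> = (\<Sum>j\<le>degree T. coeff T j * b k ^ j)"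
          by (rule sum.mono_neutral_right) (use deg in \<open>auto simp: coeff_eq_0\<close>)
        also have "\<dots> = poly T (b k)" by (simp add: poly_altdef)
        finally show ?thesis .
      qed
      thus ?thesis unfolding C_rr w_def by (intro CollectI exI[of _ c]) simp
    qed
    have w_zero: "w $ k = 0 \<longleftrightarrow> (\<exists>l\<in>{1..m - 2}. b k = \<beta> l)" for k
      using a[of k] \<kappa> b_eq[of k] by (auto simp: w_def T_def poly_prod prod_zero_iff)
    have "w \<noteq> 0"
    proof
      assume "w = 0"
      have "1 * (q - 1) \<le> N" unfolding N by (rule mult_le_mono1) simp
      moreover have "1 \<le> q - 1" using assms(2) by linarith
      \<comment> \<open>As \<open>(q+1)(q-1) = N\<close>, y takes the value \<open>v\<close> at
        \<open>Q_(q-1)\<close>; the chosen roots have indices \<open>l <= m - 2 < q - 1\<close> and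
        miss it.\<close>
      ultimately obtain k where k: "e k = q - 1" using e_surj[of "q - 1"] by auto
      have "b k = v" unfolding b_def k N[symmetric] \<omega>N(1) by simp
      moreover obtain l where l: "l \<in> {1..m - 2}" "b k = \<beta> l"
        using w_zero[of k] \<open>w = 0\<close> by auto
      ultimately have "\<omega> ^ ((q + 1) * l) = \<omega> ^ N" using \<open>v \<noteq> 0\<close> \<omega>N(1) by (simp add: \<beta>_def)
      moreover have lt: "(q + 1) * l < N"
        unfolding N using l(1) assms(4,5) by (intro mult_strict_left_mono) auto
      moreover have "(q + 1) * l \<in> {1..N}" "N \<in> {1..N}" using l(1) lt by auto
      ultimately show False using inj_onD[OF \<omega>N(2)] by blast
    qed
    have "d \<le> card {k. w $ k \<noteq> 0}" by (rule d(3)[OF \<open>w \<in> C\<close> \<open>w \<noteq> 0\<close>])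
    also have "{k. w $ k \<noteq> 0} = - {k. w $ k = 0}" by auto
    also have "card \<dots> = N - card {k. w $ k = 0}" by (simp add: card_Diff_subset Compl_eq_Diff_UNIV card_n)
    finally have "d \<le> N - card {k. w $ k = 0}" .
    moreover have "(m - 2) * (q + 1) \<le> card {k. w $ k = 0}"
    proof -
      \<comment> \<open>Indices congruent modulo \<open>q - 1\<close> share the value of y, again by
        \<open>(q+1)(q-1) = N\<close>; so each of the \<open>m - 2\<close> roots accounts for
        \<open>q + 1\<close> zeros.\<close>
      define Z where "Z = (\<lambda>(l, t). l + t * (q - 1)) ` ({1..m - 2} \<times> {..q})"
      have "inj_on (\<lambda>(l, t). l + t * (q - 1)) ({1..m - 2} \<times> {..q})"
      proof (rule inj_onI, clarify)
        fix l t l' t' assume l: "l \<in> {1..m - 2}" "l' \<in> {1..m - 2}"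
          and eq: "l + t * (q - 1) = l' + t' * (q - 1)"
        have "l < q - 1" "l' < q - 1" using l assms(4,5) by auto
        hence "l = l'" using arg_cong[OF eq, of "\<lambda>n. n mod (q - 1)"]
          by (simp only: mod_mult_self1 mod_less)
        moreover from this have "t = t'" using eq assms(2) by simp
        ultimately show "l = l' \<and> t = t'" by simp
      qed
      hence cardZ: "card Z = (m - 2) * (q + 1)" unfolding Z_def by (simp add: card_image)
      have "Z \<subseteq> e ` {k. w $ k = 0}"
      proof
        fix i assume "i \<in> Z"
        then obtain l t where i: "i = l + t * (q - 1)" "l \<in> {1..m - 2}" "t \<le> q" by (auto simp: Z_def)
        have "t * (q - 1) \<le> q * (q - 1)" using i(3) by (rule mult_le_mono1)
        moreover have "l \<le> q - 1" using i(2) assms(4,5) by auto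
        moreover have "N = (q - 1) + q * (q - 1)" by (simp add: N)
        ultimately have "i \<le> N" unfolding i(1) by linarith
        then obtain k where k: "e k = i" using e_surj[of i] i by auto
        have "b k = \<omega> ^ ((q + 1) * l) * (\<omega> ^ N) ^ t * v"
          unfolding b_def k i(1) N by (simp flip: power_mult power_add add: algebra_simps del: mult_Suc)
        hence "b k = \<beta> l" by (simp add: \<omega>N(1) \<beta>_def)
        hence "w $ k = 0" using w_zero i(2) by blast
        thus "i \<in> e ` {k. w $ k = 0}" using k by blast
      qed
      hence "card Z \<le> card (e ` {k. w $ k = 0})" by (intro card_mono) auto
      also have "\<dots> = card {k. w $ k = 0}" by (rule card_image[OF inj_on_subset[OF e_inj]]) simp
      finally show ?thesis using cardZ by simp
    qed
    ultimately show ?thesis by linarith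
  qed

  have m0: "m > 0" using assms(4) by simp
  have deg: "divisor_degree y (hermitian_G q y m) = int m * (int q - 1)"
    by (rule divisor_degree_hermitian_G[OF m0])
  have iN: "int N = int q ^ 2 - 1" using qN by (metis of_nat_Suc of_nat_power add_diff_cancel_left')
  have iD: "int D = int q * (int m - 1) - 1"
    using qm(1) m0 by (simp add: D_def of_nat_diff)
  have lo: "int N - int D \<le> int d" using d(2) DN by linarith
  have "(m - 2) * (q + 1) \<le> (q - 1) * (q + 1)" using assms(5) by (intro mult_le_mono1) simp
  hence "(m - 2) * (q + 1) \<le> N" by (simp add: N mult.commute)
  hence "int d \<le> int N - int ((m - 2) * (q + 1))" using upper by linarith
  moreover have "int ((m - 2) * (q + 1)) = (int m - 2) * (int q + 1)"
    by (simp only: of_nat_mult of_nat_diff[OF assms(4)] of_nat_add of_nat_1 of_nat_numeral)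
  ultimately have hi: "int d \<le> int q ^ 2 - 1 - (int m - 2) * (int q + 1)" unfolding iN by simp
  show ?thesis
  proof (intro exI[of _ d] conjI)
    show "is_linear_code (functional_ag_code y (\<lambda>j. hermitian_Q q y \<omega> u v (e j)) (hermitian_G q y m))
      (q ^ 2 - 1) (m * (m - 1) div 2 + 1) d"
      using d(1) unfolding C_def cardE N_def .
    show "int q ^ 2 - 1 - (int q * (int m - 1) - 1) \<le> int d"
      using lo unfolding iN iD .
    show "int d - (int q ^ 2 - 1 - divisor_degree y (hermitian_G q y m)) \<ge> int q + 1 - int m"
      using lo unfolding iN iD deg by (simp add: algebra_simps)
  qed (fact hi deg)+
qed

end
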